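(* Let $\mathbb{K}$ be a field of characteristic $0$ and $V$ a graded $\mathbb{K}$-vector space. Let $Q=d+\partial$ be a coderivation of degree $+1$ on $\bar T(V)$ (decomposed into the part $d$ preserving tensor length and the part $\partial$ strictly decreasing tensor length), whose restriction to $\bar S(V)$ is a codifferential, i.e. $Q^2=0$ on $\bar S(V)$. Let $W$ be a differential graded subspace of $(V,d_1)$, $d_1=Q|_V$, and let $(W,V,i,p,k)$ be a contraction, with $i\colon W\to V$ the inclusion. Let $(\bar T(W),\bar T(V),\imath,\pi,h)$ be the coalgebra contraction obtained by taking tensor powers, i.e. $\imath=T(i)$, $\pi=T(p)$, $h=Tk$. Set \[ D_\partial=\sum_{n\ge 0}\pi\partial(h\partial)^n\imath=\sum_{n\ge 0}\pi(\partial h)^n\partial\imath\colon \bar S(W)\to\bar S(W). \] Then $d+D_\partial$ is a codifferential in $\bar S(W)$, and \[ \imath_\partial=\sum_{n\ge 0}(h\partial)^n\imath\colon (\bar S(W),\,d+D_\partial)\to(\bar S(V),\,d+\partial) \] is a morphism of differential graded coalgebras. (Part of the assertion is that the maps $D_\partial\colon\bar T(W)\to\bar T(W)$ and $\imath_\partial\colon\bar T(W)\to\bar T(V)$ given by these formulas send $\bar S(W)$ to $\bar S(W)$ and to $\bar S(V)$, respectively.)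
   Context: All graded vector spaces are $\mathbb{Z}$-graded, differentials have degree $+1$, and the Koszul sign rule is used for tensor products of maps and elements. Coalgebras: $\bar T(V)=\bigoplus_{n\ge1}V^{\otimes n}$ is the reduced tensor coalgebra, with (non-counital) coproduct $\mathfrak a(x_1\otimes\cdots\otimes x_n)=\sum_{i=1}^{n-1}(x_1\otimes\cdots\otimes x_i)\otimes(x_{i+1}\otimes\cdots\otimes x_n)$. The symmetric group $\Sigma_n$ acts on $V^{\otimes n}$ by permuting factors with Koszul signs (generated by the twist $v\otimes w\mapsto(-1)^{\deg v\deg w}w\otimes v$), and $\bar S(V)=\bigoplus_{n\ge1}(V^{\otimes n})^{\Sigma_n}\subset\bar T(V)$ is the reduced symmetric coalgebra, a graded subcoalgebra of $\bar T(V)$. A coderivation of degree $+1$ of a graded coalgebra $(C,\Delta)$ is a degree $+1$ linear map $Q$ with $\Delta Q=(Q\otimes\mathrm{Id}+\mathrm{Id}\otimes Q)\Delta$; it is a codifferential if $Q^2=0$. Every coderivation of $\bar T(V)$ maps $\bar S(V)$ into itself. Decomposition: every coderivation $Q$ of degree $+1$ of $\bar T(V)$ decomposes uniquely as $Q=d+\partial$ with $d(V^{\otimes n})\subset V^{\otimes n}$ and $\partial(V^{\otimes n})\subset\bigoplus_{i=1}^{n-1}V^{\otimes i}$ for all $n>0$. Here $d(a_1\otimes\cdots\otimes a_n)=\sum_{i=0}^{n-1}(-1)^{\deg a_1+\cdots+\deg a_i}a_1\otimes\cdots\otimes a_i\otimes d_1(a_{i+1})\otimes a_{i+2}\otimes\cdots\otimes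 a_n$, where $d_1=Q|_V\colon V\to V$. If $Q$ is a codifferential on $\bar S(V)$ then $d_1^2=0$, so $(V,d_1)$ is a complex and $d$ is the natural differential on its tensor powers. The letter $d$ also denotes the natural differential on $\bar T(W)$ and $\bar S(W)$ induced by $d_1|_W$. Contractions: a contraction $(M,N,\imath,\pi,h)$ consists of differential graded vector spaces $M,N$, cochain maps $\imath\colon M\to N$ and $\pi\colon N\to M$, and a degree $-1$ linear map $h\colon N\to N$ such that $\pi\imath=\mathrm{Id}_M$, $\imath\pi-\mathrm{Id}_N=d_Nh+hd_N$, $\pi h=0$, $h\imath=0$, $h^2=0$. Tensor powers: for a contraction $(W,V,i,p,k)$, put $T(i)=\sum_n i^{\otimes n}$, $T(p)=\sum_n p^{\otimes n}$, $Tk=\sum_{n\ge1}T^nk$ with $T^nk=\sum_{j=1}^n(ip)^{\otimes j-1}\otimes k\otimes\mathrm{Id}_V^{\otimes n-j}$ on $V^{\otimes n}$. Then $(\bar T(W),\bar T(V),T(i),T(p),Tk)$ is a contraction for the natural differentials $d$; it is a coalgebra contraction, meaning that $T(i),T(p)$ are coalgebra morphisms and $(T(ip)\otimes Tk+Tk\otimes\mathrm{Id})\circ\mathfrak a=\mathfrak a\circ Tk$. The infinite sums are finite on each element because $\partial$ strictly lowers tensor length and $h$ preserves it. *)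

theory Defs
  imports Complex_Main "HOL-Library.Function_Algebras" "HOL-Library.Groups_Big_Fun"
begin

text \<open>
  A graded vector space is given by the family \<open>V :: int \<Rightarrow> 'v set\<close> of its homogeneous components,
  which are subspaces of an ambient vector space with scalar multiplication \<open>s\<close>; the underlying
  vector space is the sum \<open>gtot s V\<close> of the components, required to be direct.
\<close>

definition gtot :: "('k::field \<Rightarrow> 'v::ab_group_add \<Rightarrow> 'v) \<Rightarrow> (int \<Rightarrow> 'v set) \<Rightarrow> 'v set" where
  "gtot s V = module.span s (\<Union>n. V n)"

definition hdecomp :: "(int \<Rightarrow> 'v::ab_group_add set) \<Rightarrow> 'v \<Rightarrow> (int \<Rightarrow> 'v) \<Rightarrow> bool" where
  "hdecomp V v c \<longleftrightarrow> (\<forall>n. c n \<in> V n) \<and> finite {n. c n \<noteq> 0} \<and> v = Sum_any c"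

definition graded_space :: "('k::field \<Rightarrow> 'v::ab_group_add \<Rightarrow> 'v) \<Rightarrow> (int \<Rightarrow> 'v set) \<Rightarrow> bool" where
  "graded_space s V \<longleftrightarrow> vector_space s \<and> (\<forall>n. module.subspace s (V n)) \<and>
     (\<forall>v\<in>gtot s V. \<exists>!c. hdecomp V v c)"

definition graded_subspace ::
    "('k::field \<Rightarrow> 'v::ab_group_add \<Rightarrow> 'v) \<Rightarrow> (int \<Rightarrow> 'v set) \<Rightarrow> (int \<Rightarrow> 'v set) \<Rightarrow> bool" where
  "graded_subspace s W V \<longleftrightarrow> (\<forall>n. module.subspace s (W n) \<and> W n \<subseteq> V n)"

definition hpart :: "(int \<Rightarrow> 'v::ab_group_add set) \<Rightarrow> int \<Rightarrow> 'v \<Rightarrow> 'v" where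
  "hpart V n v = (THE c. hdecomp V v c) n"

text \<open>
  The sign \<open>(-1)^(e * deg v)\<close> created by moving something of degree \<open>e\<close> past \<open>v\<close>, extended linearly
  to inhomogeneous \<open>v\<close>.
\<close>

definition koszul ::
    "('k::field \<Rightarrow> 'v::ab_group_add \<Rightarrow> 'v) \<Rightarrow> (int \<Rightarrow> 'v set) \<Rightarrow> int \<Rightarrow> 'v \<Rightarrow> 'v" where
  "koszul s V e v = Sum_any (\<lambda>n. s (if even (e * n) then 1 else - 1) (hpart V n v))"

definition lin_on :: "('k::field \<Rightarrow> 'v::ab_group_add \<Rightarrow> 'v) \<Rightarrow> ('k \<Rightarrow> 'w::ab_group_add \<Rightarrow> 'w) \<Rightarrow>
    'v set \<Rightarrow> ('v \<Rightarrow> 'w) \<Rightarrow> bool" where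
  "lin_on s s' A f \<longleftrightarrow> (\<forall>x\<in>A. \<forall>y\<in>A. f (x + y) = f x + f y) \<and> (\<forall>c. \<forall>x\<in>A. f (s c x) = s' c (f x))"

definition graded_map :: "('k::field \<Rightarrow> 'v::ab_group_add \<Rightarrow> 'v) \<Rightarrow> int \<Rightarrow>
    (int \<Rightarrow> 'v set) \<Rightarrow> (int \<Rightarrow> 'v set) \<Rightarrow> ('v \<Rightarrow> 'v) \<Rightarrow> bool" where
  "graded_map s e M N f \<longleftrightarrow> lin_on s s (gtot s M) f \<and> (\<forall>n. f ` M n \<subseteq> N (n + e))"


subsection \<open>Differential graded vector spaces and contractions\<close>

definition dg_space ::
    "('k::field \<Rightarrow> 'v::ab_group_add \<Rightarrow> 'v) \<Rightarrow> (int \<Rightarrow> 'v set) \<Rightarrow> ('v \<Rightarrow> 'v) \<Rightarrow> bool" where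
  "dg_space s M d \<longleftrightarrow> graded_space s M \<and> graded_map s 1 M M d \<and> (\<forall>x\<in>gtot s M. d (d x) = 0)"

definition cochain_map :: "('k::field \<Rightarrow> 'v::ab_group_add \<Rightarrow> 'v) \<Rightarrow> (int \<Rightarrow> 'v set) \<Rightarrow> ('v \<Rightarrow> 'v) \<Rightarrow>
    (int \<Rightarrow> 'v set) \<Rightarrow> ('v \<Rightarrow> 'v) \<Rightarrow> ('v \<Rightarrow> 'v) \<Rightarrow> bool" where
  "cochain_map s M dM N dN f \<longleftrightarrow> graded_map s 0 M N f \<and> (\<forall>x\<in>gtot s M. f (dM x) = dN (f x))"

definition contraction :: "('k::field \<Rightarrow> 'v::ab_group_add \<Rightarrow> 'v) \<Rightarrow> (int \<Rightarrow> 'v set) \<Rightarrow> ('v \<Rightarrow> 'v) \<Rightarrow>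
    (int \<Rightarrow> 'v set) \<Rightarrow> ('v \<Rightarrow> 'v) \<Rightarrow> ('v \<Rightarrow> 'v) \<Rightarrow> ('v \<Rightarrow> 'v) \<Rightarrow> ('v \<Rightarrow> 'v) \<Rightarrow> bool" where
  "contraction s M dM N dN i p h \<longleftrightarrow>
     dg_space s M dM \<and> dg_space s N dN \<and>
     cochain_map s M dM N dN i \<and> cochain_map s N dN M dM p \<and> graded_map s (- 1) N N h \<and>
     (\<forall>x\<in>gtot s M. p (i x) = x) \<and>
     (\<forall>x\<in>gtot s N. i (p x) - x = dN (h x) + h (dN x)) \<and>
     (\<forall>x\<in>gtot s N. p (h x) = 0) \<and>
     (\<forall>x\<in>gtot s M. h (i x) = 0) \<and>
     (\<forall>x\<in>gtot s N. h (h x) = 0)"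


subsection \<open>Tensors\<close>

text \<open>
  Over a field, \<open>V\<^sub>1 \<otimes> \<dots> \<otimes> V\<^sub>n\<close> embeds canonically into the dual of the space of multilinear
  forms on \<open>V\<^sub>1 \<times> \<dots> \<times> V\<^sub>n\<close>, the pure tensor \<open>v\<^sub>1 \<otimes> \<dots> \<otimes> v\<^sub>n\<close> going to the evaluation at
  \<open>(v\<^sub>1, \<dots>, v\<^sub>n)\<close>; tensor products are realised here as the spans of these evaluations. A form
  takes a list of vectors of any length, so that one function \<open>\<phi>\<close> collects a multilinear form on
  each \<open>V\<^sup>n\<close>, and all tensor powers live in the same function space, where tensors of
  different lengths are linearly independent.
\<close>

definition fscale :: "'k::field \<Rightarrow> ('a \<Rightarrow> 'k) \<Rightarrow> 'a \<Rightarrow> 'k" where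
  "fscale c z = (\<lambda>\<phi>. c * z \<phi>)"

lemma vector_space_fscale: "vector_space (fscale :: 'k::field \<Rightarrow> ('a \<Rightarrow> 'k) \<Rightarrow> 'a \<Rightarrow> 'k)"
  by unfold_locales (auto simp: fscale_def fun_eq_iff algebra_simps)

type_synonym ('k, 'v) tensor = "('v list \<Rightarrow> 'k) \<Rightarrow> 'k"
type_synonym ('k, 't) tensor2 = "('t \<Rightarrow> 't \<Rightarrow> 'k) \<Rightarrow> 'k"

definition multilinear_form ::
    "('k::field \<Rightarrow> 'v::ab_group_add \<Rightarrow> 'v) \<Rightarrow> (int \<Rightarrow> 'v set) \<Rightarrow> ('v list \<Rightarrow> 'k) \<Rightarrow> bool" where
  "multilinear_form s V \<phi> \<longleftrightarrow>
     (\<forall>xs ys. set xs \<subseteq> gtot s V \<longrightarrow> set ys \<subseteq> gtot s V \<longrightarrow>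
        lin_on s (*) (gtot s V) (\<lambda>v. \<phi> (xs @ v # ys)))"

definition bilinear_form ::
    "('k::field \<Rightarrow> 't::ab_group_add \<Rightarrow> 't) \<Rightarrow> (int \<Rightarrow> 't set) \<Rightarrow> ('t \<Rightarrow> 't \<Rightarrow> 'k) \<Rightarrow> bool" where
  "bilinear_form s A \<beta> \<longleftrightarrow>
     (\<forall>x\<in>gtot s A. lin_on s (*) (gtot s A) (\<lambda>y. \<beta> x y) \<and> lin_on s (*) (gtot s A) (\<lambda>y. \<beta> y x))"

definition tens :: "('k::field \<Rightarrow> 'v::ab_group_add \<Rightarrow> 'v) \<Rightarrow> (int \<Rightarrow> 'v set) \<Rightarrow>
    'v list \<Rightarrow> ('k, 'v) tensor" where
  "tens s V xs = (\<lambda>\<phi>. if multilinear_form s V \<phi> then \<phi> xs else 0)"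

definition tens2 :: "('k::field \<Rightarrow> 't::ab_group_add \<Rightarrow> 't) \<Rightarrow> (int \<Rightarrow> 't set) \<Rightarrow>
    't \<Rightarrow> 't \<Rightarrow> ('k, 't) tensor2" where
  "tens2 s A x y = (\<lambda>\<beta>. if bilinear_form s A \<beta> then \<beta> x y else 0)"

text \<open>
  Universal property: \<open>tlift g\<close> is the linear map with \<open>v\<^sub>1 \<otimes> \<dots> \<otimes> v\<^sub>n \<mapsto> g [v\<^sub>1, \<dots>, v\<^sub>n]\<close>, for \<open>g\<close>
  multilinear with values in a space of functionals; \<open>tlift2\<close> is the analogue for bilinear \<open>g\<close>.
\<close>

definition tlift :: "('v list \<Rightarrow> 'a \<Rightarrow> 'k) \<Rightarrow> ('k, 'v) tensor \<Rightarrow> 'a \<Rightarrow> 'k" where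
  "tlift g z = (\<lambda>\<phi>. z (\<lambda>xs. g xs \<phi>))"

definition tlift2 :: "('t \<Rightarrow> 't \<Rightarrow> 'a \<Rightarrow> 'k) \<Rightarrow> ('k, 't) tensor2 \<Rightarrow> 'a \<Rightarrow> 'k" where
  "tlift2 g z = (\<lambda>\<phi>. z (\<lambda>x y. g x y \<phi>))"

lemma tlift_tens:
  assumes "\<And>\<phi>. multilinear_form s V (\<lambda>xs. g xs \<phi>)"
  shows "tlift g (tens s V xs) = g xs"
  using assms by (simp add: tlift_def tens_def)

lemma tlift2_tens2:
  assumes "\<And>\<phi>. bilinear_form s A (\<lambda>x y. g x y \<phi>)"
  shows "tlift2 g (tens2 s A x y) = g x y"
  using assms by (simp add: tlift2_def tens2_def)


subsection \<open>Graded coalgebras\<close>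

text \<open>
  \<open>tmap2 s M N e f g\<close> is \<open>f \<otimes> g : M \<otimes> M \<rightarrow> N \<otimes> N\<close>, where \<open>e\<close> is the degree of \<open>g\<close>:
  \<open>(f \<otimes> g) (x \<otimes> y) = (-1)^(e * deg x) f x \<otimes> g y\<close>. Both maps have to be linear on all of \<open>M\<close>.
\<close>

definition tmap2 :: "('k::field \<Rightarrow> 't::ab_group_add \<Rightarrow> 't) \<Rightarrow> (int \<Rightarrow> 't set) \<Rightarrow> (int \<Rightarrow> 't set) \<Rightarrow>
    int \<Rightarrow> ('t \<Rightarrow> 't) \<Rightarrow> ('t \<Rightarrow> 't) \<Rightarrow> ('k, 't) tensor2 \<Rightarrow> ('k, 't) tensor2" where
  "tmap2 s M N e f g = tlift2 (\<lambda>x y. tens2 s N (f (koszul s M e x)) (g y))"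

text \<open>
  Below, \<open>C\<close> is a graded subcoalgebra of a graded coalgebra \<open>A\<close> with coproduct \<open>\<Delta>\<close>; elements of
  \<open>C \<otimes> C\<close> are regarded as elements of \<open>A \<otimes> A\<close>, and the maps on \<open>C\<close> are restrictions of linear maps
  on \<open>A\<close>.
\<close>

definition coderivation :: "('k::field \<Rightarrow> 't::ab_group_add \<Rightarrow> 't) \<Rightarrow> (int \<Rightarrow> 't set) \<Rightarrow>
    ('t \<Rightarrow> ('k, 't) tensor2) \<Rightarrow> (int \<Rightarrow> 't set) \<Rightarrow> ('t \<Rightarrow> 't) \<Rightarrow> bool" where
  "coderivation s A \<Delta> C Q \<longleftrightarrow> graded_map s 1 C C Q \<and>
     (\<forall>x\<in>gtot s C. \<Delta> (Q x) = tmap2 s A A 0 Q id (\<Delta> x) + tmap2 s A A 1 id Q (\<Delta> x))"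

definition codifferential :: "('k::field \<Rightarrow> 't::ab_group_add \<Rightarrow> 't) \<Rightarrow> (int \<Rightarrow> 't set) \<Rightarrow>
    ('t \<Rightarrow> ('k, 't) tensor2) \<Rightarrow> (int \<Rightarrow> 't set) \<Rightarrow> ('t \<Rightarrow> 't) \<Rightarrow> bool" where
  "codifferential s A \<Delta> C Q \<longleftrightarrow> coderivation s A \<Delta> C Q \<and> (\<forall>x\<in>gtot s C. Q (Q x) = 0)"

definition coalgebra_morphism :: "('k::field \<Rightarrow> 't::ab_group_add \<Rightarrow> 't) \<Rightarrow>
    (int \<Rightarrow> 't set) \<Rightarrow> ('t \<Rightarrow> ('k, 't) tensor2) \<Rightarrow> (int \<Rightarrow> 't set) \<Rightarrow>
    (int \<Rightarrow> 't set) \<Rightarrow> ('t \<Rightarrow> ('k, 't) tensor2) \<Rightarrow> (int \<Rightarrow> 't set) \<Rightarrow> ('t \<Rightarrow> 't) \<Rightarrow> bool" where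
  "coalgebra_morphism s A \<Delta> C A' \<Delta>' C' F \<longleftrightarrow> graded_map s 0 C C' F \<and>
     (\<forall>x\<in>gtot s C. \<Delta>' (F x) = tmap2 s A A' 0 F F (\<Delta> x))"

definition dg_coalgebra_morphism :: "('k::field \<Rightarrow> 't::ab_group_add \<Rightarrow> 't) \<Rightarrow>
    (int \<Rightarrow> 't set) \<Rightarrow> ('t \<Rightarrow> ('k, 't) tensor2) \<Rightarrow> (int \<Rightarrow> 't set) \<Rightarrow> ('t \<Rightarrow> 't) \<Rightarrow>
    (int \<Rightarrow> 't set) \<Rightarrow> ('t \<Rightarrow> ('k, 't) tensor2) \<Rightarrow> (int \<Rightarrow> 't set) \<Rightarrow> ('t \<Rightarrow> 't) \<Rightarrow> ('t \<Rightarrow> 't) \<Rightarrow> bool"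
  where
  "dg_coalgebra_morphism s A \<Delta> C Q A' \<Delta>' C' Q' F \<longleftrightarrow>
     codifferential s A \<Delta> C Q \<and> codifferential s A' \<Delta>' C' Q' \<and>
     coalgebra_morphism s A \<Delta> C A' \<Delta>' C' F \<and> (\<forall>x\<in>gtot s C. F (Q x) = Q' (F x))"


subsection \<open>The reduced tensor coalgebra and the reduced symmetric coalgebra\<close>

text \<open>\<open>tpow s V n\<close> is the graded vector space \<open>V\<^sup>\<otimes>\<^sup>n\<close>.\<close>

definition tpow :: "('k::field \<Rightarrow> 'v::ab_group_add \<Rightarrow> 'v) \<Rightarrow> (int \<Rightarrow> 'v set) \<Rightarrow> nat \<Rightarrow>
    int \<Rightarrow> ('k, 'v) tensor set" where
  "tpow s V n m = module.span fscale
     {tens s V xs |xs. length xs = n \<and> (\<exists>ds. list_all2 (\<lambda>x a. x \<in> V a) xs ds \<and> sum_list ds = m)}"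

definition Tbar :: "('k::field \<Rightarrow> 'v::ab_group_add \<Rightarrow> 'v) \<Rightarrow> (int \<Rightarrow> 'v set) \<Rightarrow>
    int \<Rightarrow> ('k, 'v) tensor set" where
  "Tbar s V m = module.span fscale (\<Union>n\<in>{1..}. tpow s V n m)"

definition deconcat :: "('k::field \<Rightarrow> 'v::ab_group_add \<Rightarrow> 'v) \<Rightarrow> (int \<Rightarrow> 'v set) \<Rightarrow>
    ('k, 'v) tensor \<Rightarrow> ('k, ('k, 'v) tensor) tensor2" where
  "deconcat s V = tlift (\<lambda>xs. \<Sum>i\<in>{1..<length xs}.
     tens2 fscale (Tbar s V) (tens s V (take i xs)) (tens s V (drop i xs)))"

text \<open>
  The twist \<open>v \<otimes> w \<mapsto> (-1)^(deg v * deg w) w \<otimes> v\<close> on the factors in positions \<open>i\<close> and \<open>i + 1\<close>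
  (counted from 0); for inhomogeneous \<open>v\<close> and \<open>w\<close>, \<open>a\<close> runs over the degrees of the components
  of \<open>v\<close>.
\<close>

definition twist :: "('k::field \<Rightarrow> 'v::ab_group_add \<Rightarrow> 'v) \<Rightarrow> (int \<Rightarrow> 'v set) \<Rightarrow> nat \<Rightarrow>
    ('k, 'v) tensor \<Rightarrow> ('k, 'v) tensor" where
  "twist s V i = tlift (\<lambda>xs. if Suc i < length xs
     then Sum_any (\<lambda>a. tens s V
       (take i xs @ koszul s V a (xs ! Suc i) # hpart V a (xs ! i) # drop (Suc (Suc i)) xs))
     else tens s V xs)"

text \<open>The operators by which the elements of the symmetric group \<open>\<Sigma>\<^sub>n\<close> act on \<open>V\<^sup>\<otimes>\<^sup>n\<close>.\<close>

inductive_set sym_action :: "('k::field \<Rightarrow> 'v::ab_group_add \<Rightarrow> 'v) \<Rightarrow> (int \<Rightarrow> 'v set) \<Rightarrow> nat \<Rightarrow>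
    (('k, 'v) tensor \<Rightarrow> ('k, 'v) tensor) set"
  for s V n where
  id: "id \<in> sym_action s V n"
| twist: "f \<in> sym_action s V n \<Longrightarrow> Suc i < n \<Longrightarrow> twist s V i \<circ> f \<in> sym_action s V n"

definition Sbar :: "('k::field \<Rightarrow> 'v::ab_group_add \<Rightarrow> 'v) \<Rightarrow> (int \<Rightarrow> 'v set) \<Rightarrow>
    int \<Rightarrow> ('k, 'v) tensor set" where
  "Sbar s V m = module.span fscale
     (\<Union>n\<in>{1..}. {z \<in> tpow s V n m. \<forall>f\<in>sym_action s V n. f z = z})"


subsection \<open>Maps induced on tensor powers\<close>

text \<open>The map \<open>T(f) : Tbar(M) \<rightarrow> Tbar(N)\<close> induced by a linear map \<open>f : M \<rightarrow> N\<close> of degree 0.\<close>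

definition tmap :: "('k::field \<Rightarrow> 'v::ab_group_add \<Rightarrow> 'v) \<Rightarrow> (int \<Rightarrow> 'v set) \<Rightarrow> ('v \<Rightarrow> 'v) \<Rightarrow>
    ('k, 'v) tensor \<Rightarrow> ('k, 'v) tensor" where
  "tmap s N f = tlift (\<lambda>xs. tens s N (map f xs))"

definition tdiff :: "('k::field \<Rightarrow> 'v::ab_group_add \<Rightarrow> 'v) \<Rightarrow> (int \<Rightarrow> 'v set) \<Rightarrow> ('v \<Rightarrow> 'v) \<Rightarrow>
    ('k, 'v) tensor \<Rightarrow> ('k, 'v) tensor" where
  "tdiff s V d1 = tlift (\<lambda>xs. \<Sum>j<length xs.
     tens s V (map (koszul s V 1) (take j xs) @ d1 (xs ! j) # drop (Suc j) xs))"

text \<open>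
  The sum of the maps \<open>(ip)\<^sup>\<otimes>\<^sup>j \<otimes> k \<otimes> Id\<^sup>\<otimes>\<^sup>n\<^sup>-\<^sup>j\<^sup>-\<^sup>1\<close>; the signs come from moving \<open>k\<close>, of degree
  \<open>-1\<close>, past the first \<open>j\<close> arguments.
\<close>

definition thomotopy :: "('k::field \<Rightarrow> 'v::ab_group_add \<Rightarrow> 'v) \<Rightarrow> (int \<Rightarrow> 'v set) \<Rightarrow>
    ('v \<Rightarrow> 'v) \<Rightarrow> ('v \<Rightarrow> 'v) \<Rightarrow> ('v \<Rightarrow> 'v) \<Rightarrow> ('k, 'v) tensor \<Rightarrow> ('k, 'v) tensor" where
  "thomotopy s V i p k = tlift (\<lambda>xs. \<Sum>j<length xs.
     tens s V (map (\<lambda>x. i (p (koszul s V (- 1) x))) (take j xs) @ k (xs ! j) # drop (Suc j) xs))"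

end

theory Submission
  imports Defs
begin

text \<open>
  Write \<open>F = \<Sum>(h \<partial>)\<^sup>n \<iota>\<close> for the map \<open>\<iota>\<^sub>\<partial>\<close> of the statement, so that \<open>F = \<iota> + h \<partial> F\<close>, \<open>\<pi> F = Id\<close> and
  \<open>h F = 0\<close>. By the compatibility of \<open>h\<close> with the coproduct \<open>\<Delta>\<close>, both \<open>\<Delta> F\<close> and \<open>(F \<otimes> F) \<Delta>\<close> solve
  an equation \<open>Z = (\<iota> \<otimes> \<iota>) \<Delta> + \<Phi> Z\<close> in which \<open>\<Phi>\<close> lowers the total tensor length; hence they agree, \<open>F\<close>
  is a coalgebra morphism, and \<open>D = \<pi> \<partial> F\<close> is a coderivation.

  Although \<open>h\<close> does not respect symmetric tensors, \<open>F\<close> and \<open>D\<close> do: symmetric tensors form a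
  subcoalgebra on which \<open>\<Delta>\<close> is invariant under the graded swap, every subspace with this property
  consists of symmetric tensors, and the property passes to the image under a morphism and to the
  sum with the image under a coderivation.

  Finally \<open>Q\<^sup>2 = 0\<close> on symmetric tensors implies that \<open>E = Q F - F (d + D)\<close> satisfies \<open>E = h \<partial> E\<close>
  there, so \<open>E = 0\<close>, and then \<open>(d + D)\<^sup>2 = \<pi> F (d + D)\<^sup>2 = \<pi> Q\<^sup>2 F = 0\<close>.
\<close>

text \<open>Two points shape the work. The hypotheses describe \<open>d\<close> and
  \<open>\<delta>\<close> (the \<partial> of the overview) only by their effect on tensor length. So
  \<open>d\<close> must first be identified with the natural differential: only then is
  \<open>\<delta>\<close>, as a difference of coderivations, a coderivation, and only then does the
  homotopy identity for \<open>h\<close> apply to the length-preserving part of \<open>Q\<close>.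
  The equation for \<open>E\<close> comes from rewriting \<open>d h \<delta> F\<close> by that
  identity and \<open>d \<delta> F\<close> as \<open>- \<delta> Q F\<close>, which expresses that
  the squares of \<open>Q\<close> and of \<open>d\<close> vanish. It forces \<open>E = 0\<close>
  because every tensor has bounded length and each \<open>\<delta>\<close> lowers the bound.

  The other point is the encoding. Tensors are functionals on forms, so neither the directness of
  the grading on tensors nor a description of symmetric tensors through their coproduct is at hand.
  The former comes from an operator with eigenvalue \<open>2 powi m\<close> in degree
  \<open>m\<close>; the latter from contracting one side of a coproduct with functionals, and from
  gluing the two sides back together.\<close>

global_interpretation fs: vector_space "fscale :: 'k::field \<Rightarrow> ('a \<Rightarrow> 'k) \<Rightarrow> 'a \<Rightarrow> 'k"
  by (rule vector_space_fscale)

lemma fscale_apply: "fscale c z \<phi> = c * z \<phi>"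
  by (simp add: fscale_def)

declare plus_fun_apply [simp del] zero_fun_apply [simp del] uminus_apply [simp del] minus_apply [simp del]

lemmas apply_simps = fscale_apply plus_fun_apply zero_fun_apply uminus_apply minus_apply

subsection \<open>Linear maps on subspaces\<close>

lemma lin_onI:
  assumes "\<And>x y. x \<in> A \<Longrightarrow> y \<in> A \<Longrightarrow> f (x + y) = f x + f y"
    and "\<And>c x. x \<in> A \<Longrightarrow> f (s c x) = s' c (f x)"
  shows "lin_on s s' A f"
  using assms by (simp add: lin_on_def)

lemma lin_on_add: "lin_on s s' A f \<Longrightarrow> x \<in> A \<Longrightarrow> y \<in> A \<Longrightarrow> f (x + y) = f x + f y"
  by (simp add: lin_on_def)

lemma lin_on_scale: "lin_on s s' A f \<Longrightarrow> x \<in> A \<Longrightarrow> f (s c x) = s' c (f x)"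
  by (simp add: lin_on_def)

lemma lin_on_subset: "lin_on s s' A f \<Longrightarrow> B \<subseteq> A \<Longrightarrow> lin_on s s' B f"
  unfolding lin_on_def by blast

text \<open>\<open>A\<close> need not contain 0: the value there is obtained by scaling any element
  of \<open>A\<close> by 0.\<close>

lemma lin_on_zero:
  assumes "lin_on s s' A f" "x \<in> A" "vector_space s" "vector_space s'"
  shows "f 0 = 0"
proof -
  interpret a: vector_space s by fact
  interpret b: vector_space s' by fact
  have "f (s 0 x) = s' 0 (f x)" using assms by (simp only: lin_on_def)
  then show ?thesis by simp
qed

lemma lin_on_uminus:
  assumes "lin_on s s' A f" "x \<in> A" "vector_space s" "vector_space s'"
  shows "f (- x) = - f x"
proof -
  interpret a: vector_space s by fact
  interpret b: vector_space s' by fact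
  have "f (s (-1) x) = s' (-1) (f x)" using assms by (simp only: lin_on_def)
  then show ?thesis by simp
qed

lemma lin_on_diff:
  assumes f: "lin_on s s' A f" and x: "x \<in> A" and y: "y \<in> A"
    and s: "vector_space s" and s': "vector_space s'" and A: "module.subspace s A"
  shows "f (x - y) = f x - f y"
proof -
  interpret a: vector_space s by fact
  have "- y \<in> A" using A y by (rule a.subspace_neg)
  then have "f (x + - y) = f x + f (- y)" using lin_on_add[OF f x] by blast
  then show ?thesis using lin_on_uminus[OF f y s s'] by simp
qed

lemma lin_on_sum:
  assumes f: "lin_on s s' A f" and s: "vector_space s" and s': "vector_space s'"
    and A: "module.subspace s A" and g: "\<And>i. i \<in> I \<Longrightarrow> g i \<in> A"
  shows "f (\<Sum>i\<in>I. g i) = (\<Sum>i\<in>I. f (g i))"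
proof -
  interpret a: vector_space s by fact
  have "0 \<in> A" using A by (rule a.subspace_0)
  with f s s' have f0: "f 0 = 0" by (blast intro: lin_on_zero)
  from g show ?thesis
  proof (induction I rule: infinite_finite_induct)
    case (insert x F)
    then have "(\<Sum>i\<in>F. g i) \<in> A" using a.subspace_sum[OF A, of F g] by blast
    with insert show ?case by (simp add: lin_on_add[OF f])
  qed (use f0 in auto)
qed

lemma lin_on_comp:
  assumes "lin_on s s' A f" "lin_on s' s'' B g" "\<And>x. x \<in> A \<Longrightarrow> f x \<in> B"
  shows "lin_on s s'' A (\<lambda>x. g (f x))"
  using assms by (simp add: lin_on_def)

lemma lin_on_plus:
  assumes "vector_space s'" "lin_on s s' A f" "lin_on s s' A g"
  shows "lin_on s s' A (\<lambda>x. f x + g x)"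
proof -
  interpret b: vector_space s' by fact
  show ?thesis using assms by (simp add: lin_on_def b.scale_right_distrib algebra_simps)
qed

lemma lin_on_minus:
  assumes "vector_space s'" "lin_on s s' A f" "lin_on s s' A g"
  shows "lin_on s s' A (\<lambda>x. f x - g x)"
proof -
  interpret b: vector_space s' by fact
  show ?thesis using assms by (simp add: lin_on_def b.scale_right_diff_distrib algebra_simps)
qed

lemma lin_on_id: "lin_on s s A (\<lambda>x. x)"
  by (simp add: lin_on_def)

lemma lin_on_const_zero: "vector_space s' \<Longrightarrow> lin_on s s' A (\<lambda>x. 0)"
proof -
  assume "vector_space s'"
  then interpret b: vector_space s' .
  show ?thesis by (simp add: lin_on_def)
qed

lemma lin_on_setsum:
  assumes s': "vector_space s'" and "\<And>i. i \<in> I \<Longrightarrow> lin_on s s' A (f i)"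
  shows "lin_on s s' A (\<lambda>x. \<Sum>i\<in>I. f i x)"
  using assms(2)
proof (induction I rule: infinite_finite_induct)
  case (insert i I)
  then have "lin_on s s' A (\<lambda>x. f i x + (\<Sum>i\<in>I. f i x))" by (intro lin_on_plus[OF s']) auto
  then show ?case using insert by simp
qed (simp_all add: lin_on_const_zero[OF s'])

lemma lin_on_eq_on_span:
  assumes s: "vector_space s" and s': "vector_space s'"
    and f: "lin_on s s' (module.span s B) f" and g: "lin_on s s' (module.span s B) g"
    and fg: "\<And>x. x \<in> B \<Longrightarrow> f x = g x" and x: "x \<in> module.span s B"
  shows "f x = g x"
proof -
  interpret a: vector_space s by fact
  \<comment> \<open>Membership is carried through the induction, because \<open>f\<close> and
    \<open>g\<close> are additive only on the span.\<close>
  from x have "x \<in> module.span s B \<and> f x = g x"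
  proof (induction rule: a.span_induct_alt)
    case base
    show ?case using lin_on_zero[OF f x s s'] lin_on_zero[OF g x s s'] by (simp add: a.span_zero)
  next
    case (step c x y)
    then show ?case using fg
      by (simp add: a.span_add a.span_scale a.span_base lin_on_add[OF f] lin_on_add[OF g]
          lin_on_scale[OF f] lin_on_scale[OF g])
  qed
  then show ?thesis ..
qed

lemma lin_on_span_into:
  assumes s: "vector_space s" and s': "vector_space s'"
    and f: "lin_on s s' (module.span s B) f" and K: "module.subspace s' K"
    and fK: "\<And>x. x \<in> B \<Longrightarrow> f x \<in> K" and x: "x \<in> module.span s B"
  shows "f x \<in> K"
proof -
  interpret a: vector_space s by fact
  interpret b: vector_space s' by fact
  from x have "x \<in> module.span s B \<and> f x \<in> K"
  proof (induction rule: a.span_induct_alt)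
    case base
    show ?case using lin_on_zero[OF f x s s'] by (simp add: a.span_zero b.subspace_0[OF K])
  next
    case (step c x y)
    then show ?case using fK
      by (simp add: a.span_add a.span_scale a.span_base lin_on_add[OF f]
          lin_on_scale[OF f] b.subspace_add[OF K] b.subspace_scale[OF K])
  qed
  then show ?thesis ..
qed

text \<open>Maps defined by \<open>tlift\<close> or \<open>tlift2\<close> precompose functionals and
  are therefore linear on the whole function space. Tracking this stronger property spares
  membership side conditions; \<open>Q\<close>, \<open>d\<close>, \<open>\<delta>\<close> and what
  is built from them are known to be linear only on tensors.\<close>

abbreviation flin :: "(('a \<Rightarrow> 'k::field) \<Rightarrow> 'b \<Rightarrow> 'k) \<Rightarrow> bool" where
  "flin \<equiv> lin_on fscale fscale UNIV"

lemma flin_on: "flin f \<Longrightarrow> lin_on fscale fscale A f"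
  by (rule lin_on_subset) auto

lemma flin_comp: "flin f \<Longrightarrow> flin g \<Longrightarrow> flin (\<lambda>x. g (f x))"
  by (simp add: lin_on_def)

lemma flin_add: "flin f \<Longrightarrow> f (x + y) = f x + f y"
  by (simp add: lin_on_def)

lemma flin_scale: "flin f \<Longrightarrow> f (fscale c x) = fscale c (f x)"
  by (simp add: lin_on_def)

lemma flin_zero: "flin f \<Longrightarrow> f 0 = 0"
  by (rule lin_on_zero[where A = UNIV and s = fscale and s' = fscale])
    (simp_all add: vector_space_fscale)

lemma flin_minus: "flin f \<Longrightarrow> f (- x) = - f x"
  by (rule lin_on_uminus[where A = UNIV and s = fscale and s' = fscale])
    (simp_all add: vector_space_fscale)

lemma flin_sum: "flin f \<Longrightarrow> f (\<Sum>i\<in>I. g i) = (\<Sum>i\<in>I. f (g i))"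
  by (rule lin_on_sum[where A = UNIV and s = fscale and s' = fscale])
    (simp_all add: vector_space_fscale)

lemma flin_diff: "flin f \<Longrightarrow> f (x - y) = f x - f y"
  by (rule lin_on_diff[where A = UNIV and s = fscale and s' = fscale])
    (simp_all add: vector_space_fscale)

lemma flin_tlift: "flin (tlift g)"
  by (simp add: lin_on_def tlift_def fun_eq_iff apply_simps)

lemma flin_tlift2: "flin (tlift2 g)"
  by (simp add: lin_on_def tlift2_def fun_eq_iff apply_simps)

lemma flin_eq_on_span:
  assumes "lin_on fscale fscale (fs.span B) f" "lin_on fscale fscale (fs.span B) g"
    and "\<And>x. x \<in> B \<Longrightarrow> f x = g x" "x \<in> fs.span B"
  shows "f x = g x"
  by (rule lin_on_eq_on_span[OF vector_space_fscale vector_space_fscale assms])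

lemma flin_span_into:
  assumes "lin_on fscale fscale (fs.span B) f" "fs.subspace K"
    and "\<And>x. x \<in> B \<Longrightarrow> f x \<in> K" "x \<in> fs.span B"
  shows "f x \<in> K"
  by (rule lin_on_span_into[OF vector_space_fscale vector_space_fscale assms])

lemma subspace_eqs: "flin f \<Longrightarrow> flin g \<Longrightarrow> fs.subspace {x. f x = g x}"
  by (rule fs.subspaceI) (simp_all add: flin_zero flin_add flin_scale)

subsection \<open>Graded vector spaces\<close>

text \<open>A diagonal operator with a free weight in each degree. Signs as weights give
  \<open>koszul\<close>; the weights \<open>2 powi n\<close> give an operator that tells degrees
  apart, from which the directness of the grading on tensors follows.\<close>

definition wsum :: "('k::field \<Rightarrow> 'v::ab_group_add \<Rightarrow> 'v) \<Rightarrow> (int \<Rightarrow> 'v set) \<Rightarrow> (int \<Rightarrow> 'k) \<Rightarrow> 'v \<Rightarrow> 'v"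
  where "wsum s V w v = Sum_any (\<lambda>n. s (w n) (hpart V n v))"

lemma koszul_wsum: "koszul s V e = wsum s V (\<lambda>n. if even (e * n) then 1 else - 1)"
  by (simp add: koszul_def wsum_def fun_eq_iff)

locale graded =
  fixes s :: "'k::field \<Rightarrow> 'v::ab_group_add \<Rightarrow> 'v" and V :: "int \<Rightarrow> 'v set"
  assumes graded_space: "graded_space s V"
begin

sublocale vs: vector_space s
  using graded_space by (simp add: graded_space_def)

abbreviation G :: "'v set" where "G \<equiv> gtot s V"

lemma subspace_V: "vs.subspace (V n)"
  using graded_space by (simp add: graded_space_def)

lemma gtot_eq: "G = vs.span (\<Union>n. V n)"
  by (simp add: gtot_def)

lemma subspace_G: "vs.subspace G"
  by (simp add: gtot_eq)

lemma V_G: "v \<in> V n \<Longrightarrow> v \<in> G"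
  by (auto simp: gtot_eq intro: vs.span_base)

lemma G_0: "0 \<in> G" and G_add: "x \<in> G \<Longrightarrow> y \<in> G \<Longrightarrow> x + y \<in> G"
  and G_scale: "x \<in> G \<Longrightarrow> s c x \<in> G" and G_minus: "x \<in> G \<Longrightarrow> - x \<in> G"
  and G_sum: "(\<And>i. i \<in> I \<Longrightarrow> g i \<in> G) \<Longrightarrow> sum g I \<in> G"
  using subspace_G
  by (simp_all add: vs.subspace_0 vs.subspace_add vs.subspace_scale vs.subspace_neg vs.subspace_sum)

lemma V_0: "0 \<in> V n"
  using subspace_V by (simp add: vs.subspace_0)

lemma V_scale: "v \<in> V n \<Longrightarrow> s c v \<in> V n" and V_minus: "v \<in> V n \<Longrightarrow> - v \<in> V n"
  using subspace_V by (simp_all add: vs.subspace_scale vs.subspace_neg)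

text \<open>No scalar case arises, since a multiple of a homogeneous vector is homogeneous.\<close>

lemma G_induct [consumes 1, case_names hom add]:
  assumes "v \<in> G" and "\<And>n v. v \<in> V n \<Longrightarrow> P v"
    and "\<And>x y. x \<in> G \<Longrightarrow> y \<in> G \<Longrightarrow> P x \<Longrightarrow> P y \<Longrightarrow> P (x + y)"
  shows "P v"
proof -
  from assms(1)[unfolded gtot_eq] have "v \<in> G \<and> P v"
  proof (induction rule: vs.span_induct_alt)
    case base
    then show ?case using G_0 V_0 assms(2) by blast
  next
    case (step c x y)
    then show ?case using assms(2,3) V_scale V_G G_add by (metis UN_E)
  qed
  then show ?thesis ..
qed

lemma hdecomp_hpart: "v \<in> G \<Longrightarrow> hdecomp V v (\<lambda>n. hpart V n v)"
  unfolding hpart_def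
  by (rule theI'[of "hdecomp V v"]) (use graded_space in \<open>simp add: graded_space_def\<close>)

lemma hpart_eqI: "v \<in> G \<Longrightarrow> hdecomp V v c \<Longrightarrow> hpart V n v = c n"
  using graded_space hdecomp_hpart[of v] unfolding graded_space_def by metis

lemma hpart_V: "v \<in> G \<Longrightarrow> hpart V n v \<in> V n"
  using hdecomp_hpart by (simp add: hdecomp_def)

lemma finite_hpart: "v \<in> G \<Longrightarrow> finite {n. hpart V n v \<noteq> 0}"
  using hdecomp_hpart by (simp add: hdecomp_def)

lemma sum_hpart: "v \<in> G \<Longrightarrow> Sum_any (\<lambda>n. hpart V n v) = v"
  using hdecomp_hpart by (simp add: hdecomp_def)

lemma hpart_hom: "v \<in> V m \<Longrightarrow> hpart V n v = (if n = m then v else 0)"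
  by (rule hpart_eqI) (auto simp: V_G hdecomp_def V_0)

lemma hpart_add: "x \<in> G \<Longrightarrow> y \<in> G \<Longrightarrow> hpart V n (x + y) = hpart V n x + hpart V n y"
proof (rule hpart_eqI)
  assume x: "x \<in> G" and y: "y \<in> G"
  have "finite {n. hpart V n x + hpart V n y \<noteq> 0}"
    by (rule finite_subset[OF _ finite_UnI[OF finite_hpart[OF x] finite_hpart[OF y]]]) auto
  moreover have "Sum_any (\<lambda>n. hpart V n x + hpart V n y) = x + y"
    using Sum_any.distrib[OF finite_hpart[OF x] finite_hpart[OF y]] x y by (simp add: sum_hpart)
  ultimately show "hdecomp V (x + y) (\<lambda>n. hpart V n x + hpart V n y)"
    using x y by (simp add: hdecomp_def vs.subspace_add[OF subspace_V] hpart_V)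
qed (rule G_add)

lemma Sum_any_scale: 
  assumes "finite {n. f n \<noteq> 0}" shows "Sum_any (\<lambda>n. s c (f n)) = s c (Sum_any f)"
proof -
  have "Sum_any (\<lambda>n. s c (f n)) = (\<Sum>n | f n \<noteq> 0. s c (f n))"
    by (rule Sum_any.expand_superset) (use assms in auto)
  also have "\<dots> = s c (Sum_any f)"
    by (simp add: Sum_any.expand_set vs.scale_sum_right)
  finally show ?thesis .
qed

lemma hpart_scale: "x \<in> G \<Longrightarrow> hpart V n (s c x) = s c (hpart V n x)"
proof (rule hpart_eqI)
  assume x: "x \<in> G"
  have "finite {n. s c (hpart V n x) \<noteq> 0}"
    by (rule finite_subset[OF _ finite_hpart[OF x]]) auto
  with x show "hdecomp V (s c x) (\<lambda>n. s c (hpart V n x))"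
    by (simp add: hdecomp_def V_scale hpart_V Sum_any_scale finite_hpart sum_hpart)
qed (rule G_scale)

lemma wsum_hom: "v \<in> V m \<Longrightarrow> wsum s V w v = s (w m) v"
  by (simp add: wsum_def hpart_hom if_distrib[of "s _"] cong: if_cong)

lemma finite_wsum: "v \<in> G \<Longrightarrow> finite {n. s (w n) (hpart V n v) \<noteq> 0}"
  by (rule finite_subset[OF _ finite_hpart[of v]]) auto

lemma lin_wsum: "lin_on s s G (wsum s V w)"
proof (rule lin_onI)
  fix x y assume "x \<in> G" "y \<in> G"
  then show "wsum s V w (x + y) = wsum s V w x + wsum s V w y"
    using Sum_any.distrib[OF finite_wsum[of x w] finite_wsum[of y w]]
    by (simp add: wsum_def hpart_add vs.scale_right_distrib)
next
  fix c x assume x: "x \<in> G"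
  then show "wsum s V w (s c x) = s c (wsum s V w x)"
    using Sum_any_scale[OF finite_wsum[OF x, of w], of c]
    by (simp add: wsum_def hpart_scale mult.commute)
qed

lemma wsum_G: "v \<in> G \<Longrightarrow> wsum s V w v \<in> G"
  unfolding wsum_def Sum_any.expand_set by (rule G_sum) (auto intro: G_scale V_G hpart_V)

lemma koszul_hom: "v \<in> V m \<Longrightarrow> koszul s V e v = (if even (e * m) then v else - v)"
  by (simp add: koszul_wsum wsum_hom)

lemma koszul_V: "v \<in> V m \<Longrightarrow> koszul s V e v \<in> V m"
  by (simp add: koszul_hom V_minus)

lemma lin_koszul: "lin_on s s G (koszul s V e)"
  by (simp add: koszul_wsum lin_wsum)

lemma koszul_G: "v \<in> G \<Longrightarrow> koszul s V e v \<in> G"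
  by (simp add: koszul_wsum wsum_G)

lemma koszul_add: "x \<in> G \<Longrightarrow> y \<in> G \<Longrightarrow> koszul s V e (x + y) = koszul s V e x + koszul s V e y"
  by (rule lin_on_add[OF lin_koszul])

lemma koszul_minus: "x \<in> G \<Longrightarrow> koszul s V e (- x) = - koszul s V e x"
  by (rule lin_on_uminus[OF lin_koszul _ vs.vector_space_axioms vs.vector_space_axioms])

lemma koszul_0 [simp]: "koszul s V e 0 = 0"
  by (rule lin_on_zero[OF lin_koszul G_0 vs.vector_space_axioms vs.vector_space_axioms])

lemma koszul_zero_degree: "v \<in> G \<Longrightarrow> koszul s V 0 v = v"
  by (induction rule: G_induct) (simp_all add: koszul_hom koszul_add)

lemma koszul_koszul: "v \<in> G \<Longrightarrow> koszul s V e (koszul s V e v) = v"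
  by (induction rule: G_induct) (simp_all add: koszul_hom koszul_minus V_G koszul_add koszul_G)

lemma graded_map_G:
  assumes f: "graded_map s e V N f" and N: "graded_space s N" and v: "v \<in> G"
  shows "f v \<in> gtot s N"
proof -
  interpret N: graded s N using N by unfold_locales
  have lin: "lin_on s s G f" and fV: "\<And>n. f ` V n \<subseteq> N (n + e)"
    using f unfolding graded_map_def by blast+
  from v show ?thesis
  proof (induction rule: G_induct)
    case (hom n v)
    then show ?case using fV N.V_G by blast
  next
    case (add x y)
    then show ?case by (simp add: lin_on_add[OF lin] N.G_add)
  qed
qed

text \<open>A map of degree \<open>e\<close> sends degree \<open>n\<close> to \<open>n + e\<close>,
  so the signs before and after it differ by the parity of \<open>c * e\<close>. This rule yields
  the commutation signs of \<open>p\<close>, \<open>k\<close>, \<open>d1\<close>, \<open>h\<close>,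
  \<open>\<pi>\<close> and the twists with the sign operator.\<close>

lemma graded_map_koszul:
  assumes f: "graded_map s e V N f" and N: "graded_space s N" and v: "v \<in> G"
  shows "f (koszul s V c v) = (if even (c * e) then koszul s N c (f v) else - koszul s N c (f v))"
proof -
  interpret N: graded s N using N by unfold_locales
  have lin: "lin_on s s G f" and fV: "\<And>n. f ` V n \<subseteq> N (n + e)"
    using f unfolding graded_map_def by blast+
  have neg: "x \<in> G \<Longrightarrow> f (- x) = - f x" for x
    by (rule lin_on_uminus[OF lin _ vs.vector_space_axioms vs.vector_space_axioms])
  from v show ?thesis
  proof (induction rule: G_induct)
    case (hom n v)
    then have "f v \<in> N (n + e)" using fV by blast
    then show ?case using hom by (simp add: koszul_hom N.koszul_hom V_G neg distrib_left)
  next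
    case (add x y)
    then show ?case by (simp add: koszul_add koszul_G lin_on_add[OF lin] graded_map_G[OF f N] N.koszul_add)
  qed
qed

text \<open>The homotopy has degree -1, but parity does not see the sign; a single sign operator can
  serve both the homotopy and the differentials.\<close>

lemma koszul_neg_one: "koszul s V (- 1) = koszul s V 1"
  by (simp add: koszul_def fun_eq_iff)

end

lemma hdecomp_exists:
  fixes s :: "'k::field \<Rightarrow> 'v::ab_group_add \<Rightarrow> 'v"
  assumes s: "vector_space s" and sub: "\<And>n. module.subspace s (V n)"
    and v: "v \<in> gtot s V"
  shows "\<exists>c. hdecomp V v c"
proof -
  interpret vector_space s by (rule s)
  from v[unfolded gtot_def] show ?thesis
  proof (induction rule: span_induct_alt)
    case base
    have "hdecomp V 0 (\<lambda>n. 0)" by (simp add: hdecomp_def subspace_0[OF sub])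
    then show ?case by blast
  next
    case (step a x y)
    then obtain n c where x: "x \<in> V n" and c: "hdecomp V y c" by blast
    let ?e = "\<lambda>m. if m = n then s a x else 0 :: 'v"
    have fc: "finite {m. c m \<noteq> 0}" using c by (simp add: hdecomp_def)
    have fe: "finite {m. ?e m \<noteq> 0}" by (rule finite_subset[of _ "{n}"]) auto
    have "finite {m. ?e m + c m \<noteq> 0}"
      by (rule finite_subset[OF _ finite_UnI[OF fe fc]]) auto
    moreover have "Sum_any (\<lambda>m. ?e m + c m) = s a x + y"
      using Sum_any.distrib[OF fe fc] c by (simp add: hdecomp_def)
    moreover have "?e m + c m \<in> V m" for m
      using x c subspace_add[OF sub] subspace_scale[OF sub] by (auto simp: hdecomp_def)
    ultimately have "hdecomp V (s a x + y) (\<lambda>m. ?e m + c m)" by (simp add: hdecomp_def)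
    then show ?case by blast
  qed
qed

text \<open>Eigenvectors of \<open>E\<close> for distinct eigenvalues \<open>w n\<close> are linearly independent.\<close>

lemma graded_space_eigen:
  fixes s :: "'k::field \<Rightarrow> 'v::ab_group_add \<Rightarrow> 'v"
  assumes s: "vector_space s" and sub: "\<And>n. module.subspace s (V n)"
    and E: "lin_on s s UNIV E" and eig: "\<And>n v. v \<in> V n \<Longrightarrow> E v = s (w n) v" and w: "inj w"
  shows "graded_space s V"
proof -
  interpret vector_space s by (rule s)
  have zero: "\<forall>i\<in>I. d i = 0"
    if "finite I" "\<And>i. i \<in> I \<Longrightarrow> d i \<in> V i" "(\<Sum>i\<in>I. d i) = 0" for I d
    using that
  proof (induction I arbitrary: d rule: finite_induct)
    case (insert i I)
    have sum0: "d i + (\<Sum>j\<in>I. d j) = 0" using insert by simp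
    have "E (\<Sum>j\<in>insert i I. d j) = (\<Sum>j\<in>insert i I. E (d j))"
      by (rule lin_on_sum[OF E s s]) auto
    also have "\<dots> = (\<Sum>j\<in>insert i I. s (w j) (d j))"
      by (rule sum.cong[OF refl], rule eig, rule insert.prems(1))
    finally have "(\<Sum>j\<in>insert i I. s (w j) (d j)) = 0"
      using insert.prems lin_on_zero[OF E UNIV_I s s] by simp
    \<comment> \<open>Subtracting \<open>w i\<close> times the relation removes the summand
      \<open>d i\<close> and leaves coefficients \<open>w j - w i\<close>, nonzero by
      injectivity.\<close>
    then have "(\<Sum>j\<in>insert i I. s (w j) (d j)) - s (w i) (\<Sum>j\<in>insert i I. d j) = 0"
      using insert.prems by simp
    then have "(\<Sum>j\<in>I. s (w j - w i) (d j)) = 0"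
      using insert.hyps
      by (simp add: scale_right_distrib scale_sum_right scale_left_diff_distrib sum_subtractf)
    then have "\<forall>j\<in>I. s (w j - w i) (d j) = 0"
      by (rule insert.IH[rotated]) (simp add: insert.prems subspace_scale[OF sub])
    then have "\<forall>j\<in>I. d j = 0" using w insert.hyps by (auto dest: injD)
    with sum0 show ?case by simp
  qed simp
  have uniq: "c = c'" if c: "hdecomp V v c" and c': "hdecomp V v c'" for v c c'
  proof -
    let ?I = "{n. c n \<noteq> 0} \<union> {n. c' n \<noteq> 0}"
    have fin: "finite ?I" using c c' by (simp add: hdecomp_def)
    have "(\<Sum>n\<in>?I. c n) = v" "(\<Sum>n\<in>?I. c' n) = v"
      using c c' fin Sum_any.expand_superset[of ?I c] Sum_any.expand_superset[of ?I c']
      by (auto simp: hdecomp_def)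
    then have "(\<Sum>n\<in>?I. c n - c' n) = 0" by (simp add: sum_subtractf)
    moreover have "c n - c' n \<in> V n" for n
      using c c' subspace_diff[OF sub] by (simp add: hdecomp_def)
    ultimately have "\<forall>n\<in>?I. c n - c' n = 0" using zero[OF fin, of "\<lambda>n. c n - c' n"] by blast
    then have "c n = c' n" for n by (metis (mono_tags, lifting) UnCI mem_Collect_eq right_minus_eq)
    then show ?thesis by (rule ext)
  qed
  show ?thesis
    unfolding graded_space_def
  proof (intro conjI allI ballI s sub)
    fix v assume "v \<in> gtot s V"
    from hdecomp_exists[OF s sub this] obtain c where "hdecomp V v c" ..
    then show "\<exists>!c. hdecomp V v c" using uniq[of v] by blast
  qed
qed

text \<open>Characteristic zero enters here: 2 has infinite multiplicative order, so its powers
  separate all integer degrees.\<close>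

lemma inj_two_powi: "inj (\<lambda>n. (2::'k::field_char_0) powi n)"
proof (rule linorder_injI)
  fix a b :: int assume "a < b"
  then obtain k where b: "b = a + int k" and k: "k \<noteq> 0"
    by (metis zless_iff_Suc_zadd nat.distinct(1))
  have "(2::'k) ^ k = of_nat (2 ^ k)" by simp
  moreover have "(2::nat) ^ k \<noteq> 1" using k by simp
  ultimately have "(2::'k) ^ k \<noteq> 1" by (metis of_nat_eq_iff of_nat_1)
  then show "(2::'k) powi a \<noteq> 2 powi b"
    by (simp add: b power_int_add)
qed

subsection \<open>Multilinear maps and tensors\<close>

text \<open>Multilinearity with values in functionals; evaluating the value at any point gives a
  \<open>multilinear_form\<close>, which is what a pure tensor accepts as its argument.\<close>

definition multilin ::
    "('k::field \<Rightarrow> 'v::ab_group_add \<Rightarrow> 'v) \<Rightarrow> (int \<Rightarrow> 'v set) \<Rightarrow> ('v list \<Rightarrow> 'a \<Rightarrow> 'k) \<Rightarrow> bool" where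
  "multilin s V g \<longleftrightarrow> (\<forall>xs ys. set xs \<subseteq> gtot s V \<longrightarrow> set ys \<subseteq> gtot s V \<longrightarrow>
     lin_on s fscale (gtot s V) (\<lambda>v. g (xs @ v # ys)))"

lemma multilinI:
  assumes "\<And>xs ys. set xs \<subseteq> gtot s V \<Longrightarrow> set ys \<subseteq> gtot s V \<Longrightarrow>
     lin_on s fscale (gtot s V) (\<lambda>v. g (xs @ v # ys))"
  shows "multilin s V g"
  using assms by (simp add: multilin_def)

lemma multilinD:
  assumes "multilin s V g" "set xs \<subseteq> gtot s V" "set ys \<subseteq> gtot s V"
  shows "lin_on s fscale (gtot s V) (\<lambda>v. g (xs @ v # ys))"
  using assms by (simp add: multilin_def)

lemma multilin_form: "multilin s V g \<Longrightarrow> multilinear_form s V (\<lambda>xs. g xs \<phi>)"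
  by (simp add: multilin_def multilinear_form_def lin_on_def apply_simps)

lemma tlift_eq: "multilin s V g \<Longrightarrow> tlift g (tens s V xs) = g xs"
  by (rule tlift_tens) (rule multilin_form)

text \<open>The index set may vary with the length of the list: once one slot is singled out the
  length is fixed, and so is the set.\<close>

lemma multilin_sum:
  assumes "\<And>n j xs ys. set xs \<subseteq> gtot s V \<Longrightarrow> set ys \<subseteq> gtot s V \<Longrightarrow> n = Suc (length xs + length ys) \<Longrightarrow>
     j \<in> J n \<Longrightarrow> lin_on s fscale (gtot s V) (\<lambda>v. g j (xs @ v # ys))"
  shows "multilin s V (\<lambda>xs. \<Sum>j\<in>J (length xs). g j xs)"
proof (rule multilinI)
  fix xs ys assume "set xs \<subseteq> gtot s V" "set ys \<subseteq> gtot s V"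
  then have "lin_on s fscale (gtot s V) (\<lambda>v. \<Sum>j\<in>J (Suc (length xs + length ys)). g j (xs @ v # ys))"
    by (intro lin_on_setsum vector_space_fscale assms) auto
  then show "lin_on s fscale (gtot s V) (\<lambda>v. \<Sum>j\<in>J (length (xs @ v # ys)). g j (xs @ v # ys))"
    by simp
qed

lemma multilin_length:
  assumes "\<And>xs ys. set xs \<subseteq> gtot s V \<Longrightarrow> set ys \<subseteq> gtot s V \<Longrightarrow> P (Suc (length xs + length ys)) \<Longrightarrow>
     lin_on s fscale (gtot s V) (\<lambda>v. g (xs @ v # ys))"
    and "\<And>xs ys. set xs \<subseteq> gtot s V \<Longrightarrow> set ys \<subseteq> gtot s V \<Longrightarrow> \<not> P (Suc (length xs + length ys)) \<Longrightarrow>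
     lin_on s fscale (gtot s V) (\<lambda>v. h (xs @ v # ys))"
  shows "multilin s V (\<lambda>xs. if P (length xs) then g xs else h xs)"
proof (rule multilinI)
  fix xs ys assume "set xs \<subseteq> gtot s V" "set ys \<subseteq> gtot s V"
  then show "lin_on s fscale (gtot s V)
      (\<lambda>v. if P (length (xs @ v # ys)) then g (xs @ v # ys) else h (xs @ v # ys))"
    using assms by (cases "P (Suc (length xs + length ys))") simp_all
qed

lemma multilin_tens: "multilin s V (tens s V)"
proof (rule multilinI, rule lin_onI)
  fix xs ys x y assume "set xs \<subseteq> gtot s V" "set ys \<subseteq> gtot s V" "x \<in> gtot s V" "y \<in> gtot s V"
  then show "tens s V (xs @ (x + y) # ys) = tens s V (xs @ x # ys) + tens s V (xs @ y # ys)"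
    by (auto simp: tens_def multilinear_form_def lin_on_def fun_eq_iff apply_simps)
next
  fix xs ys c x assume "set xs \<subseteq> gtot s V" "set ys \<subseteq> gtot s V" "x \<in> gtot s V"
  then show "tens s V (xs @ s c x # ys) = fscale c (tens s V (xs @ x # ys))"
    by (auto simp: tens_def multilinear_form_def lin_on_def fun_eq_iff apply_simps)
qed

lemmas lin_tens = multilinD[OF multilin_tens]

text \<open>Tensoring with \<open>v\<close> on the left. Together with the empty tensor this
  generates all tensors, so identities between induced maps reduce to recursions in the first
  factor.\<close>

definition tcons :: "('k::field \<Rightarrow> 'v::ab_group_add \<Rightarrow> 'v) \<Rightarrow> (int \<Rightarrow> 'v set) \<Rightarrow> 'v \<Rightarrow>
    ('k, 'v) tensor \<Rightarrow> ('k, 'v) tensor" where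
  "tcons s V v = tlift (\<lambda>xs. tens s V (v # xs))"

lemma flin_tcons: "flin (tcons s V v)"
  by (simp add: tcons_def flin_tlift)

definition hlist :: "(int \<Rightarrow> 'v set) \<Rightarrow> 'v list \<Rightarrow> int list \<Rightarrow> bool" where
  "hlist V = list_all2 (\<lambda>x a. x \<in> V a)"

lemma hlist_simps [simp]:
  "hlist V [] ds \<longleftrightarrow> ds = []"
  "hlist V (x # xs) ds \<longleftrightarrow> (\<exists>a as. ds = a # as \<and> x \<in> V a \<and> hlist V xs as)"
  "hlist V xs [] \<longleftrightarrow> xs = []"
  by (auto simp: hlist_def list_all2_Cons1)

lemma hlist_append: "hlist V xs as \<Longrightarrow> hlist V ys bs \<Longrightarrow> hlist V (xs @ ys) (as @ bs)"
  by (simp add: hlist_def list_all2_appendI)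

lemma hlist_take: "hlist V xs as \<Longrightarrow> hlist V (take n xs) (take n as)"
  and hlist_drop: "hlist V xs as \<Longrightarrow> hlist V (drop n xs) (drop n as)"
  by (simp_all add: hlist_def list_all2_takeI list_all2_dropI)

lemma hlist_length: "hlist V xs as \<Longrightarrow> length as = length xs"
  by (simp add: hlist_def list_all2_lengthD)

text \<open>The unital tensor algebra, with unit \<open>tens s V []\<close>.\<close>

definition Tens :: "('k::field \<Rightarrow> 'v::ab_group_add \<Rightarrow> 'v) \<Rightarrow> (int \<Rightarrow> 'v set) \<Rightarrow> ('k, 'v) tensor set" where
  "Tens s V = fs.span {tens s V xs |xs ds. hlist V xs ds}"

lemma tpow_eq: "tpow s V n m =
    fs.span {tens s V xs |xs. length xs = n \<and> (\<exists>ds. hlist V xs ds \<and> sum_list ds = m)}"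
  by (simp add: tpow_def hlist_def)

lemma tpow_tens: "hlist V xs ds \<Longrightarrow> tens s V xs \<in> tpow s V (length xs) (sum_list ds)"
  by (auto simp: tpow_eq intro: fs.span_base)

lemma Tbar_tpow: "n \<ge> 1 \<Longrightarrow> tpow s V n m \<subseteq> Tbar s V m"
  unfolding Tbar_def by (rule order_trans[OF _ fs.span_superset]) auto

lemma Tbar_tens: "hlist V xs ds \<Longrightarrow> xs \<noteq> [] \<Longrightarrow> tens s V xs \<in> Tbar s V (sum_list ds)"
  by (rule subsetD[OF Tbar_tpow tpow_tens]) (auto simp: Suc_le_eq)

lemma tens_gtot: "hlist V xs ds \<Longrightarrow> xs \<noteq> [] \<Longrightarrow> tens s V xs \<in> gtot fscale (Tbar s V)"
  unfolding gtot_def by (rule fs.span_base) (blast intro: Tbar_tens)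

lemma tens_Tens: "hlist V xs ds \<Longrightarrow> tens s V xs \<in> Tens s V"
  unfolding Tens_def by (rule fs.span_base) blast

lemma gtot_Tbar: "gtot fscale (Tbar s V) = fs.span {tens s V xs |xs ds. hlist V xs ds \<and> xs \<noteq> []}"
    (is "_ = fs.span ?B")
proof
  have "tpow s V n m \<subseteq> fs.span ?B" if "n \<ge> 1" for n m
    unfolding tpow_eq using that by (intro fs.span_mono) auto
  then have "Tbar s V m \<subseteq> fs.span ?B" for m
    unfolding Tbar_def by (intro fs.span_minimal) auto
  then show "gtot fscale (Tbar s V) \<subseteq> fs.span ?B"
    unfolding gtot_def by (intro fs.span_minimal) auto
  show "fs.span ?B \<subseteq> gtot fscale (Tbar s V)"
    by (rule fs.span_minimal) (auto simp: tens_gtot, simp add: gtot_def)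
qed

lemma gtot_tpow: "gtot fscale (tpow s V n) =
    fs.span {tens s V xs |xs ds. hlist V xs ds \<and> length xs = n}" (is "_ = fs.span ?B")
proof
  have "tpow s V n m \<subseteq> fs.span ?B" for m
    unfolding tpow_eq by (intro fs.span_mono) auto
  then show "gtot fscale (tpow s V n) \<subseteq> fs.span ?B"
    unfolding gtot_def by (intro fs.span_minimal) auto
  show "fs.span ?B \<subseteq> gtot fscale (tpow s V n)"
    unfolding gtot_def using tpow_tens by (intro fs.span_mono) blast
qed

lemma gtot_Tbar_Tens: "gtot fscale (Tbar s V) \<subseteq> Tens s V"
  unfolding gtot_Tbar Tens_def by (rule fs.span_mono) blast

lemma Tens_0: "0 \<in> Tens s V" and Tens_add: "x \<in> Tens s V \<Longrightarrow> y \<in> Tens s V \<Longrightarrow> x + y \<in> Tens s V"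
  by (simp_all add: Tens_def fs.span_zero fs.span_add)

lemma subspace_Tens: "fs.subspace (Tens s V)"
  by (simp add: Tens_def)

lemma Tens_induct [consumes 1, case_names lin lin' tens]:
  assumes "z \<in> Tens s V" and "flin f" "flin g"
    and "\<And>xs ds. hlist V xs ds \<Longrightarrow> f (tens s V xs) = g (tens s V xs)"
  shows "f z = g z"
proof (rule flin_eq_on_span[OF _ _ _ assms(1)[unfolded Tens_def]])
  fix x assume "x \<in> {tens s V xs |xs ds. hlist V xs ds}"
  then show "f x = g x" using assms(4) by blast
qed (rule flin_on, fact)+

lemma Tbar_induct [consumes 1, case_names lin lin' tens]:
  assumes "z \<in> gtot fscale (Tbar s V)" and "lin_on fscale fscale (gtot fscale (Tbar s V)) f"
    and "lin_on fscale fscale (gtot fscale (Tbar s V)) g"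
    and "\<And>xs ds. hlist V xs ds \<Longrightarrow> xs \<noteq> [] \<Longrightarrow> f (tens s V xs) = g (tens s V xs)"
  shows "f z = g z"
proof (rule flin_eq_on_span[OF _ _ _ assms(1)[unfolded gtot_Tbar]])
  fix x assume "x \<in> {tens s V xs |xs ds. hlist V xs ds \<and> xs \<noteq> []}"
  then show "f x = g x" using assms(4) by blast
qed (use assms(2,3) in \<open>simp_all only: gtot_Tbar\<close>)

locale tensor_powers = graded s V
  for s :: "'k::field_char_0 \<Rightarrow> 'v::ab_group_add \<Rightarrow> 'v" and V
begin

lemma hlist_G: "hlist V xs ds \<Longrightarrow> set xs \<subseteq> G"
  by (induction xs arbitrary: ds) (auto intro: V_G)

lemma tcons_tens: "v \<in> G \<Longrightarrow> tcons s V v (tens s V xs) = tens s V (v # xs)"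
  unfolding tcons_def
proof (rule tlift_eq, rule multilinI)
  fix xs ys assume "v \<in> G" "set xs \<subseteq> G" "set ys \<subseteq> G"
  then show "lin_on s fscale G (\<lambda>w. tens s V (v # xs @ w # ys))"
    using lin_tens[of "v # xs" s V ys] by simp
qed

lemma lin_tens_Cons: "set ys \<subseteq> G \<Longrightarrow> lin_on s fscale G (\<lambda>v. tens s V (v # ys))"
  using lin_tens[of "[]" s V ys] by simp

text \<open>The factors are made homogeneous from left to right: \<open>ps\<close> collects those
  already done, and linearity in the next slot reduces it to homogeneous vectors.\<close>

lemma tens_in_span_hom:
  assumes "set xs \<subseteq> G" "hlist V ps ds"
  shows "tens s V (ps @ xs) \<in> gtot fscale (tpow s V (length ps + length xs))"
  using assms
proof (induction xs arbitrary: ps ds)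
  case Nil
  then show ?case unfolding gtot_tpow by (auto intro: fs.span_base)
next
  case (Cons v xs)
  have lin: "lin_on s fscale (vs.span (\<Union>n. V n)) (\<lambda>v. tens s V (ps @ v # xs))"
    using Cons.prems lin_tens[of ps s V xs] hlist_G by (simp add: gtot_eq)
  show ?case
  proof (rule lin_on_span_into[OF vs.vector_space_axioms vector_space_fscale lin])
    show "fs.subspace (gtot fscale (tpow s V (length ps + length (v # xs))))"
      by (simp add: gtot_tpow)
    show "v \<in> vs.span (\<Union>n. V n)" using Cons.prems by (simp add: gtot_eq)
  next
    fix u assume "u \<in> (\<Union>n. V n)"
    then obtain n where "u \<in> V n" by blast
    then have "hlist V (ps @ [u]) (ds @ [n])" using Cons.prems by (intro hlist_append) auto
    with Cons.IH[of "ps @ [u]"] Cons.prems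
    show "tens s V (ps @ u # xs) \<in> gtot fscale (tpow s V (length ps + length (v # xs)))" by simp
  qed
qed

lemma tens_T: "set xs \<subseteq> G \<Longrightarrow> xs \<noteq> [] \<Longrightarrow> tens s V xs \<in> gtot fscale (Tbar s V)"
proof -
  assume xs: "set xs \<subseteq> G" "xs \<noteq> []"
  have "gtot fscale (tpow s V (length xs)) \<subseteq> gtot fscale (Tbar s V)"
    unfolding gtot_tpow gtot_Tbar by (rule fs.span_mono) (use xs in auto)
  then show ?thesis using tens_in_span_hom[of xs "[]"] xs by auto
qed

lemma lin_tcons: "z \<in> Tens s V \<Longrightarrow> lin_on s fscale G (\<lambda>v. tcons s V v z)"
  unfolding Tens_def
proof (induction rule: fs.span_induct_alt)
  case base
  show ?case unfolding flin_zero[OF flin_tcons] by (rule lin_on_const_zero[OF vector_space_fscale])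
next
  case (step c x y)
  then obtain xs ds where x: "x = tens s V xs" "hlist V xs ds" by blast
  then have l: "lin_on s fscale G (\<lambda>v. tens s V (v # xs))" using lin_tens_Cons hlist_G by blast
  have l': "lin_on s fscale G (\<lambda>v. tcons s V v x)"
    using l unfolding lin_on_def by (simp add: x tcons_tens G_add G_scale)
  show ?case
    unfolding flin_add[OF flin_tcons] flin_scale[OF flin_tcons]
    by (rule lin_on_plus[OF vector_space_fscale _ step.IH])
      (use l' in \<open>simp add: lin_on_def fs.scale_right_distrib mult.commute\<close>)
qed

lemma tcons_tpow: "v \<in> V a \<Longrightarrow> z \<in> tpow s V n m \<Longrightarrow> tcons s V v z \<in> tpow s V (Suc n) (a + m)"
proof (rule flin_span_into[OF flin_on[OF flin_tcons]])
  assume v: "v \<in> V a"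
  fix x assume "x \<in> {tens s V xs |xs. length xs = n \<and> (\<exists>ds. hlist V xs ds \<and> sum_list ds = m)}"
  then obtain xs ds where "x = tens s V xs" "length xs = n" "hlist V xs ds" "sum_list ds = m" by blast
  then show "tcons s V v x \<in> tpow s V (Suc n) (a + m)"
    using v tpow_tens[of V "v # xs" "a # ds" s] by (auto simp: tcons_tens V_G)
qed (simp_all add: tpow_eq)

lemma tcons_Tens: "v \<in> G \<Longrightarrow> z \<in> Tens s V \<Longrightarrow> tcons s V v z \<in> Tens s V"
  and tcons_Tbar: "v \<in> G \<Longrightarrow> z \<in> Tens s V \<Longrightarrow> tcons s V v z \<in> gtot fscale (Tbar s V)"
proof -
  assume v: "v \<in> G" and z: "z \<in> Tens s V"
  have "tcons s V v x \<in> gtot fscale (Tbar s V)" if "x \<in> {tens s V xs |xs ds. hlist V xs ds}" for x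
  proof -
    from that obtain xs ds where x: "x = tens s V xs" and "hlist V xs ds" by blast
    then have "set (v # xs) \<subseteq> G" using v hlist_G by simp
    from tens_T[OF this] show ?thesis using v x by (simp add: tcons_tens)
  qed
  then show "tcons s V v z \<in> gtot fscale (Tbar s V)"
    using flin_span_into[OF flin_on[OF flin_tcons] _ _ z[unfolded Tens_def],
        of "gtot fscale (Tbar s V)" s V v] by (simp add: gtot_def)
  then show "tcons s V v z \<in> Tens s V" using gtot_Tbar_Tens by blast
qed

lemma tcons_add: "u \<in> G \<Longrightarrow> v \<in> G \<Longrightarrow> z \<in> Tens s V \<Longrightarrow>
    tcons s V (u + v) z = tcons s V u z + tcons s V v z"
  by (rule lin_on_add[OF lin_tcons])

lemma tcons_minus: "v \<in> G \<Longrightarrow> z \<in> Tens s V \<Longrightarrow> tcons s V (- v) z = - tcons s V v z"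
  by (rule lin_on_uminus[OF lin_tcons _ vs.vector_space_axioms vector_space_fscale])

lemma tcons_scale: "v \<in> G \<Longrightarrow> z \<in> Tens s V \<Longrightarrow> tcons s V (s c v) z = fscale c (tcons s V v z)"
  by (rule lin_on_scale[OF lin_tcons])

lemma tcons_zero: "z \<in> Tens s V \<Longrightarrow> tcons s V 0 z = 0"
  by (rule lin_on_zero[OF lin_tcons G_0 vs.vector_space_axioms vector_space_fscale])

lemma multilin_map:
  assumes M: "graded_space s M" and f: "lin_on s s (gtot s M) f"
    and fG: "\<And>v. v \<in> gtot s M \<Longrightarrow> f v \<in> G"
  shows "multilin s M (\<lambda>xs. tens s V (map f xs))"
proof (rule multilinI)
  fix xs ys assume "set xs \<subseteq> gtot s M" "set ys \<subseteq> gtot s M"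
  then have "lin_on s fscale G (\<lambda>v. tens s V (map f xs @ v # map f ys))"
    using fG by (intro lin_tens) auto
  from lin_on_comp[OF f this fG] show "lin_on s fscale (gtot s M) (\<lambda>v. tens s V (map f (xs @ v # ys)))"
    by simp
qed

lemma tmap_tens:
  assumes "graded_space s M" "lin_on s s (gtot s M) f" "\<And>v. v \<in> gtot s M \<Longrightarrow> f v \<in> G"
  shows "tmap s V f (tens s M xs) = tens s V (map f xs)"
  unfolding tmap_def using assms by (intro tlift_eq multilin_map)

lemma tmap_wsum_tens:
  assumes "hlist V xs ds"
  shows "tmap s V (wsum s V w) (tens s V xs) = fscale (\<Prod>a\<leftarrow>ds. w a) (tens s V xs)"
proof -
  have "tens s V (map (wsum s V w) xs) = fscale (\<Prod>a\<leftarrow>ds. w a) (tens s V xs)"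
    using assms
  proof (induction xs arbitrary: ds)
    case (Cons x xs)
    then obtain a as where ds: "ds = a # as" "x \<in> V a" "hlist V xs as" by auto
    have "tens s V (map (wsum s V w) (x # xs)) = tcons s V (s (w a) x) (tens s V (map (wsum s V w) xs))"
      using ds by (simp add: tcons_tens wsum_hom G_scale V_G)
    also have "\<dots> = tcons s V (s (w a) x) (fscale (\<Prod>a\<leftarrow>as. w a) (tens s V xs))"
      using Cons.IH ds by simp
    also have "\<dots> = fscale (w a * (\<Prod>a\<leftarrow>as. w a)) (tens s V (x # xs))"
      using ds by (simp add: flin_scale[OF flin_tcons] tcons_scale V_G tens_Tens tcons_tens mult.commute)
    finally show ?case using ds by simp
  qed simp
  then show ?thesis
    using tmap_tens[OF graded_space lin_wsum wsum_G] by simp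
qed

lemma prod_list_powi: "(\<Prod>a\<leftarrow>ds. (2::'k) powi a) = 2 powi sum_list ds"
  by (induction ds) (simp_all add: power_int_add)

lemma flin_tmap: "flin (tmap s' V' f)"
  by (simp add: tmap_def flin_tlift)

lemma Tbar_span: "Tbar s V m = fs.span {tens s V xs |xs ds. hlist V xs ds \<and> xs \<noteq> [] \<and> sum_list ds = m}"
  (is "_ = fs.span ?B")
proof
  have "tpow s V n m \<subseteq> fs.span ?B" if "n \<ge> 1" for n
    unfolding tpow_eq using that by (intro fs.span_mono) fastforce
  then show "Tbar s V m \<subseteq> fs.span ?B"
    unfolding Tbar_def by (intro fs.span_minimal) auto
  show "fs.span ?B \<subseteq> Tbar s V m"
    by (rule fs.span_minimal) (auto simp: Tbar_tens, simp add: Tbar_def)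
qed

text \<open>The product of the weights must depend on the total degree alone. This holds for powers
  of 2 and for Koszul signs, the two weights to which the lemma is applied.\<close>

lemma tmap_wsum_Tbar:
  assumes z: "z \<in> Tbar s V m" and w: "\<And>ds. sum_list ds = m \<Longrightarrow> (\<Prod>a\<leftarrow>ds. w a) = c"
  shows "tmap s V (wsum s V w) z = fscale c z"
proof (rule flin_eq_on_span[OF _ _ _ z[unfolded Tbar_span]])
  show "lin_on fscale fscale A (fscale c)" for A
    by (simp add: lin_on_def fs.scale_right_distrib mult.commute)
  fix x assume "x \<in> {tens s V xs |xs ds. hlist V xs ds \<and> xs \<noteq> [] \<and> sum_list ds = m}"
  then show "tmap s V (wsum s V w) x = fscale c x" using w by (auto simp: tmap_wsum_tens)
qed (rule flin_on[OF flin_tmap])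

text \<open>Nothing in the definition of \<open>Tbar\<close> makes the sum of its components direct.
  It is direct because the operator induced by the weights \<open>2 powi n\<close> has eigenvalue
  \<open>2 powi m\<close> on \<open>Tbar s V m\<close>, and these eigenvalues are distinct.\<close>

sublocale T: graded fscale "Tbar s V"
proof
  show "graded_space fscale (Tbar s V)"
  proof (rule graded_space_eigen[OF vector_space_fscale _ flin_tmap _ inj_two_powi])
    show "fs.subspace (Tbar s V n)" for n by (simp add: Tbar_def)
    show "v \<in> Tbar s V n \<Longrightarrow> tmap s V (wsum s V (\<lambda>n. 2 powi n)) v = fscale (2 powi n) v" for n v
      by (rule tmap_wsum_Tbar) (auto simp only: prod_list_powi)
  qed
qed

text \<open>The sign attached to the total degree is the product of the signs of the
  factors.\<close>

lemma koszul_T: "z \<in> T.G \<Longrightarrow> koszul fscale (Tbar s V) e z = tmap s V (koszul s V e) z"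
proof (induction rule: T.G_induct)
  case (hom m z)
  have "(\<Prod>a\<leftarrow>ds. if even (e * a) then 1 else - 1 :: 'k) = (if even (e * sum_list ds) then 1 else - 1)" for ds
    by (induction ds) auto
  with hom(1) have "tmap s V (koszul s V e) z = fscale (if even (e * m) then 1 else - 1) z"
    unfolding koszul_wsum by (intro tmap_wsum_Tbar) auto
  also have "\<dots> = (if even (e * m) then z else - z)" by simp
  finally show ?case using hom by (simp add: T.koszul_hom)
qed (simp add: T.koszul_add flin_add[OF flin_tmap])

end

subsection \<open>Tensor products of two spaces\<close>

definition bilin :: "(int \<Rightarrow> ('a \<Rightarrow> 'k::field) set) \<Rightarrow> (('a \<Rightarrow> 'k) \<Rightarrow> ('a \<Rightarrow> 'k) \<Rightarrow> 'b \<Rightarrow> 'k) \<Rightarrow> bool" where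
  "bilin A g \<longleftrightarrow> (\<forall>x\<in>gtot fscale A.
     lin_on fscale fscale (gtot fscale A) (\<lambda>y. g x y) \<and> lin_on fscale fscale (gtot fscale A) (\<lambda>y. g y x))"

lemma bilin_form: "bilin A g \<Longrightarrow> bilinear_form fscale A (\<lambda>x y. g x y \<phi>)"
  by (simp add: bilin_def bilinear_form_def lin_on_def apply_simps)

lemma tlift2_eq: "bilin A g \<Longrightarrow> tlift2 g (tens2 fscale A x y) = g x y"
  by (rule tlift2_tens2) (rule bilin_form)

lemma gtot_closed:
  "0 \<in> gtot fscale A" "x \<in> gtot fscale A \<Longrightarrow> y \<in> gtot fscale A \<Longrightarrow> x + y \<in> gtot fscale A"
  "x \<in> gtot fscale A \<Longrightarrow> y \<in> gtot fscale A \<Longrightarrow> x - y \<in> gtot fscale A"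
  "x \<in> gtot fscale A \<Longrightarrow> - x \<in> gtot fscale A"
  "x \<in> gtot fscale A \<Longrightarrow> fscale c x \<in> gtot fscale A"
  by (simp_all add: gtot_def fs.span_zero fs.span_add fs.span_scale fs.span_neg fs.span_diff)

lemma subspace_gtot: "fs.subspace (gtot fscale A)"
  by (simp add: gtot_def)

lemma bilin_tens2: "bilin A (tens2 fscale A)"
  by (auto simp: bilin_def tens2_def bilinear_form_def lin_on_def apply_simps fun_eq_iff gtot_closed)

lemma tens2_add_left: "x \<in> gtot fscale A \<Longrightarrow> x' \<in> gtot fscale A \<Longrightarrow> y \<in> gtot fscale A \<Longrightarrow>
    tens2 fscale A (x + x') y = tens2 fscale A x y + tens2 fscale A x' y"
  and tens2_add_right: "x \<in> gtot fscale A \<Longrightarrow> y \<in> gtot fscale A \<Longrightarrow> y' \<in> gtot fscale A \<Longrightarrow>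
    tens2 fscale A x (y + y') = tens2 fscale A x y + tens2 fscale A x y'"
  and tens2_scale_left: "x \<in> gtot fscale A \<Longrightarrow> y \<in> gtot fscale A \<Longrightarrow>
    tens2 fscale A (fscale c x) y = fscale c (tens2 fscale A x y)"
  and tens2_scale_right: "x \<in> gtot fscale A \<Longrightarrow> y \<in> gtot fscale A \<Longrightarrow>
    tens2 fscale A x (fscale c y) = fscale c (tens2 fscale A x y)"
  using bilin_tens2[of A] by (simp_all add: bilin_def lin_on_def)

lemma tens2_zero_left: "y \<in> gtot fscale A \<Longrightarrow> tens2 fscale A 0 y = 0"
  and tens2_zero_right: "y \<in> gtot fscale A \<Longrightarrow> tens2 fscale A y 0 = 0"
  using tens2_scale_left[of y A y 0] tens2_scale_right[of y A y 0] by simp_all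

definition lmap :: "(int \<Rightarrow> ('a \<Rightarrow> 'k::field) set) \<Rightarrow> (int \<Rightarrow> ('b \<Rightarrow> 'k) set) \<Rightarrow>
    (('a \<Rightarrow> 'k) \<Rightarrow> 'b \<Rightarrow> 'k) \<Rightarrow> bool" where
  "lmap A B f \<longleftrightarrow> lin_on fscale fscale (gtot fscale A) f \<and> (\<forall>x\<in>gtot fscale A. f x \<in> gtot fscale B)"

lemma lmapI: "lin_on fscale fscale (gtot fscale A) f \<Longrightarrow> (\<And>x. x \<in> gtot fscale A \<Longrightarrow> f x \<in> gtot fscale B) \<Longrightarrow>
    lmap A B f"
  by (simp add: lmap_def)

lemma lmap_lin: "lmap A B f \<Longrightarrow> lin_on fscale fscale (gtot fscale A) f"
  and lmap_in: "lmap A B f \<Longrightarrow> x \<in> gtot fscale A \<Longrightarrow> f x \<in> gtot fscale B"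
  by (simp_all add: lmap_def)

lemma lmap_add: "lmap A B f \<Longrightarrow> x \<in> gtot fscale A \<Longrightarrow> y \<in> gtot fscale A \<Longrightarrow> f (x + y) = f x + f y"
  and lmap_scale: "lmap A B f \<Longrightarrow> x \<in> gtot fscale A \<Longrightarrow> f (fscale c x) = fscale c (f x)"
  by (simp_all add: lmap_def lin_on_def)

lemma lmap_zero: "lmap A B f \<Longrightarrow> f 0 = 0"
  using lmap_scale[of A B f 0 0] by (simp add: gtot_closed)

lemma lmap_minus: "lmap A B f \<Longrightarrow> x \<in> gtot fscale A \<Longrightarrow> f (- x) = - f x"
  using lmap_scale[of A B f x "-1"] by simp

lemma lmap_diff: "lmap A B f \<Longrightarrow> x \<in> gtot fscale A \<Longrightarrow> y \<in> gtot fscale A \<Longrightarrow> f (x - y) = f x - f y"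
  using lmap_add[of A B f x "- y"] by (simp add: gtot_closed lmap_minus)

lemma lmap_comp: "lmap A B f \<Longrightarrow> lmap B C g \<Longrightarrow> lmap A C (\<lambda>x. g (f x))"
  by (auto simp: lmap_def lin_on_def)

lemma lmap_id: "lmap A A (\<lambda>x. x)" "lmap A A id"
  by (simp_all add: lmap_def lin_on_def)

lemma lmap_plus: "lmap A B f \<Longrightarrow> lmap A B g \<Longrightarrow> lmap A B (\<lambda>x. f x + g x)"
  and lmap_sub: "lmap A B f \<Longrightarrow> lmap A B g \<Longrightarrow> lmap A B (\<lambda>x. f x - g x)"
  by (simp_all add: lmap_def gtot_closed lin_on_plus lin_on_minus vector_space_fscale)

text \<open>The tensor product of two maps without signs. The Koszul sign of \<open>tmap2\<close> is
  moved into the left map, so composition and additivity become sign-free and the sign operator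
  appears as an ordinary map on the left factor.\<close>

definition t2map :: "(int \<Rightarrow> ('b \<Rightarrow> 'k::field) set) \<Rightarrow> (('a \<Rightarrow> 'k) \<Rightarrow> 'b \<Rightarrow> 'k) \<Rightarrow> (('a \<Rightarrow> 'k) \<Rightarrow> 'b \<Rightarrow> 'k) \<Rightarrow>
    ('k, 'a \<Rightarrow> 'k) tensor2 \<Rightarrow> ('k, 'b \<Rightarrow> 'k) tensor2" where
  "t2map B f g = tlift2 (\<lambda>x y. tens2 fscale B (f x) (g y))"

lemma tmap2_t2map: "tmap2 fscale A B e f g = t2map B (\<lambda>x. f (koszul fscale A e x)) g"
  by (simp add: tmap2_def t2map_def)

lemma flin_t2map: "flin (t2map B f g)"
  by (simp add: t2map_def flin_tlift2)

lemma t2map_tens2: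
  assumes "lmap A B f" "lmap A B g"
  shows "t2map B f g (tens2 fscale A x y) = tens2 fscale B (f x) (g y)"
  unfolding t2map_def
  by (rule tlift2_eq)
    (use assms in \<open>simp add: bilin_def lin_on_def lmap_add[OF assms(1)] lmap_add[OF assms(2)]
      lmap_scale[OF assms(1)] lmap_scale[OF assms(2)] lmap_in[OF assms(1)] lmap_in[OF assms(2)]
      tens2_add_left tens2_add_right tens2_scale_left tens2_scale_right\<close>)

definition T2 :: "(int \<Rightarrow> ('a \<Rightarrow> 'k::field) set) \<Rightarrow> ('k, 'a \<Rightarrow> 'k) tensor2 set" where
  "T2 A = fs.span {tens2 fscale A x y |x y. x \<in> gtot fscale A \<and> y \<in> gtot fscale A}"

lemma T2_tens2: "x \<in> gtot fscale A \<Longrightarrow> y \<in> gtot fscale A \<Longrightarrow> tens2 fscale A x y \<in> T2 A"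
  unfolding T2_def by (rule fs.span_base) blast

lemma T2_closed: "0 \<in> T2 A" "X \<in> T2 A \<Longrightarrow> Y \<in> T2 A \<Longrightarrow> X + Y \<in> T2 A"
    "X \<in> T2 A \<Longrightarrow> Y \<in> T2 A \<Longrightarrow> X - Y \<in> T2 A"
  by (simp_all add: T2_def fs.span_zero fs.span_add fs.span_diff)

lemma subspace_T2: "fs.subspace (T2 A)"
  by (simp add: T2_def)

lemma T2_eqI:
  assumes "Z \<in> T2 A" "flin F" "flin F'"
    and "\<And>x y. x \<in> gtot fscale A \<Longrightarrow> y \<in> gtot fscale A \<Longrightarrow> F (tens2 fscale A x y) = F' (tens2 fscale A x y)"
  shows "F Z = F' Z"
proof (rule flin_eq_on_span[OF _ _ _ assms(1)[unfolded T2_def]])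
  fix x assume "x \<in> {tens2 fscale A x y |x y. x \<in> gtot fscale A \<and> y \<in> gtot fscale A}"
  then show "F x = F' x" using assms(4) by blast
qed (rule flin_on, fact)+

lemma t2map_T2:
  assumes Z: "Z \<in> T2 A" and "lmap A B f" "lmap A B g"
  shows "t2map B f g Z \<in> T2 B"
  by (rule flin_span_into[OF flin_on[OF flin_t2map] subspace_T2 _ Z[unfolded T2_def]])
    (auto simp: t2map_tens2[OF assms(2,3)] intro!: T2_tens2 lmap_in[OF assms(2)] lmap_in[OF assms(3)])

lemma t2map_comp:
  assumes "Z \<in> T2 A" "lmap A B f" "lmap A B g" "lmap B C f'" "lmap B C g'"
  shows "t2map C f' g' (t2map B f g Z) = t2map C (\<lambda>x. f' (f x)) (\<lambda>x. g' (g x)) Z"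
  by (rule T2_eqI[OF assms(1)])
    (simp_all add: flin_comp[OF flin_t2map flin_t2map] flin_t2map t2map_tens2[OF assms(2,3)]
      t2map_tens2[OF assms(4,5)] t2map_tens2[OF lmap_comp[OF assms(2,4)] lmap_comp[OF assms(3,5)]])

text \<open>On elements of \<open>T2\<close> only the values on the total space matter. This allows
  maps to be replaced by others that agree with them on tensors alone, such as
  \<open>\<delta>\<close> by \<open>Q - dV\<close>.\<close>

lemma t2map_cong:
  assumes "Z \<in> T2 A" "lmap A B f" "lmap A B g"
    and eq: "\<And>x. x \<in> gtot fscale A \<Longrightarrow> f' x = f x" "\<And>x. x \<in> gtot fscale A \<Longrightarrow> g' x = g x"
  shows "t2map B f' g' Z = t2map B f g Z"
proof (rule T2_eqI[OF assms(1)])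
  have "lmap A B f'"
    by (rule lmapI, rule lin_onI)
      (simp_all add: gtot_closed eq lmap_add[OF assms(2)] lmap_scale[OF assms(2)] lmap_in[OF assms(2)])
  moreover have "lmap A B g'"
    by (rule lmapI, rule lin_onI)
      (simp_all add: gtot_closed eq lmap_add[OF assms(3)] lmap_scale[OF assms(3)] lmap_in[OF assms(3)])
  ultimately show "x \<in> gtot fscale A \<Longrightarrow> y \<in> gtot fscale A \<Longrightarrow>
      t2map B f' g' (tens2 fscale A x y) = t2map B f g (tens2 fscale A x y)" for x y
    by (simp add: t2map_tens2[OF assms(2,3)] t2map_tens2 eq)
qed (rule flin_t2map)+

lemma flin_plus: "flin f \<Longrightarrow> flin g \<Longrightarrow> flin (\<lambda>x. f x + g x)"
  and flin_sub: "flin f \<Longrightarrow> flin g \<Longrightarrow> flin (\<lambda>x. f x - g x)"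
  and flin_id: "flin (\<lambda>x. x)"
  by (auto simp: lin_on_def fs.scale_right_distrib fs.scale_right_diff_distrib algebra_simps)

lemma t2map_plus_left:
  assumes "Z \<in> T2 A" "lmap A B f" "lmap A B f'" "lmap A B g"
  shows "t2map B (\<lambda>x. f x + f' x) g Z = t2map B f g Z + t2map B f' g Z"
  by (rule T2_eqI[OF assms(1)])
    (use assms in \<open>simp_all add: flin_t2map flin_plus t2map_tens2[OF assms(2,4)] t2map_tens2[OF assms(3,4)]
      t2map_tens2[OF lmap_plus[OF assms(2,3)] assms(4)] tens2_add_left lmap_in[OF assms(2)]
      lmap_in[OF assms(3)] lmap_in[OF assms(4)]\<close>)

lemma t2map_plus_right:
  assumes "Z \<in> T2 A" "lmap A B f" "lmap A B g" "lmap A B g'"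
  shows "t2map B f (\<lambda>x. g x + g' x) Z = t2map B f g Z + t2map B f g' Z"
  by (rule T2_eqI[OF assms(1)])
    (use assms in \<open>simp_all add: flin_t2map flin_plus t2map_tens2[OF assms(2,3)] t2map_tens2[OF assms(2,4)]
      t2map_tens2[OF assms(2) lmap_plus[OF assms(3,4)]] tens2_add_right lmap_in[OF assms(2)]
      lmap_in[OF assms(3)] lmap_in[OF assms(4)]\<close>)

lemma t2map_minus_left:
  assumes "Z \<in> T2 A" "lmap A B f" "lmap A B f'" "lmap A B g"
  shows "t2map B (\<lambda>x. f x - f' x) g Z = t2map B f g Z - t2map B f' g Z"
  using t2map_plus_left[OF assms(1) lmap_sub[OF assms(2,3)] assms(3,4)] by (simp add: algebra_simps)

lemma t2map_minus_right:
  assumes "Z \<in> T2 A" "lmap A B f" "lmap A B g" "lmap A B g'"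
  shows "t2map B f (\<lambda>x. g x - g' x) Z = t2map B f g Z - t2map B f g' Z"
  using t2map_plus_right[OF assms(1,2) lmap_sub[OF assms(3,4)] assms(4)] by (simp add: algebra_simps)

lemma t2map_zero_left: "Z \<in> T2 A \<Longrightarrow> lmap A B g \<Longrightarrow> (\<And>x. x \<in> gtot fscale A \<Longrightarrow> f x = 0) \<Longrightarrow> t2map B f g Z = 0"
  and t2map_zero_right: "Z \<in> T2 A \<Longrightarrow> lmap A B g \<Longrightarrow> (\<And>x. x \<in> gtot fscale A \<Longrightarrow> f x = 0) \<Longrightarrow> t2map B g f Z = 0"
proof -
  assume Z: "Z \<in> T2 A" and g: "lmap A B g" and f: "\<And>x. x \<in> gtot fscale A \<Longrightarrow> f x = 0"
  have 0: "lmap A B (\<lambda>x. g x - g x)" using g by (intro lmap_sub)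
  show "t2map B f g Z = 0"
    using t2map_cong[OF Z 0 g, of f g] t2map_minus_left[OF Z g g g] f by simp
  show "t2map B g f Z = 0"
    using t2map_cong[OF Z g 0, of g f] t2map_minus_right[OF Z g g g] f by simp
qed

subsection \<open>The coproduct\<close>

text \<open>The part of the coproduct that splits after \<open>i\<close> factors, set to zero where
  no such split exists; thus the range of \<open>i\<close> need not depend on the length of the
  tensor.\<close>

definition cut :: "('k::field \<Rightarrow> 'v::ab_group_add \<Rightarrow> 'v) \<Rightarrow> (int \<Rightarrow> 'v set) \<Rightarrow> nat \<Rightarrow>
    ('k, 'v) tensor \<Rightarrow> ('k, ('k, 'v) tensor) tensor2" where
  "cut s V i = tlift (\<lambda>xs. if i \<in> {1..<length xs}
     then tens2 fscale (Tbar s V) (tens s V (take i xs)) (tens s V (drop i xs)) else 0)"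

lemma flin_cut: "flin (cut s V i)"
  by (simp add: cut_def flin_tlift)

lemma flin_deconcat: "flin (deconcat s V)"
  by (simp add: deconcat_def flin_tlift)

text \<open>The common form of the natural differential and of the homotopy on tensor powers.\<close>

definition tder :: "('k::field \<Rightarrow> 'v::ab_group_add \<Rightarrow> 'v) \<Rightarrow> (int \<Rightarrow> 'v set) \<Rightarrow> ('v \<Rightarrow> 'v) \<Rightarrow>
    ('v \<Rightarrow> 'v) \<Rightarrow> ('k, 'v) tensor \<Rightarrow> ('k, 'v) tensor" where
  "tder s V \<gamma> k = tlift (\<lambda>xs. \<Sum>j<length xs.
     tens s V (map \<gamma> (take j xs) @ k (xs ! j) # drop (Suc j) xs))"

lemma tdiff_tder: "tdiff s V d1 = tder s V (koszul s V 1) d1"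
  by (simp add: tdiff_def tder_def)

lemma thomotopy_tder: "thomotopy s V i p k = tder s V (\<lambda>x. i (p (koszul s V (- 1) x))) k"
  by (simp add: thomotopy_def tder_def)

lemma flin_tder: "flin (tder s V \<gamma> k)"
  by (simp add: tder_def flin_tlift)

definition gmap :: "('k::field \<Rightarrow> 'v::ab_group_add \<Rightarrow> 'v) \<Rightarrow> (int \<Rightarrow> 'v set) \<Rightarrow> (int \<Rightarrow> 'v set) \<Rightarrow> ('v \<Rightarrow> 'v) \<Rightarrow> bool"
  where "gmap s M N f \<longleftrightarrow> lin_on s s (gtot s M) f \<and> (\<forall>x\<in>gtot s M. f x \<in> gtot s N)"

lemma gmap_lin: "gmap s M N f \<Longrightarrow> lin_on s s (gtot s M) f"
  and gmap_in: "gmap s M N f \<Longrightarrow> x \<in> gtot s M \<Longrightarrow> f x \<in> gtot s N"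
  by (simp_all add: gmap_def)

lemma graded_map_gmap:
  "graded_map s e M N f \<Longrightarrow> graded_space s M \<Longrightarrow> graded_space s N \<Longrightarrow> gmap s M N f"
proof -
  assume f: "graded_map s e M N f" and M: "graded_space s M" and N: "graded_space s N"
  interpret M: graded s M using M by unfold_locales
  show ?thesis using f M.graded_map_G[OF f N] by (simp add: gmap_def graded_map_def)
qed

context tensor_powers
begin

abbreviation "tens2V \<equiv> tens2 fscale (Tbar s V)"

lemma lin_cut:
  assumes xs: "set xs \<subseteq> G" and ys: "set ys \<subseteq> G" and i: "i \<in> {1..<Suc (length xs + length ys)}"
  shows "lin_on s fscale G (\<lambda>v. tens2V (tens s V (take i (xs @ v # ys))) (tens s V (drop i (xs @ v # ys))))"
\<comment> \<open>The variable factor \<open>v\<close> sits at position \<open>length xs\<close>,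
  hence in the right block exactly if \<open>i \<le> length xs\<close>.\<close>
proof (cases "i \<le> length xs")
  case True
  have "set (take i xs) \<subseteq> G" "set (drop i xs) \<subseteq> G"
    using xs set_take_subset set_drop_subset by fastforce+
  moreover from this have "tens s V (take i xs) \<in> T.G" using i True by (intro tens_T) auto
  moreover have "v \<in> G \<Longrightarrow> tens s V (drop i xs @ v # ys) \<in> T.G" for v
    using calculation ys by (intro tens_T) auto
  ultimately show ?thesis
    using True lin_on_comp[OF lin_tens[of "drop i xs" s V ys], of fscale T.G "tens2V (tens s V (take i xs))"]
      ys bilin_tens2[of "Tbar s V"] by (simp add: bilin_def)
next
  case False
  then obtain j where j: "i = Suc (length xs + j)" by (metis less_iff_Suc_add not_le add_Suc_right)
  have "set (take j ys) \<subseteq> G" "set (drop j ys) \<subseteq> G"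
    using ys set_take_subset set_drop_subset by fastforce+
  moreover from this have "tens s V (drop j ys) \<in> T.G" using i j by (intro tens_T) auto
  moreover have "v \<in> G \<Longrightarrow> tens s V (xs @ v # take j ys) \<in> T.G" for v
    using calculation xs by (intro tens_T) auto
  ultimately show ?thesis
    using j lin_on_comp[OF lin_tens[of xs s V "take j ys"], of fscale T.G "\<lambda>x. tens2V x (tens s V (drop j ys))"]
      xs bilin_tens2[of "Tbar s V"] by (simp add: bilin_def)
qed

lemma cut_tens: "cut s V i (tens s V xs) = (if i \<in> {1..<length xs}
     then tens2V (tens s V (take i xs)) (tens s V (drop i xs)) else 0)"
  unfolding cut_def
  by (subst tlift_eq, rule multilin_length)
    (rule lin_cut, assumption+, rule lin_on_const_zero[OF vector_space_fscale], rule refl)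

lemma deconcat_tens: "deconcat s V (tens s V xs) = (\<Sum>i\<in>{1..<length xs}.
    tens2V (tens s V (take i xs)) (tens s V (drop i xs)))"
  unfolding deconcat_def by (subst tlift_eq, rule multilin_sum) (rule lin_cut, simp_all only:)

lemma set_take_G: "set xs \<subseteq> G \<Longrightarrow> set (take i xs) \<subseteq> G"
  and set_drop_G: "set xs \<subseteq> G \<Longrightarrow> set (drop i xs) \<subseteq> G"
  using set_take_subset set_drop_subset by fastforce+

lemma deconcat_tens_T2: "set xs \<subseteq> G \<Longrightarrow> deconcat s V (tens s V xs) \<in> T2 (Tbar s V)"
  unfolding deconcat_tens
  by (intro fs.subspace_sum[OF subspace_T2] T2_tens2 tens_T set_take_G set_drop_G) auto

lemma deconcat_T2: "z \<in> T.G \<Longrightarrow> deconcat s V z \<in> T2 (Tbar s V)"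
proof -
  assume z: "z \<in> T.G"
  show ?thesis
  proof (rule flin_span_into[OF flin_on[OF flin_deconcat] subspace_T2 _ z[unfolded gtot_Tbar]])
    fix x assume "x \<in> {tens s V xs |xs ds. hlist V xs ds \<and> xs \<noteq> []}"
    then show "deconcat s V x \<in> T2 (Tbar s V)" using deconcat_tens_T2 hlist_G by blast
  qed
qed

lemma lmap_tcons: "v \<in> G \<Longrightarrow> lmap (Tbar s V) (Tbar s V) (tcons s V v)"
  using gtot_Tbar_Tens[of s V] by (intro lmapI[OF flin_on[OF flin_tcons]] tcons_Tbar) auto

lemma deconcat_single: "deconcat s V (tens s V [v]) = 0"
  by (simp add: deconcat_tens)

text \<open>Either the cut falls directly after \<open>v\<close>, or it cuts \<open>z\<close> and
  leaves \<open>v\<close> in the left block. The first alternative requires \<open>z\<close> to have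
  positive length, hence the reduced tensors.\<close>

lemma deconcat_tcons:
  assumes v: "v \<in> G" and z: "z \<in> T.G"
  shows "deconcat s V (tcons s V v z) =
    tens2V (tens s V [v]) z + t2map (Tbar s V) (tcons s V v) (\<lambda>x. x) (deconcat s V z)"
  using z
proof (induction rule: Tbar_induct)
  case (tens xs ds)
  have [simp]: "{Suc 0..<Suc (length xs)} = insert (Suc 0) {Suc (Suc 0)..<Suc (length xs)}"
    using tens(2) by (cases xs) auto
  have xs: "set xs \<subseteq> G" using tens hlist_G by blast
  have "(\<Sum>i\<in>{Suc (Suc 0)..<Suc (length xs)}.
      tens2V (tens s V (take i (v # xs))) (tens s V (drop i (v # xs)))) =
    (\<Sum>i\<in>{Suc 0..<length xs}. tens2V (tens s V (v # take i xs)) (tens s V (drop i xs)))"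
    unfolding sum.shift_bounds_Suc_ivl by simp
  then show ?case
    using v xs by (simp add: tcons_tens deconcat_tens flin_sum[OF flin_t2map]
        t2map_tens2[OF lmap_tcons lmap_id(1)])
next
  case lin
  show ?case by (rule flin_on[OF flin_comp[OF flin_tcons flin_deconcat]])
next
  case lin'
  show ?case
  proof (rule lin_on_plus[OF vector_space_fscale])
    show "lin_on fscale fscale T.G (\<lambda>z. tens2V (tens s V [v]) z)"
      using bilin_tens2[of "Tbar s V"] tens_T[of "[v]"] v by (simp add: bilin_def)
  qed (rule flin_on[OF flin_comp[OF flin_deconcat flin_t2map]])
qed

lemma lin_tder:
  assumes g: "gmap s V V \<gamma>" and k: "gmap s V V k" and xs: "set xs \<subseteq> G" and ys: "set ys \<subseteq> G"
    and j: "j < Suc (length xs + length ys)"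
  shows "lin_on s fscale G (\<lambda>v. tens s V (map \<gamma> (take j (xs @ v # ys)) @ k ((xs @ v # ys) ! j) #
     drop (Suc j) (xs @ v # ys)))"
proof -
  consider "j < length xs" | "j = length xs" | i where "j = Suc (length xs + i)" "i < length ys"
  proof (cases j "length xs" rule: linorder_cases)
    case greater
    then obtain i where "j = Suc (length xs + i)" by (auto dest: less_imp_Suc_add)
    then show thesis using j that(3) by simp
  qed (use that in auto)
  then show ?thesis
  proof cases
    case 1
    have "set (map \<gamma> (take j xs) @ k (xs ! j) # drop (Suc j) xs) \<subseteq> G"
      using 1 xs set_take_G[OF xs, of j] set_drop_G[OF xs, of "Suc j"] gmap_in[OF g] gmap_in[OF k] nth_mem[OF 1]
      by (auto simp del: nth_mem)
    from lin_tens[OF this ys] 1 show ?thesis by (simp add: nth_append)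
  next
    case 2
    have "set (map \<gamma> xs) \<subseteq> G" using xs gmap_in[OF g] by auto
    from lin_on_comp[OF gmap_lin[OF k] lin_tens[OF this ys]] 2 show ?thesis
      using gmap_in[OF k] by simp
  next
    case 3
    have 1: "set (map \<gamma> xs) \<subseteq> G" using xs gmap_in[OF g] by auto
    have "set (map \<gamma> (take i ys) @ k (ys ! i) # drop (Suc i) ys) \<subseteq> G"
      using 3 ys set_take_G[OF ys, of i] set_drop_G[OF ys, of "Suc i"] gmap_in[OF g] gmap_in[OF k] nth_mem[OF 3(2)]
      by (auto simp del: nth_mem)
    from lin_on_comp[OF gmap_lin[OF g] lin_tens[OF 1 this]] 3 show ?thesis
      using gmap_in[OF g] by (simp add: nth_append)
  qed
qed

lemma tder_tens:
  assumes "gmap s V V \<gamma>" "gmap s V V k"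
  shows "tder s V \<gamma> k (tens s V xs) =
    (\<Sum>j<length xs. tens s V (map \<gamma> (take j xs) @ k (xs ! j) # drop (Suc j) xs))"
  unfolding tder_def
  by (subst tlift_eq, rule multilin_sum[where J = "\<lambda>n. {..<n}"])
    (rule lin_tder[OF assms], simp_all only: lessThan_iff)

lemma tder_Nil: "gmap s V V \<gamma> \<Longrightarrow> gmap s V V k \<Longrightarrow> tder s V \<gamma> k (tens s V []) = 0"
  by (simp add: tder_tens)

text \<open>Leibniz rule: \<open>k\<close> hits the first factor, or passes it and leaves
  \<open>\<gamma>\<close> behind. The contraction identities on tensor powers are derived from this
  recursion.\<close>

lemma tder_tcons:
  assumes g: "gmap s V V \<gamma>" and k: "gmap s V V k" and v: "v \<in> G" and z: "z \<in> Tens s V"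
  shows "tder s V \<gamma> k (tcons s V v z) = tcons s V (k v) z + tcons s V (\<gamma> v) (tder s V \<gamma> k z)"
  using z
proof (induction rule: Tens_induct)
  case (tens xs ds)
  then show ?case
    using v gmap_in[OF g] gmap_in[OF k]
    by (simp add: tcons_tens tder_tens[OF g k] flin_sum[OF flin_tcons] sum.lessThan_Suc_shift
        del: sum.lessThan_Suc)
qed (intro flin_plus flin_comp[OF flin_tcons flin_tder] flin_comp[OF flin_tder flin_tcons] flin_tcons)+

end

section \<open>The filtration by tensor length\<close>

definition Tle :: "('k::field \<Rightarrow> 'v::ab_group_add \<Rightarrow> 'v) \<Rightarrow> (int \<Rightarrow> 'v set) \<Rightarrow> nat \<Rightarrow> ('k, 'v) tensor set"
  where "Tle s V N = fs.span (\<Union>m\<in>{1..N}. gtot fscale (tpow s V m))"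

lemma subspace_Tle: "fs.subspace (Tle s V N)"
  by (simp add: Tle_def)

lemma Tle_0 [simp]: "Tle s V 0 = {0}"
  by (simp add: Tle_def)

lemma Tle_mono: "M \<le> N \<Longrightarrow> Tle s V M \<subseteq> Tle s V N"
  unfolding Tle_def by (rule fs.span_mono) force

lemma tpow_Tle: "1 \<le> n \<Longrightarrow> n \<le> N \<Longrightarrow> gtot fscale (tpow s V n) \<subseteq> Tle s V N"
  unfolding Tle_def by (rule order_trans[OF _ fs.span_superset]) auto

lemma tpow_Tbar: "1 \<le> n \<Longrightarrow> gtot fscale (tpow s V n) \<subseteq> gtot fscale (Tbar s V)"
  unfolding gtot_tpow gtot_Tbar by (rule fs.span_mono) auto

lemma Tle_Tbar: "Tle s V N \<subseteq> gtot fscale (Tbar s V)"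
  unfolding Tle_def
  by (rule fs.span_minimal[OF _ subspace_gtot], rule UN_least, rule tpow_Tbar) simp

lemma tens_tpow: "hlist V xs ds \<Longrightarrow> tens s V xs \<in> gtot fscale (tpow s V (length xs))"
  unfolding gtot_tpow by (rule fs.span_base) blast

text \<open>A tensor is a finite sum of pure ones, so its length is bounded; this is what makes a
  length-lowering series finite on it.\<close>

lemma Tbar_Tle:
  assumes "z \<in> gtot fscale (Tbar s V)"
  shows "\<exists>N. z \<in> Tle s V N"
  using assms[unfolded gtot_Tbar]
proof (induction rule: fs.span_induct_alt)
  case base
  show ?case using fs.subspace_0[OF subspace_Tle] by blast
next
  case (step c x y)
  then obtain N xs ds where y: "y \<in> Tle s V N" and x: "x = tens s V xs" "hlist V xs ds" "xs \<noteq> []" by blast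
  let ?M = "max N (length xs)"
  have "x \<in> Tle s V ?M"
    using subsetD[OF tpow_Tle tens_tpow[OF x(2)], of "?M"] x(1,3) by (simp add: Suc_le_eq)
  moreover have "y \<in> Tle s V ?M" using y Tle_mono[of N ?M s V] by auto
  ultimately have "fscale c x + y \<in> Tle s V ?M"
    by (intro fs.subspace_add[OF subspace_Tle] fs.subspace_scale[OF subspace_Tle])
  then show ?case by blast
qed

lemma Tle_into:
  assumes L: "lin_on fscale fscale (gtot fscale (Tbar s V)) L" and K: "fs.subspace K"
    and n: "\<And>n. 1 \<le> n \<Longrightarrow> n \<le> N \<Longrightarrow> L ` gtot fscale (tpow s V n) \<subseteq> K" and z: "z \<in> Tle s V N"
  shows "L z \<in> K"
proof (rule flin_span_into[OF _ K _ z[unfolded Tle_def]])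
  show "lin_on fscale fscale (fs.span (\<Union>m\<in>{1..N}. gtot fscale (tpow s V m))) L"
    by (rule lin_on_subset[OF L]) (use Tle_Tbar[of s V N] in \<open>simp add: Tle_def\<close>)
  fix x assume "x \<in> (\<Union>m\<in>{1..N}. gtot fscale (tpow s V m))"
  then obtain m where "1 \<le> m" "m \<le> N" "x \<in> gtot fscale (tpow s V m)" by auto
  then show "L x \<in> K" using n[of m] by blast
qed

text \<open>The target family \<open>B\<close> is left open so that the rule covers both maps into
  \<open>Tbar\<close> and projections onto a single tensor power.\<close>

lemma graded_map_TbarI:
  assumes f: "lin_on fscale fscale (gtot fscale (Tbar s V)) f"
    and B: "\<And>n. fs.subspace (B n)"
    and tens: "\<And>xs ds. hlist V xs ds \<Longrightarrow> xs \<noteq> [] \<Longrightarrow> f (tens s V xs) \<in> B (sum_list ds + e)"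
    and z: "z \<in> Tbar s V n"
  shows "f z \<in> B (n + e)"
proof -
  let ?S = "{tens s V xs |xs ds. hlist V xs ds \<and> xs \<noteq> [] \<and> sum_list ds = n}"
  have "tpow s V l n \<subseteq> fs.span ?S" if "l \<ge> 1" for l
    unfolding tpow_eq using that by (intro fs.span_mono) fastforce
  then have "Tbar s V n \<subseteq> fs.span ?S"
    unfolding Tbar_def by (intro fs.span_minimal) auto
  with z have z: "z \<in> fs.span ?S" by blast
  have lin: "lin_on fscale fscale (fs.span ?S) f"
    by (rule lin_on_subset[OF f]) (unfold gtot_Tbar, rule fs.span_mono, blast)
  have "x \<in> ?S \<Longrightarrow> f x \<in> B (n + e)" for x using tens by blast
  from flin_span_into[OF lin B this z] show ?thesis .
qed

section \<open>Induced maps on tensor powers: degree, length and compatibility with the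
  coproduct\<close>

context tensor_powers
begin

lemma tmap_tens_gmap:
  assumes "graded_space s M" "gmap s M V f"
  shows "tmap s V f (tens s M xs) = tens s V (map f xs)"
  by (rule tmap_tens) (use assms in \<open>auto simp: gmap_def\<close>)

lemma tmap_tcons:
  assumes M: "graded_space s M" and f: "gmap s M V f" and v: "v \<in> gtot s M" and z: "z \<in> Tens s M"
  shows "tmap s V f (tcons s M v z) = tcons s V (f v) (tmap s V f z)"
proof -
  interpret M: tensor_powers s M using M by unfold_locales
  from z show ?thesis
  proof (induction rule: Tens_induct)
    case (tens xs ds)
    then show ?case
      using v gmap_in[OF f v] by (simp add: M.tcons_tens tcons_tens tmap_tens_gmap[OF M f])
  qed (intro flin_comp[OF flin_tcons flin_tmap] flin_comp[OF flin_tmap flin_tcons])+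
qed

lemma tmap_hlist:
  assumes M: "graded_space s M" and f: "graded_map s 0 M V f" and xs: "hlist M xs ds"
  shows "hlist V (map f xs) ds"
  using xs
proof (induction xs arbitrary: ds)
  case (Cons x xs)
  then obtain a as where "ds = a # as" "x \<in> M a" "hlist M xs as" by auto
  moreover have "f ` M a \<subseteq> V (a + 0)" using f unfolding graded_map_def by blast
  ultimately show ?case using Cons.IH by auto
qed simp

lemma graded_map_tmap:
  assumes M: "graded_space s M" and f: "graded_map s 0 M V f"
  shows "graded_map fscale 0 (Tbar s M) (Tbar s V) (tmap s V f)"
    and "tmap s V f ` gtot fscale (tpow s M n) \<subseteq> gtot fscale (tpow s V n)"
proof -
  have gf: "gmap s M V f" by (rule graded_map_gmap[OF f M graded_space])
  show "graded_map fscale 0 (Tbar s M) (Tbar s V) (tmap s V f)"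
    unfolding graded_map_def
  proof (intro conjI allI image_subsetI)
    fix n z assume "z \<in> Tbar s M n"
    then show "tmap s V f z \<in> Tbar s V (n + 0)"
    proof (rule graded_map_TbarI[OF flin_on[OF flin_tmap], where B = "Tbar s V", rotated 2])
      fix xs ds assume "hlist M xs ds" "xs \<noteq> []"
      then show "tmap s V f (tens s M xs) \<in> Tbar s V (sum_list ds + 0)"
        using Tbar_tens[OF tmap_hlist[OF M f]] by (simp add: tmap_tens_gmap[OF M gf])
    qed (rule T.subspace_V)
  qed (rule flin_on[OF flin_tmap])
  show "tmap s V f ` gtot fscale (tpow s M n) \<subseteq> gtot fscale (tpow s V n)"
  proof (rule image_subsetI)
    fix z assume "z \<in> gtot fscale (tpow s M n)"
    then show "tmap s V f z \<in> gtot fscale (tpow s V n)"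
      unfolding gtot_tpow[of s M]
    proof (rule flin_span_into[OF flin_on[OF flin_tmap] subspace_gtot, rotated])
      fix x assume "x \<in> {tens s M xs |xs ds. hlist M xs ds \<and> length xs = n}"
      then show "tmap s V f x \<in> gtot fscale (tpow s V n)"
        using tens_tpow[OF tmap_hlist[OF M f]] by (auto simp: tmap_tens_gmap[OF M gf])
    qed
  qed
qed

lemma graded_map_lmap:
  "graded_map fscale e A B f \<Longrightarrow> graded_space fscale A \<Longrightarrow> graded_space fscale B \<Longrightarrow> lmap A B f"
  using graded_map_gmap[of fscale e A B f] by (simp add: lmap_def gmap_def)

lemma lmap_tmap:
  assumes M: "graded_space s M" and f: "graded_map s 0 M V f"
  shows "lmap (Tbar s M) (Tbar s V) (tmap s V f)"
proof -
  interpret M: tensor_powers s M using M by unfold_locales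
  show ?thesis
    by (rule graded_map_lmap[OF graded_map_tmap(1)[OF M f] M.T.graded_space T.graded_space])
qed

lemma tder_tpow:
  assumes g: "graded_map s 0 V V \<gamma>" and k: "graded_map s e V V k" and xs: "hlist V xs ds"
  shows "tder s V \<gamma> k (tens s V xs) \<in> tpow s V (length xs) (sum_list ds + e)"
  using xs
proof (induction xs arbitrary: ds)
  case Nil
  then show ?case
    using graded_map_gmap[OF g graded_space graded_space] graded_map_gmap[OF k graded_space graded_space]
    by (simp add: tder_Nil tpow_def fs.span_zero)
next
  case (Cons x xs)
  note gg = graded_map_gmap[OF g graded_space graded_space]
    and gk = graded_map_gmap[OF k graded_space graded_space]
  obtain a as where ds: "ds = a # as" and x: "x \<in> V a" and xs: "hlist V xs as" using Cons.prems by auto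
  have "k ` V a \<subseteq> V (a + e)" "\<gamma> ` V a \<subseteq> V (a + 0)" using k g unfolding graded_map_def by blast+
  then have kx: "k x \<in> V (a + e)" and gx: "\<gamma> x \<in> V a" using x by auto
  have "tcons s V (k x) (tens s V xs) \<in> tpow s V (Suc (length xs)) (a + e + sum_list as)"
    using kx tpow_tens[OF xs] by (rule tcons_tpow)
  moreover have "tcons s V (\<gamma> x) (tder s V \<gamma> k (tens s V xs)) \<in> tpow s V (Suc (length xs)) (a + (sum_list as + e))"
    using gx Cons.IH[OF xs] by (rule tcons_tpow)
  moreover have "tder s V \<gamma> k (tens s V (x # xs)) =
      tcons s V (k x) (tens s V xs) + tcons s V (\<gamma> x) (tder s V \<gamma> k (tens s V xs))"
    using tder_tcons[OF gg gk V_G[OF x] tens_Tens[OF xs]] x by (simp add: tcons_tens V_G)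
  ultimately show ?case
    by (simp add: ds tpow_def fs.span_add algebra_simps)
qed

lemma graded_map_tder:
  assumes g: "graded_map s 0 V V \<gamma>" and k: "graded_map s e V V k"
  shows "graded_map fscale e (Tbar s V) (Tbar s V) (tder s V \<gamma> k)"
    and "tder s V \<gamma> k ` gtot fscale (tpow s V n) \<subseteq> gtot fscale (tpow s V n)"
proof -
  show "graded_map fscale e (Tbar s V) (Tbar s V) (tder s V \<gamma> k)"
    unfolding graded_map_def
  proof (intro conjI allI image_subsetI)
    fix n z assume "z \<in> Tbar s V n"
    then show "tder s V \<gamma> k z \<in> Tbar s V (n + e)"
    proof (rule graded_map_TbarI[OF flin_on[OF flin_tder], where B = "Tbar s V", rotated 2])
      fix xs ds assume "hlist V xs ds" "xs \<noteq> []"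
      then show "tder s V \<gamma> k (tens s V xs) \<in> Tbar s V (sum_list ds + e)"
        using tder_tpow[OF g k] Tbar_tpow[of "length xs" s V] by (fastforce simp: Suc_le_eq)
    qed (rule T.subspace_V)
  qed (rule flin_on[OF flin_tder])
  show "tder s V \<gamma> k ` gtot fscale (tpow s V n) \<subseteq> gtot fscale (tpow s V n)"
  proof (rule image_subsetI)
    fix z assume "z \<in> gtot fscale (tpow s V n)"
    then show "tder s V \<gamma> k z \<in> gtot fscale (tpow s V n)"
      unfolding gtot_tpow[of s V]
    proof (rule flin_span_into[OF flin_on[OF flin_tder] fs.subspace_span, rotated])
      fix x assume "x \<in> {tens s V xs |xs ds. hlist V xs ds \<and> length xs = n}"
      then obtain xs ds where "x = tens s V xs" "hlist V xs ds" "length xs = n" by blast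
      then have "tder s V \<gamma> k x \<in> gtot fscale (tpow s V n)"
        using tder_tpow[OF g k, of xs ds] by (auto simp: gtot_def intro: fs.span_base)
      then show "tder s V \<gamma> k x \<in> fs.span {tens s V xs |xs ds. hlist V xs ds \<and> length xs = n}"
        unfolding gtot_tpow .
    qed
  qed
qed

lemma lmap_tder:
  "graded_map s 0 V V \<gamma> \<Longrightarrow> graded_map s e V V k \<Longrightarrow> lmap (Tbar s V) (Tbar s V) (tder s V \<gamma> k)"
  by (rule graded_map_lmap[OF graded_map_tder(1) T.graded_space T.graded_space])

lemma tmap_Nil: "graded_space s M \<Longrightarrow> gmap s M V f \<Longrightarrow> tmap s V f (tens s M []) = tens s V []"
  by (simp add: tmap_tens_gmap)

text \<open>If \<open>k\<close> acts in the left block of a cut, the right block is untouched; if it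
  acts in the right block, it has passed every factor of the left block, which contributes
  \<open>tmap s V \<gamma>\<close>. With the sign operator as \<open>\<gamma>\<close> this makes the
  natural differential a coderivation; with the sign operator followed by \<open>p\<close> it is the
  compatibility of the homotopy with the coproduct. All Koszul signs are contained in
  \<open>\<gamma>\<close>.\<close>

lemma deconcat_tder:
  assumes g: "graded_map s 0 V V \<gamma>" and k: "graded_map s e V V k" and z: "z \<in> T.G"
  shows "deconcat s V (tder s V \<gamma> k z) =
    t2map (Tbar s V) (tder s V \<gamma> k) (\<lambda>x. x) (deconcat s V z) +
    t2map (Tbar s V) (tmap s V \<gamma>) (tder s V \<gamma> k) (deconcat s V z)"
  using z
proof (induction rule: Tbar_induct)
  case (tens xs ds)
  let ?A = "Tbar s V" and ?H = "tder s V \<gamma> k" and ?g = "tmap s V \<gamma>"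
  note gg = graded_map_gmap[OF g graded_space graded_space]
    and gk = graded_map_gmap[OF k graded_space graded_space]
  have H: "lmap ?A ?A ?H" by (rule lmap_tder[OF g k])
  have tg: "lmap ?A ?A ?g" by (rule lmap_tmap[OF graded_space g])
  show ?case using tens(2,1)
  proof (induction xs arbitrary: ds rule: list_nonempty_induct)
    case (single x)
    then have x: "x \<in> G" using hlist_G by fastforce
    have "?H (tens s V [x]) = tens s V [k x]" by (simp add: tder_tens[OF gg gk])
    then show ?case by (simp add: deconcat_single flin_zero[OF flin_t2map])
  next
    case (cons x xs)
    then obtain as where xs: "hlist V xs as" by auto
    have x: "x \<in> G" using cons.prems hlist_G by fastforce
    have gx: "\<gamma> x \<in> G" and kx: "k x \<in> G" using x gmap_in[OF gg] gmap_in[OF gk] by auto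
    let ?z = "tens s V xs" let ?a = "deconcat s V ?z"
    have zT: "?z \<in> T.G" using xs cons.hyps by (rule tens_gtot)
    then have zTens: "?z \<in> Tens s V" using gtot_Tbar_Tens by blast
    have a: "?a \<in> T2 ?A" using zT by (rule deconcat_T2)
    note cx = lmap_tcons[OF x] and cgx = lmap_tcons[OF gx] and ckx = lmap_tcons[OF kx]
    have sT: "tens s V [v] \<in> T.G" if "v \<in> G" for v using that by (intro tens_T) auto
    have Hx: "?H (tens s V [x]) = tens s V [k x]" by (simp add: tder_tens[OF gg gk])
    have gxs: "?g (tens s V [x]) = tens s V [\<gamma> x]" by (simp add: tmap_tens_gmap[OF graded_space gg])
    have Hc: "?H (tcons s V x y) = tcons s V (k x) y + tcons s V (\<gamma> x) (?H y)" if "y \<in> T.G" for y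
      using that gtot_Tbar_Tens by (intro tder_tcons[OF gg gk x]) blast
    have gc: "?g (tcons s V x y) = tcons s V (\<gamma> x) (?g y)" if "y \<in> T.G" for y
      using that gtot_Tbar_Tens by (intro tmap_tcons[OF graded_space gg x]) blast
    have e1: "t2map ?A (tcons s V (\<gamma> x)) (\<lambda>x. x) (t2map ?A ?H (\<lambda>x. x) ?a + t2map ?A ?g ?H ?a) =
       t2map ?A (\<lambda>y. tcons s V (\<gamma> x) (?H y)) (\<lambda>x. x) ?a + t2map ?A (\<lambda>y. tcons s V (\<gamma> x) (?g y)) ?H ?a"
      by (simp only: flin_add[OF flin_t2map] t2map_comp[OF a H lmap_id(1) cgx lmap_id(1)]
          t2map_comp[OF a tg H cgx lmap_id(1)])
    have "?H (tens s V (x # xs)) = tcons s V (k x) ?z + tcons s V (\<gamma> x) (?H ?z)"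
      using Hc[OF zT] by (simp only: tcons_tens[OF x])
    then have lhs: "deconcat s V (?H (tens s V (x # xs))) =
       tens2V (tens s V [k x]) ?z + t2map ?A (tcons s V (k x)) (\<lambda>x. x) ?a +
       (tens2V (tens s V [\<gamma> x]) (?H ?z) + (t2map ?A (\<lambda>y. tcons s V (\<gamma> x) (?H y)) (\<lambda>x. x) ?a +
        t2map ?A (\<lambda>y. tcons s V (\<gamma> x) (?g y)) ?H ?a))"
      by (simp only: flin_add[OF flin_deconcat] deconcat_tcons[OF kx zT]
          deconcat_tcons[OF gx lmap_in[OF H zT]] cons.IH[OF xs] e1)
    have d: "deconcat s V (tens s V (x # xs)) = tens2V (tens s V [x]) ?z + t2map ?A (tcons s V x) (\<lambda>x. x) ?a"
      using deconcat_tcons[OF x zT] by (simp add: tcons_tens x)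
    have e2: "t2map ?A (\<lambda>y. ?H (tcons s V x y)) (\<lambda>x. x) ?a =
        t2map ?A (tcons s V (k x)) (\<lambda>x. x) ?a + t2map ?A (\<lambda>y. tcons s V (\<gamma> x) (?H y)) (\<lambda>x. x) ?a"
      unfolding t2map_plus_left[OF a ckx lmap_comp[OF H cgx] lmap_id(1), symmetric]
      by (rule t2map_cong[OF a lmap_plus[OF ckx lmap_comp[OF H cgx]] lmap_id(1)]) (simp_all add: Hc)
    have r1: "t2map ?A ?H (\<lambda>x. x) (deconcat s V (tens s V (x # xs))) =
       tens2V (tens s V [k x]) ?z + (t2map ?A (tcons s V (k x)) (\<lambda>x. x) ?a +
       t2map ?A (\<lambda>y. tcons s V (\<gamma> x) (?H y)) (\<lambda>x. x) ?a)"
      by (simp only: d flin_add[OF flin_t2map] t2map_tens2[OF H lmap_id(1)] Hx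
          t2map_comp[OF a cx lmap_id(1) H lmap_id(1)] e2)
    have e3: "t2map ?A (\<lambda>y. ?g (tcons s V x y)) ?H ?a = t2map ?A (\<lambda>y. tcons s V (\<gamma> x) (?g y)) ?H ?a"
      by (rule t2map_cong[OF a lmap_comp[OF tg cgx] H]) (simp_all add: gc)
    have r2: "t2map ?A ?g ?H (deconcat s V (tens s V (x # xs))) =
       tens2V (tens s V [\<gamma> x]) (?H ?z) + t2map ?A (\<lambda>y. tcons s V (\<gamma> x) (?g y)) ?H ?a"
      by (simp only: d flin_add[OF flin_t2map] t2map_tens2[OF tg H] gxs
          t2map_comp[OF a cx lmap_id(1) tg H] e3)
    show ?case unfolding lhs r1 r2 by (simp add: algebra_simps)
  qed
next
  case lin
  show ?case by (rule flin_on[OF flin_comp[OF flin_tder flin_deconcat]])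
next
  case lin'
  show ?case
    by (rule flin_on[OF flin_plus[OF flin_comp[OF flin_deconcat flin_t2map] flin_comp[OF flin_deconcat flin_t2map]]])
qed

lemma deconcat_tmap:
  assumes M: "graded_space s M" and f: "graded_map s 0 M V f" and z: "z \<in> gtot fscale (Tbar s M)"
  shows "deconcat s V (tmap s V f z) = t2map (Tbar s V) (tmap s V f) (tmap s V f) (deconcat s M z)"
proof -
  interpret M: tensor_powers s M using M by unfold_locales
  note gf = graded_map_gmap[OF f M graded_space] and tf = lmap_tmap[OF M f]
  from z show ?thesis
  proof (induction rule: Tbar_induct)
    case (tens xs ds)
    then show ?case
      by (simp add: tmap_tens_gmap[OF M gf] deconcat_tens M.deconcat_tens flin_sum[OF flin_t2map]
          t2map_tens2[OF tf tf] take_map drop_map)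
  next
    case lin
    show ?case by (rule flin_on[OF flin_comp[OF flin_tmap flin_deconcat]])
  next
    case lin'
    show ?case by (rule flin_on[OF flin_comp[OF flin_deconcat flin_t2map]])
  qed
qed

lemma tmap_comp:
  assumes "graded_space s M" "graded_space s N" "gmap s M N f" "gmap s N V g" "z \<in> Tens s M"
  shows "tmap s V g (tmap s N f z) = tmap s V (\<lambda>x. g (f x)) z"
proof -
  interpret N: tensor_powers s N using assms by unfold_locales
  have gf: "gmap s M V (\<lambda>x. g (f x))" using assms(3,4) by (auto simp: gmap_def lin_on_def)
  show ?thesis
    by (rule Tens_induct[OF assms(5)])
      (simp_all add: flin_tmap flin_comp[OF flin_tmap flin_tmap] N.tmap_tens_gmap[OF assms(1,3)]
       tmap_tens_gmap[OF assms(2,4)] tmap_tens_gmap[OF assms(1) gf] comp_def)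
qed

end

subsection \<open>The symmetric coalgebra\<close>

definition sg :: "int \<Rightarrow> 'k::field" where "sg e = (if even e then 1 else - 1)"

lemma sg_mult: "sg a * sg b = sg (a + b)"
  by (simp add: sg_def)

lemma sg_square [simp]: "sg a * sg a = 1"
  by (simp add: sg_def)

definition lenp :: "('k::field \<Rightarrow> 'v::ab_group_add \<Rightarrow> 'v) \<Rightarrow> (int \<Rightarrow> 'v set) \<Rightarrow> nat \<Rightarrow>
    ('k, 'v) tensor \<Rightarrow> ('k, 'v) tensor" where
  "lenp s V n = tlift (\<lambda>xs. if length xs = n then tens s V xs else 0)"

text \<open>Concatenation of tensors. Linear in \<open>x\<close> by construction, whereas linearity
  in \<open>y\<close> is available only when \<open>x\<close> and \<open>y\<close> are
  tensors.\<close>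

definition tprod :: "('k::field \<Rightarrow> 'v::ab_group_add \<Rightarrow> 'v) \<Rightarrow> (int \<Rightarrow> 'v set) \<Rightarrow>
    ('k, 'v) tensor \<Rightarrow> ('k, 'v) tensor \<Rightarrow> ('k, 'v) tensor" where
  "tprod s V x y = tlift (\<lambda>xs. tlift (\<lambda>ys. tens s V (xs @ ys)) y) x"

lemma flin_lenp: "flin (lenp s V n)"
  by (simp add: lenp_def flin_tlift)

lemma flin_twist: "flin (twist s V i)"
  by (simp add: twist_def flin_tlift)

lemma flin_tprod: "flin (\<lambda>x. tprod s V x y)"
  by (simp add: tprod_def flin_tlift)

text \<open>One condition for all lengths at once: \<open>twist s V i\<close> is the identity on
  tensors without a factor in position \<open>i + 1\<close>, so positions beyond the length impose
  nothing.\<close>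

definition tinv :: "('k::field \<Rightarrow> 'v::ab_group_add \<Rightarrow> 'v) \<Rightarrow> (int \<Rightarrow> 'v set) \<Rightarrow> ('k, 'v) tensor \<Rightarrow> bool"
  where "tinv s V z \<longleftrightarrow> (\<forall>i. twist s V i z = z)"

lemma subspace_tinv: "fs.subspace {z. tinv s V z}"
  unfolding tinv_def by (rule fs.subspaceI)
    (simp_all add: flin_zero[OF flin_twist] flin_add[OF flin_twist] flin_scale[OF flin_twist])

lemma lin_subset_span:
  assumes "flin f" "\<And>x. x \<in> B \<Longrightarrow> f x \<in> K" "fs.subspace K" "x \<in> fs.span B"
  shows "f x \<in> K"
  using flin_span_into[OF flin_on[OF assms(1)] assms(3,2,4)] .

lemma (in graded) hpart_graded_map:
  assumes f: "graded_map s 0 V N f" and N: "graded_space s N" and v: "v \<in> G"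
  shows "hpart N n (f v) = f (hpart V n v)"
proof -
  interpret N: graded s N using N by unfold_locales
  have lin: "lin_on s s G f" and fV: "\<And>n. f ` V n \<subseteq> N (n + 0)"
    using f unfolding graded_map_def by blast+
  have f0: "f 0 = 0" by (rule lin_on_zero[OF lin G_0 vs.vector_space_axioms vs.vector_space_axioms])
  from v show ?thesis
  proof (induction rule: G_induct)
    case (hom m v)
    then have "f v \<in> N m" using fV[of m] by auto
    then show ?case using hom by (simp add: hpart_hom N.hpart_hom f0)
  next
    case (add x y)
    then show ?case
      by (simp add: lin_on_add[OF lin] hpart_add N.hpart_add graded_map_G[OF f N] V_G[OF hpart_V])
  qed
qed

context tensor_powers
begin

lemma lenp_tens: "lenp s V n (tens s V xs) = (if length xs = n then tens s V xs else 0)"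
  unfolding lenp_def
  by (subst tlift_eq, rule multilin_length)
    (rule lin_tens, assumption+, rule lin_on_const_zero[OF vector_space_fscale], rule refl)

lemma tens_eq_zero: "set xs \<subseteq> G \<Longrightarrow> set ys \<subseteq> G \<Longrightarrow> tens s V (xs @ 0 # ys) = 0"
  by (rule lin_on_zero[OF lin_tens G_0 vs.vector_space_axioms vector_space_fscale])

text \<open>The delicate slot is the one whose vector also controls the degrees summed over; there
  (\<open>lin1\<close>) sums are added by means of their finite supports. In the other slots
  (\<open>lin2\<close>) the support is that of a fixed vector, and the sum becomes an ordinary
  finite one.\<close>

lemma lin_swap:
  assumes xs: "set xs \<subseteq> G" and ys: "set ys \<subseteq> G" and i: "Suc i < Suc (length xs + length ys)"
  shows "lin_on s fscale G (\<lambda>v. let zs = xs @ v # ys in Sum_any (\<lambda>a. tens s V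
       (take i zs @ koszul s V a (zs ! Suc i) # hpart V a (zs ! i) # drop (Suc (Suc i)) zs)))"
proof -
  have fin: "finite {a. tens s V (P @ koszul s V a w # hpart V a u # R) \<noteq> 0}"
    if "set P \<subseteq> G" "set R \<subseteq> G" "u \<in> G" "w \<in> G" for P R u w
    by (rule finite_subset[OF _ finite_hpart[OF \<open>u \<in> G\<close>]])
      (use that tens_eq_zero[of "P @ [koszul s V _ w]" R] koszul_G in auto)
  have lin1: "lin_on s fscale G (\<lambda>v. Sum_any (\<lambda>a. tens s V (P @ koszul s V a w # hpart V a v # R)))"
    if P: "set P \<subseteq> G" and R: "set R \<subseteq> G" and w: "w \<in> G" for P R w
  proof (rule lin_onI)
    have l: "lin_on s fscale G (\<lambda>v. tens s V (P @ koszul s V a w # v # R))" for a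
      using lin_tens[of "P @ [koszul s V a w]" s V R] that koszul_G by simp
    fix u v assume uv: "u \<in> G" "v \<in> G"
    then show "Sum_any (\<lambda>a. tens s V (P @ koszul s V a w # hpart V a (u + v) # R)) =
       Sum_any (\<lambda>a. tens s V (P @ koszul s V a w # hpart V a u # R)) +
       Sum_any (\<lambda>a. tens s V (P @ koszul s V a w # hpart V a v # R))"
      using Sum_any.distrib[OF fin[OF P R uv(1) w] fin[OF P R uv(2) w]]
      by (simp add: hpart_add lin_on_add[OF l] V_G[OF hpart_V])
  next
    have l: "lin_on s fscale G (\<lambda>v. tens s V (P @ koszul s V a w # v # R))" for a
      using lin_tens[of "P @ [koszul s V a w]" s V R] that koszul_G by simp
    fix c u assume u: "u \<in> G"
    then show "Sum_any (\<lambda>a. tens s V (P @ koszul s V a w # hpart V a (s c u) # R)) =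
       fscale c (Sum_any (\<lambda>a. tens s V (P @ koszul s V a w # hpart V a u # R)))"
      using T.Sum_any_scale[OF fin[OF P R u w], of c]
      by (simp add: hpart_scale lin_on_scale[OF l] V_G[OF hpart_V])
  qed
  have lin2: "lin_on s fscale G (\<lambda>v. Sum_any (\<lambda>a. tens s V (P v @ koszul s V a (w v) # hpart V a u # R v)))"
    if P: "\<And>v. v \<in> G \<Longrightarrow> set (P v) \<subseteq> G" "\<And>v. v \<in> G \<Longrightarrow> set (R v) \<subseteq> G" "u \<in> G" "\<And>v. v \<in> G \<Longrightarrow> w v \<in> G"
      and l: "\<And>a. lin_on s fscale G (\<lambda>v. tens s V (P v @ koszul s V a (w v) # hpart V a u # R v))"
    for P R u w
  proof -
    have eq: "Sum_any (\<lambda>a. tens s V (P v @ koszul s V a (w v) # hpart V a u # R v)) =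
       (\<Sum>a | hpart V a u \<noteq> 0. tens s V (P v @ koszul s V a (w v) # hpart V a u # R v))" if v: "v \<in> G" for v
      by (rule Sum_any.expand_superset[OF finite_hpart[OF \<open>u \<in> G\<close>]])
        (use P(1,2,4)[OF v] tens_eq_zero[of "P v @ [koszul s V _ (w v)]" "R v"] koszul_G in auto)
    have "lin_on s fscale G
       (\<lambda>v. \<Sum>a | hpart V a u \<noteq> 0. tens s V (P v @ koszul s V a (w v) # hpart V a u # R v))"
      by (rule lin_on_setsum[OF vector_space_fscale l])
    then show ?thesis unfolding lin_on_def by (simp add: eq G_add G_scale)
  qed
  \<comment> \<open>The twisted pair lies after \<open>v\<close>, begins with \<open>v\<close>, ends
    with \<open>v\<close>, or lies before \<open>v\<close>.\<close>
  consider j where "i = Suc (length xs + j)" | "i = length xs" | "Suc i = length xs" | "Suc i < length xs"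
  proof (cases i "length xs" rule: linorder_cases)
    case greater
    then obtain j where "i = Suc (length xs + j)" by (auto dest: less_imp_Suc_add)
    then show thesis by (rule that(1))
  next
    case less
    then show thesis using that(3,4) by (cases "Suc i = length xs") auto
  qed (rule that(2))
  then show ?thesis
  proof cases
    case 1
    then have "j < length ys" "Suc j < length ys" using i by auto
    then have G: "ys ! j \<in> G" "ys ! Suc j \<in> G" using ys nth_mem by blast+
    have "lin_on s fscale G (\<lambda>v. Sum_any (\<lambda>a. tens s V ((xs @ v # take j ys) @ koszul s V a (ys ! Suc j) #
        hpart V a (ys ! j) # drop (Suc (Suc j)) ys)))"
    proof (rule lin2[where P = "\<lambda>v. xs @ v # take j ys" and w = "\<lambda>v. ys ! Suc j" and R = "\<lambda>v. drop (Suc (Suc j)) ys"])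
      fix a
      show "lin_on s fscale G (\<lambda>v. tens s V ((xs @ v # take j ys) @ koszul s V a (ys ! Suc j) #
          hpart V a (ys ! j) # drop (Suc (Suc j)) ys))"
        using lin_tens[of xs s V "take j ys @ koszul s V a (ys ! Suc j) # hpart V a (ys ! j) # drop (Suc (Suc j)) ys"]
          xs set_take_G[OF ys] set_drop_G[OF ys] koszul_G[OF G(2)] V_G[OF hpart_V[OF G(1)]] by simp
    qed (use xs G set_take_G[OF ys] set_drop_G[OF ys] in auto)
    then show ?thesis using 1 by (simp add: Let_def nth_append numeral_3_eq_3)
  next
    case 2
    then obtain w ys' where ys': "ys = w # ys'" using i by (cases ys) auto
    then have "set ys' \<subseteq> G" "w \<in> G" using ys by auto
    from lin1[OF xs this] show ?thesis using 2 ys' by (simp add: Let_def nth_append)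
  next
    case 3
    then obtain xs' u where xs': "xs = xs' @ [u]" by (cases xs rule: rev_cases) auto
    then have G: "set xs' \<subseteq> G" "u \<in> G" using xs by auto
    have "lin_on s fscale G (\<lambda>v. Sum_any (\<lambda>a. tens s V (xs' @ koszul s V a v # hpart V a u # ys)))"
    proof (rule lin2[where P = "\<lambda>v. xs'" and w = "\<lambda>v. v" and R = "\<lambda>v. ys"])
      fix a
      have "set (hpart V a u # ys) \<subseteq> G" using ys G V_G[OF hpart_V] by simp
      from lin_on_comp[OF lin_koszul lin_tens[OF G(1) this]]
      show "lin_on s fscale G (\<lambda>v. tens s V (xs' @ koszul s V a v # hpart V a u # ys))"
        using koszul_G by blast
    qed (use ys G in auto)
    then show ?thesis using 3 xs' by (simp add: Let_def nth_append)
  next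
    case 4
    then have G: "xs ! i \<in> G" "xs ! Suc i \<in> G" using xs nth_mem[of i xs] nth_mem[of "Suc i" xs] by auto
    have "lin_on s fscale G (\<lambda>v. Sum_any (\<lambda>a. tens s V (take i xs @ koszul s V a (xs ! Suc i) #
        hpart V a (xs ! i) # drop (Suc (Suc i)) xs @ v # ys)))"
    proof (rule lin2[where P = "\<lambda>v. take i xs" and w = "\<lambda>v. xs ! Suc i" and R = "\<lambda>v. drop (Suc (Suc i)) xs @ v # ys"])
      fix a
      show "lin_on s fscale G (\<lambda>v. tens s V (take i xs @ koszul s V a (xs ! Suc i) #
          hpart V a (xs ! i) # drop (Suc (Suc i)) xs @ v # ys))"
        using lin_tens[of "take i xs @ koszul s V a (xs ! Suc i) # hpart V a (xs ! i) # drop (Suc (Suc i)) xs" s V ys]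
          ys set_take_G[OF xs] set_drop_G[OF xs] koszul_G[OF G(2)] V_G[OF hpart_V[OF G(1)]] by simp
    qed (use ys G set_take_G[OF xs] set_drop_G[OF xs] in auto)
    then show ?thesis using 4 by (simp add: Let_def nth_append)
  qed
qed

lemma twist_tens: "twist s V i (tens s V xs) = (if Suc i < length xs
     then Sum_any (\<lambda>a. tens s V
       (take i xs @ koszul s V a (xs ! Suc i) # hpart V a (xs ! i) # drop (Suc (Suc i)) xs))
     else tens s V xs)"
  unfolding twist_def
  by (subst tlift_eq, rule multilin_length)
    (rule lin_swap[unfolded Let_def], assumption+, rule lin_tens, assumption+, rule refl)

lemma twist_short: "length xs \<le> Suc i \<Longrightarrow> twist s V i (tens s V xs) = tens s V xs"
  by (simp add: twist_tens)

lemma twist_hom: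
  assumes "hlist V xs as" "u \<in> V a" "w \<in> V b" "hlist V ys bs" "length xs = i"
  shows "twist s V i (tens s V (xs @ u # w # ys)) = fscale (sg (a * b)) (tens s V (xs @ w # u # ys))"
proof -
  have G: "set xs \<subseteq> G" "set ys \<subseteq> G" "u \<in> G" "w \<in> G" using assms hlist_G V_G by auto
  \<comment> \<open>For homogeneous \<open>u\<close> only the summand of its own degree
    survives.\<close>
  have "Sum_any (\<lambda>c. tens s V (xs @ koszul s V c w # hpart V c u # ys)) =
      Sum_any (\<lambda>c. if c = a then tens s V (xs @ koszul s V c w # u # ys) else 0)"
    using assms(2) tens_eq_zero[of "xs @ [koszul s V _ w]" ys] G koszul_G
    by (intro arg_cong[of _ _ Sum_any] ext) (simp add: hpart_hom)
  also have "\<dots> = tens s V (xs @ koszul s V a w # u # ys)" by simp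
  also have "\<dots> = tens s V (xs @ s (sg (a * b)) w # u # ys)"
    using assms(3) by (simp add: koszul_hom sg_def)
  also have "\<dots> = fscale (sg (a * b)) (tens s V (xs @ w # u # ys))"
    using lin_on_scale[OF lin_tens[of xs s V "u # ys"]] G by simp
  finally show ?thesis using assms by (simp add: twist_tens nth_append)
qed

lemma hlist_split:
  assumes "hlist V xs ds" "Suc i < length xs"
  obtains ys as u a w b zs bs where "xs = ys @ u # w # zs" "ds = as @ a # b # bs" "hlist V ys as"
    "u \<in> V a" "w \<in> V b" "hlist V zs bs" "length ys = i" "length as = i"
proof -
  have 1: "xs = take i xs @ xs ! i # xs ! Suc i # drop (Suc (Suc i)) xs"
    using assms(2) by (metis Cons_nth_drop_Suc Suc_lessD append_take_drop_id)
  have l: "length ds = length xs" using hlist_length[OF assms(1)] .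
  then have 2: "ds = take i ds @ ds ! i # ds ! Suc i # drop (Suc (Suc i)) ds"
    using assms(2) by (metis Cons_nth_drop_Suc Suc_lessD append_take_drop_id)
  have 3: "xs ! i \<in> V (ds ! i)" "xs ! Suc i \<in> V (ds ! Suc i)"
    using assms by (auto simp: hlist_def list_all2_conv_all_nth)
  show thesis
    by (rule that[OF 1 2 hlist_take[OF assms(1)] 3 hlist_drop[OF assms(1)]]) (use assms l in auto)
qed

lemma twist_tpow: "z \<in> tpow s V n m \<Longrightarrow> twist s V i z \<in> tpow s V n m"
proof -
  assume z: "z \<in> tpow s V n m"
  have K: "fs.subspace (tpow s V n m)" by (simp add: tpow_eq)
  show ?thesis
  proof (rule lin_subset_span[OF flin_twist _ K z[unfolded tpow_eq]])
    fix x assume "x \<in> {tens s V xs |xs. length xs = n \<and> (\<exists>ds. hlist V xs ds \<and> sum_list ds = m)}"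
    then obtain xs ds where x: "x = tens s V xs" "length xs = n" "hlist V xs ds" "sum_list ds = m" by blast
    show "twist s V i x \<in> tpow s V n m"
    proof (cases "Suc i < length xs")
      case True
      obtain ys as u a w b zs bs where *: "xs = ys @ u # w # zs" "ds = as @ a # b # bs" "hlist V ys as"
        "u \<in> V a" "w \<in> V b" "hlist V zs bs" "length ys = i" "length as = i"
        using hlist_split[OF x(3) True] by metis
      have "hlist V (ys @ w # u # zs) (as @ b # a # bs)" using * by (intro hlist_append) auto
      from tpow_tens[OF this, of s] have "tens s V (ys @ w # u # zs) \<in> tpow s V n m"
        using * x by (simp add: algebra_simps)
      then show ?thesis using * x twist_hom[OF *(3-7)] by (simp add: fs.subspace_scale[OF K])
    next
      case False
      then show ?thesis using x tpow_tens by (auto simp: twist_short)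
    qed
  qed
qed

lemma graded_map_twist: "graded_map fscale 0 (Tbar s V) (Tbar s V) (twist s V i)"
  unfolding graded_map_def
proof (intro conjI allI image_subsetI)
  fix n z assume "z \<in> Tbar s V n"
  then show "twist s V i z \<in> Tbar s V (n + 0)"
  proof (rule graded_map_TbarI[OF flin_on[OF flin_twist], where B = "Tbar s V", rotated 2])
    fix xs ds assume "hlist V xs ds" "xs \<noteq> []"
    then show "twist s V i (tens s V xs) \<in> Tbar s V (sum_list ds + 0)"
      using twist_tpow[OF tpow_tens] Tbar_tpow[of "length xs" s V] by (fastforce simp: Suc_le_eq)
  qed (rule T.subspace_V)
qed (rule flin_on[OF flin_twist])

lemma lenp_tpow: "n \<ge> 1 \<Longrightarrow> z \<in> Tbar s V m \<Longrightarrow> lenp s V n z \<in> tpow s V n m"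
proof -
  assume n: "n \<ge> 1" and z: "z \<in> Tbar s V m"
  have K: "fs.subspace (tpow s V n m)" for m by (simp add: tpow_eq)
  from z have "lenp s V n z \<in> tpow s V n (m + 0)"
  proof (rule graded_map_TbarI[OF flin_on[OF flin_lenp], where B = "tpow s V n", rotated 2])
    fix xs ds assume "hlist V xs ds" "xs \<noteq> []"
    then show "lenp s V n (tens s V xs) \<in> tpow s V n (sum_list ds + 0)"
      using tpow_tens[of V xs ds s] by (auto simp: lenp_tens fs.subspace_0[OF K])
  qed (rule K)
  then show ?thesis by simp
qed

lemma lenp_Tens: "z \<in> Tens s V \<Longrightarrow> lenp s V n z \<in> Tens s V"
proof -
  assume z: "z \<in> Tens s V"
  show ?thesis
    by (rule lin_subset_span[OF flin_lenp _ subspace_Tens z[unfolded Tens_def]])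
      (auto simp: lenp_tens Tens_0 intro: tens_Tens)
qed

lemma lenp_sum: "z \<in> Tle s V N \<Longrightarrow> z = (\<Sum>n\<in>{1..N}. lenp s V n z)"
proof -
  assume "z \<in> Tle s V N"
  have flin: "flin (\<lambda>z. \<Sum>n\<in>{1..N}. lenp s V n z)"
    by (rule lin_on_setsum[OF vector_space_fscale flin_lenp])
  have "Tle s V N \<subseteq> {z. z = (\<Sum>n\<in>{1..N}. lenp s V n z)}"
    unfolding Tle_def gtot_tpow
    by (intro fs.span_minimal UN_least subspace_eqs[OF flin_id flin])
      (auto simp: lenp_tens if_distrib cong: if_cong)
  with \<open>z \<in> Tle s V N\<close> show ?thesis by blast
qed

lemma twist_lenp: "z \<in> Tens s V \<Longrightarrow> twist s V i (lenp s V n z) = lenp s V n (twist s V i z)"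
proof (induction rule: Tens_induct)
  case (tens xs ds)
  show ?case
  proof (cases "Suc i < length xs")
    case True
    obtain ys as u a w b zs bs where *: "xs = ys @ u # w # zs" "ds = as @ a # b # bs" "hlist V ys as"
      "u \<in> V a" "w \<in> V b" "hlist V zs bs" "length ys = i" "length as = i"
      using hlist_split[OF tens True] by metis
    then show ?thesis
      using twist_hom[OF *(3-7)]
      by (simp add: lenp_tens flin_zero[OF flin_twist] flin_scale[OF flin_lenp])
  qed (simp add: twist_short lenp_tens flin_zero[OF flin_twist])
qed (rule flin_comp[OF flin_lenp flin_twist] flin_comp[OF flin_twist flin_lenp])+

lemma tinv_sym_action: "tinv s V z \<Longrightarrow> f \<in> sym_action s V n \<Longrightarrow> f z = z"
proof -
  assume z: "tinv s V z" and "f \<in> sym_action s V n"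
  from this(2) show "f z = z" by induction (use z in \<open>simp_all add: tinv_def\<close>)
qed

lemma sym_action_tinv:
  assumes z: "z \<in> tpow s V n m" and f: "\<forall>f\<in>sym_action s V n. f z = z"
  shows "tinv s V z"
  unfolding tinv_def
proof
  fix i
  show "twist s V i z = z"
  proof (cases "Suc i < n")
    case True
    from sym_action.twist[OF sym_action.id True, of s V] f show ?thesis by fastforce
  next
    case False
    have "tpow s V n m \<subseteq> {z. twist s V i z = z}"
      unfolding tpow_eq by (intro fs.span_minimal subspace_eqs[OF flin_twist flin_id])
        (use False in \<open>auto simp: twist_short\<close>)
    then show ?thesis using z by blast
  qed
qed

lemma subspace_Sbar: "fs.subspace (Sbar s V m)"
  by (simp add: Sbar_def)

text \<open>Twists preserve tensor length and so commute with the projections \<open>lenp\<close>: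
  the components of an invariant tensor are invariant in each tensor power, where the symmetric
  group action is generated by the twists.\<close>

lemma Sbar_iff: "z \<in> Sbar s V m \<longleftrightarrow> z \<in> Tbar s V m \<and> tinv s V z"
proof
  assume "z \<in> Sbar s V m"
  moreover have "Sbar s V m \<subseteq> Tbar s V m \<inter> {z. tinv s V z}"
    unfolding Sbar_def
  proof (rule fs.span_minimal)
    show "(\<Union>n\<in>{1..}. {z \<in> tpow s V n m. \<forall>f\<in>sym_action s V n. f z = z}) \<subseteq> Tbar s V m \<inter> {z. tinv s V z}"
      using sym_action_tinv subsetD[OF Tbar_tpow[of _ s V m]] by auto
  qed (intro fs.subspace_inter T.subspace_V subspace_tinv)
  ultimately show "z \<in> Tbar s V m \<and> tinv s V z" by blast
next
  assume z: "z \<in> Tbar s V m \<and> tinv s V z"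
  then have zT: "z \<in> T.G" using T.V_G by blast
  obtain N where N: "z \<in> Tle s V N" using Tbar_Tle[OF zT] by blast
  have "lenp s V n z \<in> Sbar s V m" if "n \<in> {1..N}" for n
  proof -
    have "tinv s V (lenp s V n z)"
      unfolding tinv_def
      using z twist_lenp[OF subsetD[OF gtot_Tbar_Tens zT], of _ n] by (simp add: tinv_def)
    moreover have "lenp s V n z \<in> tpow s V n m" using that z by (intro lenp_tpow) auto
    ultimately have "lenp s V n z \<in> {z \<in> tpow s V n m. \<forall>f\<in>sym_action s V n. f z = z}"
      by (simp add: tinv_sym_action)
    then have "lenp s V n z \<in> (\<Union>n\<in>{1..}. {z \<in> tpow s V n m. \<forall>f\<in>sym_action s V n. f z = z})"
      using that by (intro UN_I[of n]) simp_all
    then show ?thesis unfolding Sbar_def by (rule fs.span_base)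
  qed
  then have "(\<Sum>n\<in>{1..N}. lenp s V n z) \<in> Sbar s V m"
    by (rule fs.subspace_sum[OF subspace_Sbar])
  then show "z \<in> Sbar s V m" unfolding lenp_sum[OF N, symmetric] .
qed

text \<open>The analogous argument for degrees: twists have degree 0 and therefore commute with
  taking homogeneous components.\<close>

lemma S_iff: "z \<in> gtot fscale (Sbar s V) \<longleftrightarrow> z \<in> T.G \<and> tinv s V z"
proof
  assume "z \<in> gtot fscale (Sbar s V)"
  moreover have "gtot fscale (Sbar s V) \<subseteq> T.G \<inter> {z. tinv s V z}"
    unfolding gtot_def[of fscale "Sbar s V"]
    by (intro fs.span_minimal fs.subspace_inter T.subspace_G subspace_tinv)
      (use Sbar_iff T.V_G in auto)
  ultimately show "z \<in> T.G \<and> tinv s V z" by blast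
next
  assume z: "z \<in> T.G \<and> tinv s V z"
  have "hpart (Tbar s V) n z \<in> Sbar s V n" for n
  proof -
    have "twist s V i (hpart (Tbar s V) n z) = hpart (Tbar s V) n z" for i
      using z T.hpart_graded_map[OF graded_map_twist T.graded_space, of z n i] by (simp add: tinv_def)
    then show ?thesis using z T.hpart_V by (simp add: Sbar_iff tinv_def)
  qed
  then have "hpart (Tbar s V) n z \<in> gtot fscale (Sbar s V)" for n
    unfolding gtot_def by (blast intro: fs.span_base)
  then have "Sum_any (\<lambda>n. hpart (Tbar s V) n z) \<in> gtot fscale (Sbar s V)"
    unfolding Sum_any.expand_set by (intro fs.subspace_sum[OF subspace_gtot])
  then show "z \<in> gtot fscale (Sbar s V)" using z T.sum_hpart by simp
qed

end

text \<open>Invariance of \<open>Z\<close> under the graded swap \<open>x \<otimes> y \<mapsto> (-1)^(deg x * deg y) y \<otimes> x\<close>.\<close>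

definition sym2 :: "(int \<Rightarrow> ('a \<Rightarrow> 'k::field) set) \<Rightarrow> ('k, 'a \<Rightarrow> 'k) tensor2 \<Rightarrow> bool" where
  "sym2 A Z \<longleftrightarrow> (\<forall>\<beta> \<beta>'. bilinear_form fscale A \<beta> \<longrightarrow> bilinear_form fscale A \<beta>' \<longrightarrow>
     (\<forall>a b. \<forall>x\<in>A a. \<forall>y\<in>A b. \<beta>' x y = sg (a * b) * \<beta> y x) \<longrightarrow> Z \<beta> = Z \<beta>')"

lemma subspace_sym2: "fs.subspace {Z. sym2 A Z}"
  by (rule fs.subspaceI) (auto simp: sym2_def apply_simps)

text \<open>The map \<open>id \<otimes> \<theta>\<close> for a functional \<open>\<theta>\<close>:
  it contracts the second tensor factor.\<close>

definition slice :: "(('a \<Rightarrow> 'k::field) \<Rightarrow> 'k) \<Rightarrow> ('k, 'a \<Rightarrow> 'k) tensor2 \<Rightarrow> 'a \<Rightarrow> 'k" where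
  "slice \<theta> = tlift2 (\<lambda>x y. fscale (\<theta> y) x)"

text \<open>The plain flip of the factors, without Koszul sign. It only carries statements about
  first factors over to second factors; graded symmetry is expressed by \<open>sym2\<close>.\<close>

definition swap2 :: "('k, 'a \<Rightarrow> 'k) tensor2 \<Rightarrow> ('k::field, 'a \<Rightarrow> 'k) tensor2" where
  "swap2 Z = (\<lambda>\<beta>. Z (\<lambda>x y. \<beta> y x))"

lemma flin_slice: "flin (slice \<theta>)"
  by (simp add: slice_def flin_tlift2)

lemma flin_swap2: "flin swap2"
  by (simp add: lin_on_def swap2_def fun_eq_iff apply_simps)

lemma swap2_swap2 [simp]: "swap2 (swap2 Z) = Z"
  by (simp add: swap2_def)

lemma swap2_tens2: "swap2 (tens2 fscale A x y) = tens2 fscale A y x"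
  by (auto simp: swap2_def tens2_def bilinear_form_def)

lemma slice_tens2:
  assumes "lin_on fscale (*) (gtot fscale A) \<theta>"
  shows "slice \<theta> (tens2 fscale A x y) = fscale (\<theta> y) x"
  unfolding slice_def
  by (rule tlift2_eq)
    (use assms in \<open>auto simp: bilin_def lin_on_def apply_simps fun_eq_iff algebra_simps\<close>)

text \<open>Locates a coproduct inside the ambient tensor square by the sets its two factors may be
  taken from. These sets need not be subspaces, so that images and unions can be inserted
  directly.\<close>

definition T2_in :: "(int \<Rightarrow> ('a \<Rightarrow> 'k::field) set) \<Rightarrow> ('a \<Rightarrow> 'k) set \<Rightarrow> ('a \<Rightarrow> 'k) set \<Rightarrow> ('k, 'a \<Rightarrow> 'k) tensor2 set"
  where "T2_in A X Y = fs.span {tens2 fscale A x y |x y. x \<in> X \<and> y \<in> Y}"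

lemma T2_in_base: "x \<in> X \<Longrightarrow> y \<in> Y \<Longrightarrow> tens2 fscale A x y \<in> T2_in A X Y"
  unfolding T2_in_def by (rule fs.span_base) blast

lemma T2_in_mono: "X \<subseteq> X' \<Longrightarrow> Y \<subseteq> Y' \<Longrightarrow> T2_in A X Y \<subseteq> T2_in A X' Y'"
  unfolding T2_in_def by (rule fs.span_mono) blast

lemma subspace_T2_in: "fs.subspace (T2_in A X Y)"
  by (simp add: T2_in_def)

lemma T2_eq: "T2 A = T2_in A (gtot fscale A) (gtot fscale A)"
  by (simp add: T2_def T2_in_def)

lemma T2_in_map:
  assumes f: "flin f" and K: "fs.subspace K" and Z: "Z \<in> T2_in A X Y"
    and fK: "\<And>x y. x \<in> X \<Longrightarrow> y \<in> Y \<Longrightarrow> f (tens2 fscale A x y) \<in> K"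
  shows "f Z \<in> K"
  by (rule lin_subset_span[OF f _ K Z[unfolded T2_in_def]]) (use fK in blast)

text \<open>Expand the second factor in a basis: the coefficients are slices of \<open>Z\<close>.\<close>

lemma T2_slices:
  assumes Z: "Z \<in> T2 A"
    and K: "\<And>\<theta>. lin_on fscale (*) (gtot fscale A) \<theta> \<Longrightarrow> slice \<theta> Z \<in> K"
  shows "Z \<in> T2_in A K (gtot fscale A)"
proof -
  obtain B where B: "B \<subseteq> gtot fscale A" "fs.independent B" "gtot fscale A \<subseteq> fs.span B"
    by (rule fs.maximal_independent_subset)
  have span: "fs.span B = gtot fscale A"
    using B fs.span_minimal[OF B(1) subspace_gtot] by blast
  let ?\<theta> = "\<lambda>b y. fs.representation B y b"
  have lin: "lin_on fscale (*) (gtot fscale A) (?\<theta> b)" for b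
    using B(2) by (simp add: lin_on_def span[symmetric] fs.representation_add fs.representation_scale)
  \<comment> \<open>The vanishing of the slices outside \<open>F\<close> belongs to the induction
    statement so that \<open>F\<close> can be enlarged when a further tensor is added.\<close>
  have "\<exists>F. finite F \<and> F \<subseteq> B \<and> Z = (\<Sum>b\<in>F. tens2 fscale A (slice (?\<theta> b) Z) b) \<and>
      (\<forall>b. slice (?\<theta> b) Z \<in> gtot fscale A) \<and> (\<forall>b. b \<notin> F \<longrightarrow> slice (?\<theta> b) Z = 0)"
    using Z[unfolded T2_def]
  proof (induction rule: fs.span_induct_alt)
    case base
    show ?case by (intro exI[of _ "{}"]) (simp add: flin_zero[OF flin_slice] gtot_closed)
  next
    case (step c Y Z)
    then obtain x y where Y: "Y = tens2 fscale A x y" and x: "x \<in> gtot fscale A" and y: "y \<in> gtot fscale A"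
      by blast
    from step.IH obtain F where F: "finite F" "F \<subseteq> B" "Z = (\<Sum>b\<in>F. tens2 fscale A (slice (?\<theta> b) Z) b)"
      "\<And>b. slice (?\<theta> b) Z \<in> gtot fscale A" "\<And>b. b \<notin> F \<Longrightarrow> slice (?\<theta> b) Z = 0" by blast
    let ?H = "{b. ?\<theta> b y \<noteq> 0}"
    have H: "finite ?H" "?H \<subseteq> B" using fs.finite_representation fs.representation_ne_zero by blast+
    let ?U = "F \<union> ?H"
    have sl: "slice (?\<theta> b) (fscale c Y + Z) = fscale (c * ?\<theta> b y) x + slice (?\<theta> b) Z" for b
      by (simp add: flin_add[OF flin_slice] flin_scale[OF flin_slice] Y slice_tens2[OF lin])
    have BA: "b \<in> gtot fscale A" if "b \<in> ?U" for b using that F(2) H(2) B(1) by blast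
    have tsc: "tens2 fscale A x (\<Sum>b\<in>I. fscale (f b) b) = (\<Sum>b\<in>I. fscale (f b) (tens2 fscale A x b))"
      if "finite I" "I \<subseteq> gtot fscale A" for I f
      using that
    proof (induction I rule: finite_induct)
      case (insert b I)
      then show ?case
        using x by (simp add: tens2_add_right tens2_scale_right gtot_closed fs.subspace_sum[OF subspace_gtot] subset_iff)
    qed (simp add: x tens2_zero_right)
    have "y = (\<Sum>b\<in>?H. fscale (?\<theta> b y) b)"
      using fs.sum_nonzero_representation_eq[OF B(2), of y] y span by simp
    also have "\<dots> = (\<Sum>b\<in>?U. fscale (?\<theta> b y) b)"
      by (rule sum.mono_neutral_left) (use F(1) H(1) in auto)
    finally have "Y = (\<Sum>b\<in>?U. fscale (?\<theta> b y) (tens2 fscale A x b))"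
      using tsc[of ?U "\<lambda>b. ?\<theta> b y"] F(1) H(1) BA by (simp add: Y subset_iff)
    moreover have "Z = (\<Sum>b\<in>?U. tens2 fscale A (slice (?\<theta> b) Z) b)"
      by (subst F(3), rule sum.mono_neutral_left) (use F H BA in \<open>auto simp: tens2_zero_left\<close>)
    ultimately have "fscale c Y + Z = (\<Sum>b\<in>?U. fscale c (fscale (?\<theta> b y) (tens2 fscale A x b)) +
        tens2 fscale A (slice (?\<theta> b) Z) b)"
      by (simp only: sum.distrib fs.scale_sum_right)
    also have "\<dots> = (\<Sum>b\<in>?U. tens2 fscale A (slice (?\<theta> b) (fscale c Y + Z)) b)"
      by (rule sum.cong[OF refl], unfold sl)
        (simp add: tens2_add_left tens2_scale_left gtot_closed x F(4) BA)
    finally have "fscale c Y + Z = (\<Sum>b\<in>?U. tens2 fscale A (slice (?\<theta> b) (fscale c Y + Z)) b)" .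
    moreover have "slice (?\<theta> b) (fscale c Y + Z) \<in> gtot fscale A" for b
      unfolding sl by (simp add: gtot_closed x F(4))
    moreover have "slice (?\<theta> b) (fscale c Y + Z) = 0" if "b \<notin> ?U" for b
      using that F(5) by (simp add: sl)
    ultimately show ?case using F(1,2) H by (intro exI[of _ ?U]) blast
  qed
  then obtain F where F: "finite F" "F \<subseteq> B" "Z = (\<Sum>b\<in>F. tens2 fscale A (slice (?\<theta> b) Z) b)" by blast
  have "(\<Sum>b\<in>F. tens2 fscale A (slice (?\<theta> b) Z) b) \<in> T2_in A K (gtot fscale A)"
    using F(2) B(1) K[OF lin] by (intro fs.subspace_sum[OF subspace_T2_in] T2_in_base) auto
  then show ?thesis using F(3) by simp
qed

lemma T2_slices':
  assumes Z: "Z \<in> T2 A"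
    and K: "\<And>\<theta>. lin_on fscale (*) (gtot fscale A) \<theta> \<Longrightarrow> slice \<theta> (swap2 Z) \<in> K"
  shows "Z \<in> T2_in A (gtot fscale A) K"
proof -
  have "swap2 Z \<in> T2 A"
    by (rule T2_in_map[OF flin_swap2 subspace_T2 Z[unfolded T2_eq]]) (simp add: swap2_tens2 T2_tens2)
  then have "swap2 Z \<in> T2_in A K (gtot fscale A)" by (rule T2_slices[OF _ K])
  then have "swap2 (swap2 Z) \<in> T2_in A (gtot fscale A) K"
    by (rule T2_in_map[OF flin_swap2 subspace_T2_in]) (simp add: swap2_tens2 T2_in_base)
  then show ?thesis by simp
qed

section \<open>Concatenation, and recovery of a tensor from its coproduct\<close>

context tensor_powers
begin

lemma multilin_append: "set xs \<subseteq> G \<Longrightarrow> multilin s V (\<lambda>ys. tens s V (xs @ ys))"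
proof (rule multilinI)
  fix ys zs assume "set xs \<subseteq> G" "set ys \<subseteq> G" "set zs \<subseteq> G"
  then show "lin_on s fscale G (\<lambda>v. tens s V (xs @ ys @ v # zs))"
    using lin_tens[of "xs @ ys" s V zs] by simp
qed

lemma tlift_append: "set xs \<subseteq> G \<Longrightarrow> tlift (\<lambda>ys. tens s V (xs @ ys)) (tens s V ys) = tens s V (xs @ ys)"
  by (rule tlift_eq[OF multilin_append])

lemma tprod_tens:
  assumes xs: "set xs \<subseteq> G" and y: "y \<in> Tens s V"
  shows "tprod s V (tens s V xs) y = tlift (\<lambda>ys. tens s V (xs @ ys)) y"
  unfolding tprod_def
proof (rule tlift_eq, rule multilinI)
  fix ps qs assume P: "set ps \<subseteq> G" "set qs \<subseteq> G"
  let ?f = "\<lambda>v. tlift (\<lambda>ys. tens s V ((ps @ v # qs) @ ys))"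
  from y show "lin_on s fscale G (\<lambda>v. ?f v y)"
    unfolding Tens_def
  proof (induction rule: fs.span_induct_alt)
    case base
    show ?case unfolding flin_zero[OF flin_tlift] by (rule lin_on_const_zero[OF vector_space_fscale])
  next
    case (step c x y)
    then obtain ys ds where x: "x = tens s V ys" "hlist V ys ds" by blast
    then have "lin_on s fscale G (\<lambda>v. tens s V (ps @ v # qs @ ys))"
      using P hlist_G by (intro lin_tens) auto
    then have "lin_on s fscale G (\<lambda>v. ?f v x)"
      using P tlift_append[of "ps @ _ # qs" ys] unfolding lin_on_def by (simp add: x G_add G_scale)
    then show ?case
      unfolding flin_add[OF flin_tlift] flin_scale[OF flin_tlift]
      by (intro lin_on_plus[OF vector_space_fscale _ step.IH])
        (simp add: lin_on_def fs.scale_right_distrib mult.commute)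
  qed
qed

lemma tprod_tens_tens: "set xs \<subseteq> G \<Longrightarrow> hlist V ys ds \<Longrightarrow>
    tprod s V (tens s V xs) (tens s V ys) = tens s V (xs @ ys)"
  by (simp add: tprod_tens tens_Tens tlift_append)

lemma lin_tprod: "x \<in> Tens s V \<Longrightarrow> lin_on fscale fscale (Tens s V) (tprod s V x)"
  unfolding Tens_def[of s V]
proof (induction rule: fs.span_induct_alt)
  case base
  show ?case unfolding flin_zero[OF flin_tprod] by (rule lin_on_const_zero[OF vector_space_fscale])
next
  case (step c x y)
  then obtain xs ds where x: "x = tens s V xs" "hlist V xs ds" by blast
  have "lin_on fscale fscale (Tens s V) (tprod s V x)"
    using flin_add[OF flin_tlift, of "\<lambda>ys. tens s V (xs @ ys)"]
      flin_scale[OF flin_tlift, of "\<lambda>ys. tens s V (xs @ ys)"] hlist_G[OF x(2)]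
    unfolding lin_on_def x(1)
    by (simp add: tprod_tens Tens_add fs.subspace_scale[OF subspace_Tens])
  then have "lin_on fscale fscale (Tens s V) (\<lambda>y. fscale c (tprod s V x y))"
    by (simp add: lin_on_def fs.scale_right_distrib mult.commute)
  from lin_on_plus[OF vector_space_fscale this step.IH[folded Tens_def]]
  show ?case unfolding Tens_def[symmetric]
    by (simp add: flin_add[OF flin_tprod] flin_scale[OF flin_tprod])
qed

lemma bilin_tprod:
  assumes f: "flin f" "\<And>x. x \<in> T.G \<Longrightarrow> f x \<in> Tens s V"
    and g: "flin g" "\<And>x. x \<in> T.G \<Longrightarrow> g x \<in> Tens s V" and h: "flin h"
  shows "bilin (Tbar s V) (\<lambda>x y. h (tprod s V (f x) (g y)))"
  unfolding bilin_def
proof (intro ballI conjI)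
  fix x assume x: "x \<in> T.G"
  show "lin_on fscale fscale T.G (\<lambda>y. h (tprod s V (f x) (g y)))"
    by (rule lin_on_comp[OF lin_on_comp[OF flin_on[OF g(1)] lin_tprod[OF f(2)[OF x]] g(2)] h UNIV_I])
  show "lin_on fscale fscale T.G (\<lambda>y. h (tprod s V (f y) (g x)))"
    by (rule flin_on[OF flin_comp[OF flin_comp[OF f(1) flin_tprod] h]])
qed

text \<open>Keeps the part whose left factor has length \<open>n\<close> and concatenates: this
  undoes the cut after \<open>n\<close> factors and discards all other cuts.\<close>

definition glue :: "nat \<Rightarrow> ('k, ('k, 'v) tensor) tensor2 \<Rightarrow> ('k, 'v) tensor" where
  "glue n = tlift2 (\<lambda>x y. tprod s V (lenp s V n x) y)"

lemma T_Tens: "z \<in> T.G \<Longrightarrow> z \<in> Tens s V"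
  using gtot_Tbar_Tens by blast

lemma glue_tens2: "glue n (tens2V x y) = tprod s V (lenp s V n x) y"
  unfolding glue_def
  by (rule tlift2_eq, rule bilin_tprod[where h = "\<lambda>x. x" and g = "\<lambda>x. x"])
    (simp_all add: flin_lenp flin_id lenp_Tens T_Tens)

lemma flin_glue: "flin (glue n)"
  by (simp add: glue_def flin_tlift2)

text \<open>On a pure tensor longer than \<open>n\<close> only the cut after \<open>n\<close>
  factors survives, and concatenation undoes it. The correction sum accounts for lengths at most
  \<open>n\<close>, where that cut does not exist.\<close>

lemma glue_deconcat:
  assumes n: "n \<ge> 1" and z: "z \<in> T.G"
  shows "z = (\<Sum>m\<in>{1..n}. lenp s V m z) + glue n (deconcat s V z)"
  using z
proof (induction rule: Tbar_induct)
  case (tens xs ds)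
  have "glue n (deconcat s V (tens s V xs)) = (\<Sum>i\<in>{1..<length xs}. if i = n then tens s V xs else 0)"
    unfolding deconcat_tens flin_sum[OF flin_glue] glue_tens2
  proof (rule sum.cong[OF refl])
    fix i assume i: "i \<in> {1..<length xs}"
    show "tprod s V (lenp s V n (tens s V (take i xs))) (tens s V (drop i xs)) = (if i = n then tens s V xs else 0)"
      using i set_take_G[OF hlist_G[OF tens(1)]]
      by (simp add: lenp_tens flin_zero[OF flin_tprod] tprod_tens_tens[OF _ hlist_drop[OF tens(1)]])
  qed
  moreover have "(\<Sum>m\<in>{1..n}. lenp s V m (tens s V xs)) = (if length xs \<le> n then tens s V xs else 0)"
    using tens(2) by (simp add: lenp_tens Suc_le_eq)
  ultimately show ?case using n by simp
next
  case lin'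
  show ?case
    by (rule flin_on[OF flin_plus[OF lin_on_setsum[OF vector_space_fscale flin_lenp] flin_comp[OF flin_deconcat flin_glue]]])
qed (rule lin_on_id)

lemma twist_tprod:
  assumes x: "x \<in> Tens s V" and y: "y \<in> Tens s V"
  shows "twist s V (n + i) (tprod s V (lenp s V n x) y) = tprod s V (lenp s V n x) (twist s V i y)"
proof -
  have tw: "twist s V i y \<in> Tens s V" if "y \<in> Tens s V" for i y
    using that unfolding Tens_def
  proof (rule lin_subset_span[OF flin_twist _ fs.subspace_span, rotated])
    fix x assume "x \<in> {tens s V xs |xs ds. hlist V xs ds}"
    then obtain xs ds where x: "x = tens s V xs" "hlist V xs ds" by blast
    have "tpow s V (length xs) (sum_list ds) \<subseteq> Tens s V"
      unfolding tpow_eq Tens_def by (rule fs.span_mono) blast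
    then show "twist s V i x \<in> fs.span {tens s V xs |xs ds. hlist V xs ds}"
      using twist_tpow[OF tpow_tens[OF x(2)], of i] x(1) by (auto simp: Tens_def)
  qed
  have "lin_on fscale fscale (Tens s V) (\<lambda>y. twist s V (n + i) (tprod s V (lenp s V n x) y))"
    by (rule lin_on_comp[OF lin_tprod[OF lenp_Tens[OF x]] flin_twist UNIV_I])
  moreover have "lin_on fscale fscale (Tens s V) (\<lambda>y. tprod s V (lenp s V n x) (twist s V i y))"
    by (rule lin_on_comp[OF flin_on[OF flin_twist] lin_tprod[OF lenp_Tens[OF x]] tw])
  moreover have "twist s V (n + i) (tprod s V (lenp s V n x) (tens s V ys)) =
      tprod s V (lenp s V n x) (twist s V i (tens s V ys))" if ys: "hlist V ys bs" for ys bs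
    using x
  proof (induction rule: Tens_induct)
    case (tens xs ds)
    show ?case
    proof (cases "length xs = n")
      case True
      then have l: "lenp s V n (tens s V xs) = tens s V xs" by (simp add: lenp_tens)
      show ?thesis
      proof (cases "Suc i < length ys")
        case short: True
        obtain ps as u a w b zs cs where *: "ys = ps @ u # w # zs" "bs = as @ a # b # cs" "hlist V ps as"
          "u \<in> V a" "w \<in> V b" "hlist V zs cs" "length ps = i" "length as = i"
          using hlist_split[OF ys short] by metis
        have 1: "hlist V (xs @ ps) (ds @ as)" using tens *(3) by (rule hlist_append)
        have 2: "hlist V (ps @ w # u # zs) (as @ b # a # cs)" using * by (intro hlist_append) auto
        have "twist s V (n + i) (tens s V ((xs @ ps) @ u # w # zs)) =
            fscale (sg (a * b)) (tens s V ((xs @ ps) @ w # u # zs))"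
          by (rule twist_hom[OF 1 *(4-6)]) (use True * in simp)
        then show ?thesis
          using lin_on_scale[OF lin_tprod[OF tens_Tens[OF tens]] tens_Tens[OF 2]] hlist_G[OF tens]
            tprod_tens_tens[OF hlist_G[OF tens] 2] tprod_tens_tens[OF hlist_G[OF tens] ys]
          by (simp add: l twist_hom[OF *(3-7)] *(1))
      next
        case False
        then show ?thesis
          using True tprod_tens_tens[OF hlist_G[OF tens] ys] by (simp add: l twist_short)
      qed
    qed (simp add: lenp_tens flin_zero[OF flin_tprod] flin_zero[OF flin_twist])
  next
    case lin
    show ?case by (rule flin_comp[OF flin_comp[OF flin_lenp flin_tprod] flin_twist])
  next
    case lin'
    show ?case by (rule flin_comp[OF flin_lenp flin_tprod])
  qed
  ultimately show ?thesis
    using flin_eq_on_span[OF _ _ _ y[unfolded Tens_def], of "\<lambda>y. twist s V (n + i) (tprod s V (lenp s V n x) y)"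
      "\<lambda>y. tprod s V (lenp s V n x) (twist s V i y)"] unfolding Tens_def by blast
qed

lemma twist_tprod_left:
  assumes x: "x \<in> Tens s V" and y: "y \<in> Tens s V" and i: "Suc i < n"
  shows "twist s V i (tprod s V (lenp s V n x) y) = tprod s V (twist s V i (lenp s V n x)) y"
  using x
proof (induction rule: Tens_induct)
  case (tens xs ds)
  show ?case
  proof (cases "length xs = n")
    case True
    then have l: "lenp s V n (tens s V xs) = tens s V xs" by (simp add: lenp_tens)
    have short: "Suc i < length xs" using i True by simp
    obtain ps as u a w b zs cs where *: "xs = ps @ u # w # zs" "ds = as @ a # b # cs" "hlist V ps as"
        "u \<in> V a" "w \<in> V b" "hlist V zs cs" "length ps = i" "length as = i"
      using hlist_split[OF tens short] by metis
    have 2: "set (ps @ w # u # zs) \<subseteq> G" using hlist_G[OF tens] *(1) by auto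
    have t: "tprod s V (twist s V i (tens s V xs)) z = fscale (sg (a * b)) (tprod s V (tens s V (ps @ w # u # zs)) z)" for z
      by (simp add: *(1) twist_hom[OF *(3-7)] flin_scale[OF flin_tprod])
    have f: "flin (tlift (\<lambda>ys. tens s V (xs @ ys)))" for xs by (rule flin_tlift)
    show ?thesis unfolding l t tprod_tens[OF hlist_G[OF tens] y] tprod_tens[OF 2 y]
    proof (rule Tens_induct[OF y])
      fix ys bs assume ys: "hlist V ys bs"
      have "twist s V i (tens s V (ps @ u # w # (zs @ ys))) = fscale (sg (a * b)) (tens s V (ps @ w # u # (zs @ ys)))"
        by (rule twist_hom[OF *(3-5) hlist_append[OF *(6) ys] *(7)])
      then show "twist s V i (tlift (\<lambda>ys. tens s V (xs @ ys)) (tens s V ys)) =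
          fscale (sg (a * b)) (tlift (\<lambda>ys. tens s V ((ps @ w # u # zs) @ ys)) (tens s V ys))"
        by (simp only: tlift_append[OF hlist_G[OF tens]] tlift_append[OF 2]) (simp add: *(1))
    next
      show "flin (\<lambda>z. fscale (sg (a * b)) (tlift (\<lambda>ys. tens s V ((ps @ w # u # zs) @ ys)) z))"
        unfolding lin_on_def
        by (simp add: flin_add[OF flin_tlift] flin_scale[OF flin_tlift] fs.scale_right_distrib mult.commute
            del: append_assoc append.simps)
    qed (rule flin_comp[OF f flin_twist])
  qed (simp add: lenp_tens flin_zero[OF flin_tprod] flin_zero[OF flin_twist])
next
  case lin
  show ?case by (rule flin_comp[OF flin_comp[OF flin_lenp flin_tprod] flin_twist])
next
  case lin'
  show ?case by (rule flin_comp[OF flin_comp[OF flin_lenp flin_twist] flin_tprod])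
qed

end

lemma hlist_append_iff: "hlist V (xs @ ys) ds \<longleftrightarrow> (\<exists>as bs. ds = as @ bs \<and> hlist V xs as \<and> hlist V ys bs)"
  unfolding hlist_def list_all2_append1 by (metis list_all2_lengthD)

context tensor_powers
begin

lemma twist_lenp_1: "z \<in> Tens s V \<Longrightarrow> twist s V i (lenp s V 1 z) = lenp s V 1 z"
proof (induction rule: Tens_induct)
  case (tens xs ds)
  show ?case by (simp add: lenp_tens twist_short flin_zero[OF flin_twist])
next
  case lin
  show ?case by (rule flin_comp[OF flin_lenp flin_twist])
qed (rule flin_lenp)

text \<open>For factors of length one, the twist in position 0 of their product is the graded swap;
  all other lengths contribute zero on both sides.\<close>

lemma twist_swap:
  assumes x: "x \<in> Tbar s V a" and y: "y \<in> Tbar s V b"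
  shows "twist s V 0 (tprod s V (lenp s V 1 x) (lenp s V 1 y)) =
    fscale (sg (a * b)) (tprod s V (lenp s V 1 y) (lenp s V 1 x))"
proof -
  have *: "twist s V 0 (tprod s V (lenp s V 1 (tens s V xs)) (lenp s V 1 y)) =
    fscale (sg (a * b)) (tprod s V (lenp s V 1 y) (lenp s V 1 (tens s V xs)))"
    if xs: "hlist V xs as" "sum_list as = a" for xs as
  proof (rule flin_eq_on_span[OF _ _ _ y[unfolded Tbar_span]])
    have L: "lenp s V 1 (tens s V xs) \<in> Tens s V" by (rule lenp_Tens[OF tens_Tens[OF xs(1)]])
    show "lin_on fscale fscale (fs.span {tens s V xs |xs ds. hlist V xs ds \<and> xs \<noteq> [] \<and> sum_list ds = b})
       (\<lambda>y. twist s V 0 (tprod s V (lenp s V 1 (tens s V xs)) (lenp s V 1 y)))"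
      unfolding Tbar_span[symmetric]
      by (rule lin_on_comp[OF lin_on_comp[OF flin_on[OF flin_lenp] lin_tprod[OF L]] flin_twist UNIV_I])
        (intro lenp_Tens T_Tens T.V_G)
    show "lin_on fscale fscale (fs.span {tens s V xs |xs ds. hlist V xs ds \<and> xs \<noteq> [] \<and> sum_list ds = b})
       (\<lambda>y. fscale (sg (a * b)) (tprod s V (lenp s V 1 y) (lenp s V 1 (tens s V xs))))"
      by (simp add: lin_on_def flin_add[OF flin_lenp] flin_scale[OF flin_lenp] flin_add[OF flin_tprod]
          flin_scale[OF flin_tprod] fs.scale_right_distrib mult.commute)
    fix y assume "y \<in> {tens s V xs |xs ds. hlist V xs ds \<and> xs \<noteq> [] \<and> sum_list ds = b}"
    then obtain ys bs where y: "y = tens s V ys" "hlist V ys bs" "sum_list bs = b" by blast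
    have z: "tprod s V (tens s V zs) 0 = 0" if "set zs \<subseteq> G" for zs
      using tprod_tens[OF that Tens_0] flin_zero[OF flin_tlift] by simp
    show "twist s V 0 (tprod s V (lenp s V 1 (tens s V xs)) (lenp s V 1 y)) =
      fscale (sg (a * b)) (tprod s V (lenp s V 1 y) (lenp s V 1 (tens s V xs)))"
    proof (cases "length xs = 1 \<and> length ys = 1")
      case True
      then obtain u w where uw: "xs = [u]" "ys = [w]" by (auto simp: length_Suc_conv)
      then have V: "u \<in> V a" "w \<in> V b" using xs y by auto
      have "twist s V 0 (tens s V [u, w]) = fscale (sg (a * b)) (tens s V [w, u])"
        using twist_hom[of "[]" "[]" u a w b "[]" "[]" 0] V by simp
      then show ?thesis
        using V tprod_tens_tens[of "[u]" "[w]" "[b]"] tprod_tens_tens[of "[w]" "[u]" "[a]"] V_G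
        by (simp add: y uw lenp_tens)
    next
      case False
      then show ?thesis
        using hlist_G[OF xs(1)] hlist_G[OF y(2)]
        by (auto simp: y(1) lenp_tens z flin_zero[OF flin_tprod] flin_zero[OF flin_twist])
    qed
  qed
  show ?thesis
  proof (rule flin_eq_on_span[OF _ _ _ x[unfolded Tbar_span]])
    have L: "lenp s V 1 y \<in> Tens s V" by (rule lenp_Tens[OF T_Tens[OF T.V_G[OF y]]])
    show "lin_on fscale fscale (fs.span {tens s V xs |xs ds. hlist V xs ds \<and> xs \<noteq> [] \<and> sum_list ds = a})
       (\<lambda>x. twist s V 0 (tprod s V (lenp s V 1 x) (lenp s V 1 y)))"
      by (rule flin_on[OF flin_comp[OF flin_comp[OF flin_lenp flin_tprod] flin_twist]])
    have "lin_on fscale fscale (Tbar s V a) (\<lambda>x. tprod s V (lenp s V 1 y) (lenp s V 1 x))"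
      by (rule lin_on_comp[OF flin_on[OF flin_lenp] lin_tprod[OF L]]) (intro lenp_Tens T_Tens T.V_G)
    then show "lin_on fscale fscale (fs.span {tens s V xs |xs ds. hlist V xs ds \<and> xs \<noteq> [] \<and> sum_list ds = a})
       (\<lambda>x. fscale (sg (a * b)) (tprod s V (lenp s V 1 y) (lenp s V 1 x)))"
      unfolding Tbar_span[symmetric] by (simp add: lin_on_def fs.scale_right_distrib mult.commute)
  qed (use * in blast)
qed

definition glue11 :: "('k, ('k, 'v) tensor) tensor2 \<Rightarrow> ('k, 'v) tensor" where
  "glue11 = tlift2 (\<lambda>x y. tprod s V (lenp s V 1 x) (lenp s V 1 y))"

lemma bilin_11: "flin h \<Longrightarrow> bilin (Tbar s V) (\<lambda>x y. h (tprod s V (lenp s V 1 x) (lenp s V 1 y)))"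
  by (rule bilin_tprod) (simp_all add: flin_lenp lenp_Tens T_Tens)

text \<open>Both blocks of a cut have length one only if the tensor has length 2 and is cut in the
  middle.\<close>

lemma glue11_deconcat: "z \<in> T.G \<Longrightarrow> glue11 (deconcat s V z) = lenp s V 2 z"
proof (induction rule: Tbar_induct)
  case (tens xs ds)
  have g: "glue11 (tens2V x y) = tprod s V (lenp s V 1 x) (lenp s V 1 y)" for x y
    unfolding glue11_def by (rule tlift2_eq[OF bilin_11[OF flin_id]])
  have z: "tprod s V (tens s V zs) 0 = 0" if "set zs \<subseteq> G" for zs
    using tprod_tens[OF that Tens_0] flin_zero[OF flin_tlift] by simp
  have "glue11 (deconcat s V (tens s V xs)) =
      (\<Sum>i\<in>{1..<length xs}. if i = 1 then lenp s V 2 (tens s V xs) else 0)"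
    unfolding deconcat_tens flin_sum[OF flin_tlift2[of "\<lambda>x y. tprod s V (lenp s V 1 x) (lenp s V 1 y)", folded glue11_def]] g
  proof (rule sum.cong[OF refl])
    fix i assume i: "i \<in> {1..<length xs}"
    show "tprod s V (lenp s V 1 (tens s V (take i xs))) (lenp s V 1 (tens s V (drop i xs))) =
       (if i = 1 then lenp s V 2 (tens s V xs) else 0)"
    proof (cases "i = 1 \<and> length xs = 2")
      case True
      then show ?thesis
        using set_take_G[OF hlist_G[OF tens(1)], of 1] tprod_tens_tens[OF _ hlist_drop[OF tens(1)], of _ 1]
        by (simp add: lenp_tens)
    next
      case False
      then show ?thesis
        using i set_take_G[OF hlist_G[OF tens(1)]] by (auto simp: lenp_tens flin_zero[OF flin_tprod] z)
    qed
  qed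
  then show ?case using tens(2) by (cases xs) (auto simp: lenp_tens)
next
  case lin
  show ?case unfolding glue11_def by (rule flin_on[OF flin_comp[OF flin_deconcat flin_tlift2]])
qed (rule flin_on[OF flin_lenp])

text \<open>At each point \<open>\<phi>\<close>, gluing and twisted gluing are two bilinear forms
  related by the signed exchange of arguments, precisely the kind of pair on which
  \<open>sym2\<close> forces \<open>Z\<close> to agree.\<close>

lemma twist_glue11:
  assumes Z: "Z \<in> T2 (Tbar s V)" and sym: "sym2 (Tbar s V) Z"
  shows "twist s V 0 (glue11 Z) = glue11 Z"
proof -
  let ?g = "\<lambda>x y. tprod s V (lenp s V 1 x) (lenp s V 1 y)"
  let ?t = "\<lambda>x y. twist s V 0 (?g x y)"
  have "twist s V 0 (glue11 Z) = tlift2 ?t Z"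
    unfolding glue11_def
    by (rule T2_eqI[OF Z flin_comp[OF flin_tlift2 flin_twist] flin_tlift2])
      (simp only: tlift2_eq[OF bilin_11[OF flin_id]] tlift2_eq[OF bilin_11[OF flin_twist]])
  also have "\<dots> = tlift2 ?g Z"
  proof (rule ext)
    fix \<phi>
    have "\<forall>a b. \<forall>x\<in>Tbar s V a. \<forall>y\<in>Tbar s V b. ?t x y \<phi> = sg (a * b) * ?g y x \<phi>"
      using twist_swap by (simp add: apply_simps)
    then have "Z (\<lambda>x y. ?g x y \<phi>) = Z (\<lambda>x y. ?t x y \<phi>)"
      using sym bilin_form[OF bilin_11[OF flin_id], where \<phi> = \<phi>]
        bilin_form[OF bilin_11[OF flin_twist[of s V 0]], where \<phi> = \<phi>]
      unfolding sym2_def by blast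
    then show "tlift2 ?t Z \<phi> = tlift2 ?g Z \<phi>" by (simp add: tlift2_def)
  qed
  finally show ?thesis by (simp add: glue11_def)
qed

text \<open>By \<open>glue_deconcat\<close>, \<open>z\<close> is recovered from its coproduct with one or two tensor factors split
  off. The twists in positions \<open>> 0\<close> then act on the second factor, by induction, while the twist
  in position \<open>0\<close> becomes the graded swap.\<close>

lemma tinv_subcoalgebra:
  assumes C: "C \<subseteq> T.G"
    and left: "\<And>z. z \<in> C \<Longrightarrow> deconcat s V z \<in> T2_in (Tbar s V) C T.G"
    and right: "\<And>z. z \<in> C \<Longrightarrow> deconcat s V z \<in> T2_in (Tbar s V) T.G C"
    and sym: "\<And>z. z \<in> C \<Longrightarrow> sym2 (Tbar s V) (deconcat s V z)"
    and z: "z \<in> C"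
  shows "tinv s V z"
proof -
  have CT: "z \<in> C \<Longrightarrow> z \<in> T.G" for z using C by blast
  have "twist s V i z = z" for i
    using z
  proof (induction i arbitrary: z)
    case 0
    have t2: "twist s V 0 (lenp s V 2 x) = lenp s V 2 x" if "x \<in> C" for x
      using twist_glue11[OF deconcat_T2[OF CT[OF that]] sym[OF that]] glue11_deconcat[OF CT[OF that]] by simp
    \<comment> \<open>The left factors lie in \<open>C\<close>, and their parts of length 2 have
      just been shown to be fixed by the twist.\<close>
    have "glue 2 (deconcat s V z) \<in> {y. twist s V 0 y = y}"
      by (rule T2_in_map[OF flin_glue subspace_eqs[OF flin_twist flin_id] left[OF 0]])
        (use t2 in \<open>simp add: glue_tens2 twist_tprod_left CT T_Tens\<close>)
    moreover have "z = (\<Sum>m\<in>{1..2}. lenp s V m z) + glue 2 (deconcat s V z)"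
      by (rule glue_deconcat[OF _ CT[OF 0]]) simp
    then have "z = lenp s V 1 z + lenp s V 2 z + glue 2 (deconcat s V z)"
      by (simp add: numeral_2_eq_2)
    ultimately show ?case
      using t2[OF 0] twist_lenp_1[OF T_Tens[OF CT[OF 0]], of 0]
      by (metis (mono_tags, lifting) flin_add[OF flin_twist] mem_Collect_eq)
  next
    case (Suc i)
    \<comment> \<open>With one factor split off on the left, position \<open>Suc i\<close> becomes
      position \<open>i\<close> of the right factor, which lies in \<open>C\<close>. This is why the
      induction runs over all elements of \<open>C\<close> at once.\<close>
    have "twist s V (Suc i) (glue 1 (tens2V x y)) = glue 1 (tens2V x y)" if "x \<in> T.G" "y \<in> C" for x y
      using twist_tprod[of x y 1 i] that Suc.IH[of y] CT T_Tens by (simp add: glue_tens2)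
    then have "glue 1 (deconcat s V z) \<in> {y. twist s V (Suc i) y = y}"
      by (intro T2_in_map[OF flin_glue subspace_eqs[OF flin_twist flin_id] right[OF Suc.prems]]) simp
    moreover have "z = lenp s V 1 z + glue 1 (deconcat s V z)"
      using glue_deconcat[OF _ CT[OF Suc.prems], of 1] by simp
    ultimately show ?case
      using twist_lenp_1[OF T_Tens[OF CT[OF Suc.prems]], of "Suc i"]
      by (metis (mono_tags, lifting) flin_add[OF flin_twist] mem_Collect_eq)
  qed
  then show ?thesis by (simp add: tinv_def)
qed

text \<open>The operator is the composite of the twists in positions 0 to \<open>j - 1\<close>. It
  is produced existentially, with just the properties needed: linear, trivial on invariant tensors,
  and explicit on homogeneous pure tensors.\<close>

lemma move_head: "\<exists>f. flin f \<and> (\<forall>z. tinv s V z \<longrightarrow> f z = z) \<and>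
   (\<forall>x a ys bs zs cs. x \<in> V a \<longrightarrow> hlist V ys bs \<longrightarrow> hlist V zs cs \<longrightarrow> length ys = j \<longrightarrow>
      f (tens s V (x # ys @ zs)) = fscale (sg (a * sum_list bs)) (tens s V (ys @ x # zs)))"
proof (induction j)
  case 0
  show ?case by (rule exI[of _ "\<lambda>z. z"]) (auto simp: flin_id sg_def)
next
  case (Suc j)
  then obtain f where f: "flin f" "\<And>z. tinv s V z \<Longrightarrow> f z = z"
    "\<And>x a ys bs zs cs. x \<in> V a \<Longrightarrow> hlist V ys bs \<Longrightarrow> hlist V zs cs \<Longrightarrow> length ys = j \<Longrightarrow>
      f (tens s V (x # ys @ zs)) = fscale (sg (a * sum_list bs)) (tens s V (ys @ x # zs))" by blast
  show ?case
  proof (intro exI[of _ "\<lambda>z. twist s V j (f z)"] conjI allI impI)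
    show "flin (\<lambda>z. twist s V j (f z))" by (rule flin_comp[OF f(1) flin_twist])
    show "tinv s V z \<Longrightarrow> twist s V j (f z) = z" for z using f(2) by (simp add: tinv_def)
    fix x a ys bs zs cs
    assume x: "x \<in> V a" and ys: "hlist V ys bs" and zs: "hlist V zs cs" and l: "length ys = Suc j"
    obtain ys' y where y: "ys = ys' @ [y]" using l by (cases ys rule: rev_cases) auto
    then obtain bs' b where b: "bs = bs' @ [b]" "hlist V ys' bs'" "y \<in> V b"
      using ys by (auto simp: hlist_append_iff)
    have yz: "hlist V (y # zs) (b # cs)" using b zs by simp
    have l': "length ys' = j" using l y by simp
    have "f (tens s V (x # ys @ zs)) = fscale (sg (a * sum_list bs')) (tens s V (ys' @ x # y # zs))"
      using f(3)[OF x b(2) yz l'] y by simp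
    then show "twist s V j (f (tens s V (x # ys @ zs))) =
        fscale (sg (a * sum_list bs)) (tens s V (ys @ x # zs))"
      using twist_hom[OF b(2) x b(3) zs l'] y b(1)
      by (simp add: flin_scale[OF flin_twist] sg_mult distrib_left)
  qed
qed

text \<open>The last factor \<open>x\<close> of the left block moves after the others:
  \<open>xs' @ x # ys\<close> first becomes \<open>x # ys @ xs'\<close>, and then \<open>x\<close>
  travels to the end.\<close>

lemma rotate_blocks: "\<exists>f. flin f \<and> (\<forall>z. tinv s V z \<longrightarrow> f z = z) \<and>
   (\<forall>xs as ys bs. hlist V xs as \<longrightarrow> hlist V ys bs \<longrightarrow> length xs = i \<longrightarrow> length xs + length ys = n \<longrightarrow>
      f (tens s V (xs @ ys)) = fscale (sg (sum_list as * sum_list bs)) (tens s V (ys @ xs)))"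
proof (induction i)
  case 0
  show ?case by (rule exI[of _ "\<lambda>z. z"]) (auto simp: flin_id sg_def)
next
  case (Suc i)
  then obtain f where f: "flin f" "\<And>z. tinv s V z \<Longrightarrow> f z = z"
    "\<And>xs as ys bs. hlist V xs as \<Longrightarrow> hlist V ys bs \<Longrightarrow> length xs = i \<Longrightarrow> length xs + length ys = n \<Longrightarrow>
      f (tens s V (xs @ ys)) = fscale (sg (sum_list as * sum_list bs)) (tens s V (ys @ xs))" by blast
  \<comment> \<open>\<open>x\<close> has to pass all other factors, of which there are
    \<open>n - 1\<close>.\<close>
  obtain g where g: "flin g" "\<And>z. tinv s V z \<Longrightarrow> g z = z"
    "\<And>x a ys bs zs cs. x \<in> V a \<Longrightarrow> hlist V ys bs \<Longrightarrow> hlist V zs cs \<Longrightarrow> length ys = n - 1 \<Longrightarrow>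
      g (tens s V (x # ys @ zs)) = fscale (sg (a * sum_list bs)) (tens s V (ys @ x # zs))"
    using move_head[of "n - 1"] by blast
  show ?case
  proof (intro exI[of _ "\<lambda>z. g (f z)"] conjI allI impI)
    show "flin (\<lambda>z. g (f z))" by (rule flin_comp[OF f(1) g(1)])
    show "tinv s V z \<Longrightarrow> g (f z) = z" for z using f(2) g(2) by simp
    fix xs as ys bs
    assume xs: "hlist V xs as" and ys: "hlist V ys bs" and l: "length xs = Suc i"
      and n: "length xs + length ys = n"
    obtain xs' x where x: "xs = xs' @ [x]" using l by (cases xs rule: rev_cases) auto
    then obtain as' a where a: "as = as' @ [a]" "hlist V xs' as'" "x \<in> V a"
      using xs by (auto simp: hlist_append_iff)
    have 1: "f (tens s V (xs @ ys)) = fscale (sg (sum_list as' * (a + sum_list bs))) (tens s V (x # ys @ xs'))"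
      using f(3)[OF a(2), of "x # ys" "a # bs"] a(3) ys l n x by simp
    have "g (tens s V (x # (ys @ xs') @ [])) =
        fscale (sg (a * sum_list (bs @ as'))) (tens s V ((ys @ xs') @ x # []))"
      by (rule g(3)[OF a(3) hlist_append[OF ys a(2)], of "[]" "[]"]) (use l n x in auto)
    then have 2: "g (tens s V (x # ys @ xs')) = fscale (sg (a * (sum_list bs + sum_list as'))) (tens s V (ys @ xs))"
      using x by simp
    have "g (f (tens s V (xs @ ys))) =
        fscale (sg (sum_list as' * (a + sum_list bs) + a * (sum_list bs + sum_list as'))) (tens s V (ys @ xs))"
      by (simp only: 1 2 flin_scale[OF g(1)] fs.scale_scale sg_mult)
    \<comment> \<open>The two exponents differ by twice \<open>a * sum_list as'\<close>.\<close>
    moreover have "sg (sum_list as' * (a + sum_list bs) + a * (sum_list bs + sum_list as')) =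
        (sg (sum_list as * sum_list bs) :: 'k)"
      using a(1) by (simp add: sg_def algebra_simps)
    ultimately show "g (f (tens s V (xs @ ys))) = fscale (sg (sum_list as * sum_list bs)) (tens s V (ys @ xs))"
      by simp
  qed
qed

lemma tens2_eval: "bilinear_form fscale (Tbar s V) \<beta> \<Longrightarrow> tens2V x y \<beta> = \<beta> x y"
  by (simp add: tens2_def)

text \<open>Cuts beyond the length of a tensor vanish, so one index range serves all lengths up to
  \<open>N\<close>, and statements about single cuts carry over to the coproduct.\<close>

lemma deconcat_cut: "z \<in> Tle s V N \<Longrightarrow> deconcat s V z = (\<Sum>i\<in>{1..<N}. cut s V i z)"
proof -
  assume "z \<in> Tle s V N"
  have flin: "flin (\<lambda>z. \<Sum>i\<in>{1..<N}. cut s V i z)"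
    by (rule lin_on_setsum[OF vector_space_fscale flin_cut])
  have "deconcat s V (tens s V xs) = (\<Sum>i\<in>{1..<N}. cut s V i (tens s V xs))" if "length xs \<le> N" for xs
    unfolding deconcat_tens cut_tens
    by (rule sum.mono_neutral_cong_left) (use that in auto)
  then have "Tle s V N \<subseteq> {z. deconcat s V z = (\<Sum>i\<in>{1..<N}. cut s V i z)}"
    unfolding Tle_def gtot_tpow
    by (intro fs.span_minimal UN_least subspace_eqs[OF flin_deconcat flin]) auto
  with \<open>z \<in> Tle s V N\<close> show ?thesis by blast
qed

text \<open>Rotating the first \<open>i\<close> factors to the back exchanges the two blocks of the
  cut, with exactly the sign that relates \<open>\<beta>\<close> to \<open>\<beta>'\<close>. The
  rotation fixes \<open>z\<close> by invariance, while the position of the cut changes from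
  \<open>i\<close> to \<open>n - i\<close>.\<close>

lemma sym2_cut:
  assumes z: "z \<in> tpow s V n m" and inv: "tinv s V z" and i: "i \<in> {1..<n}"
    and b: "bilinear_form fscale (Tbar s V) \<beta>" and b': "bilinear_form fscale (Tbar s V) \<beta>'"
    and s: "\<And>a b x y. x \<in> Tbar s V a \<Longrightarrow> y \<in> Tbar s V b \<Longrightarrow> \<beta>' x y = sg (a * b) * \<beta> y x"
  shows "cut s V i z \<beta> = cut s V (n - i) z \<beta>'"
proof -
  obtain f where f: "flin f" "\<And>z. tinv s V z \<Longrightarrow> f z = z"
    "\<And>xs as ys bs. hlist V xs as \<Longrightarrow> hlist V ys bs \<Longrightarrow> length xs = i \<Longrightarrow> length xs + length ys = n \<Longrightarrow>
      f (tens s V (xs @ ys)) = fscale (sg (sum_list as * sum_list bs)) (tens s V (ys @ xs))"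
    using rotate_blocks[of i n] by blast
  \<comment> \<open>Stated with \<open>f w\<close> on the right, the identity is linear in
    \<open>w\<close> and holds for all tensors, so pure ones suffice; the invariance of
    \<open>z\<close> removes \<open>f\<close> at the end.\<close>
  have "tpow s V n m \<subseteq> {w. cut s V i w \<beta> = cut s V (n - i) (f w) \<beta>'}"
    unfolding tpow_eq
  proof (rule fs.span_minimal)
    show "fs.subspace {w. cut s V i w \<beta> = cut s V (n - i) (f w) \<beta>'}"
      by (rule fs.subspaceI)
        (simp_all add: flin_zero[OF flin_cut] flin_zero[OF f(1)] flin_add[OF flin_cut] flin_add[OF f(1)]
          flin_scale[OF flin_cut] flin_scale[OF f(1)] apply_simps)
    show "{tens s V xs |xs. length xs = n \<and> (\<exists>ds. hlist V xs ds \<and> sum_list ds = m)} \<subseteq>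
        {w. cut s V i w \<beta> = cut s V (n - i) (f w) \<beta>'}"
    proof safe
      fix xs ds assume n: "n = length xs" and xs: "hlist V xs ds"
      let ?x = "take i xs" and ?y = "drop i xs" and ?a = "sum_list (take i ds)" and ?b = "sum_list (drop i ds)"
      have "f (tens s V (?x @ ?y)) = fscale (sg (?a * ?b)) (tens s V (?y @ ?x))"
        by (rule f(3)[OF hlist_take[OF xs] hlist_drop[OF xs]]) (use i n in auto)
      then have fx: "f (tens s V xs) = fscale (sg (?a * ?b)) (tens s V (?y @ ?x))" by simp
      have ne: "?x \<noteq> []" "?y \<noteq> []" using i n by auto
      have x: "tens s V ?x \<in> Tbar s V ?a" and y: "tens s V ?y \<in> Tbar s V ?b"
        using Tbar_tens[OF hlist_take[OF xs] ne(1)] Tbar_tens[OF hlist_drop[OF xs] ne(2)] by auto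
      have l: "length xs - i \<in> {1..<length (?y @ ?x)}" and l': "i \<in> {1..<length xs}" using i n by auto
      have c: "cut s V (length xs - i) (tens s V (?y @ ?x)) = tens2V (tens s V ?y) (tens s V ?x)"
        using l by (simp add: cut_tens)
      have "cut s V (length xs - i) (f (tens s V xs)) \<beta>' = sg (?a * ?b) * \<beta>' (tens s V ?y) (tens s V ?x)"
        by (simp only: fx flin_scale[OF flin_cut] c apply_simps tens2_eval[OF b'])
      also have "\<dots> = (sg (?a * ?b) * sg (?a * ?b)) * \<beta> (tens s V ?x) (tens s V ?y)"
        by (simp only: s[OF y x] mult.commute[of ?b ?a] mult.assoc)
      also have "\<dots> = cut s V i (tens s V xs) \<beta>"
        using l' by (simp add: cut_tens tens2_eval[OF b])
      finally show "cut s V i (tens s V xs) \<beta> = cut s V (length xs - i) (f (tens s V xs)) \<beta>'" ..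
    qed
  qed
  then have "cut s V i z \<beta> = cut s V (n - i) (f z) \<beta>'" using z by blast
  then show ?thesis using f(2)[OF inv] by simp
qed

lemma tpow_gtot: "tpow s V n m \<subseteq> gtot fscale (tpow s V n)"
  unfolding gtot_def by (rule order_trans[OF _ fs.span_superset]) auto

lemma sum_fun_apply: "(\<Sum>i\<in>I. f i) x = (\<Sum>i\<in>I. f i (x :: 'z) :: 'k)"
  by (induction I rule: infinite_finite_induct) (simp_all add: apply_simps)

lemma sym2_tpow:
  assumes n: "n \<ge> 1" and z: "z \<in> tpow s V n m" and inv: "tinv s V z"
  shows "sym2 (Tbar s V) (deconcat s V z)"
  unfolding sym2_def
proof (intro allI impI)
  fix \<beta> \<beta>' assume b: "bilinear_form fscale (Tbar s V) \<beta>" "bilinear_form fscale (Tbar s V) \<beta>'"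
    and "\<forall>a b. \<forall>x\<in>Tbar s V a. \<forall>y\<in>Tbar s V b. \<beta>' x y = sg (a * b) * \<beta> y x"
  then have s: "\<And>a b x y. x \<in> Tbar s V a \<Longrightarrow> y \<in> Tbar s V b \<Longrightarrow> \<beta>' x y = sg (a * b) * \<beta> y x" by blast
  have "z \<in> Tle s V n" using z tpow_gtot tpow_Tle[OF n order_refl] by blast
  note d = deconcat_cut[OF this]
  have "deconcat s V z \<beta> = (\<Sum>i\<in>{1..<n}. cut s V (n - i) z \<beta>')"
    unfolding d sum_fun_apply by (rule sum.cong[OF refl]) (rule sym2_cut[OF z inv _ b s])
  also have "\<dots> = (\<Sum>i\<in>{1..<n}. cut s V i z \<beta>')"
    by (rule sum.reindex_bij_witness[of _ "\<lambda>i. n - i" "\<lambda>i. n - i"]) auto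
  finally show "deconcat s V z \<beta> = deconcat s V z \<beta>'" unfolding d sum_fun_apply .
qed

lemma sym2_S: "z \<in> gtot fscale (Sbar s V) \<Longrightarrow> sym2 (Tbar s V) (deconcat s V z)"
proof -
  assume z: "z \<in> gtot fscale (Sbar s V)"
  have sub: "fs.subspace {z. sym2 (Tbar s V) (deconcat s V z)}"
    using subspace_sym2[of "Tbar s V"] unfolding fs.subspace_def
    by (simp add: flin_zero[OF flin_deconcat] flin_add[OF flin_deconcat] flin_scale[OF flin_deconcat])
  have "Sbar s V m \<subseteq> {z. sym2 (Tbar s V) (deconcat s V z)}" for m
    unfolding Sbar_def
    by (intro fs.span_minimal[OF _ sub]) (use sym2_tpow sym_action_tinv in auto)
  then have "gtot fscale (Sbar s V) \<subseteq> {z. sym2 (Tbar s V) (deconcat s V z)}"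
    unfolding gtot_def by (intro fs.span_minimal[OF _ sub]) auto
  then show ?thesis using z by blast
qed

lemma cut_T2: "z \<in> T.G \<Longrightarrow> cut s V i z \<in> T2 (Tbar s V)"
proof -
  assume z: "z \<in> T.G"
  show ?thesis
  proof (rule lin_subset_span[OF flin_cut _ subspace_T2 z[unfolded gtot_Tbar]])
    fix x assume "x \<in> {tens s V xs |xs ds. hlist V xs ds \<and> xs \<noteq> []}"
    then obtain xs ds where x: "x = tens s V xs" "hlist V xs ds" by blast
    show "cut s V i x \<in> T2 (Tbar s V)"
    proof (cases "i \<in> {1..<length xs}")
      case True
      then have "xs \<noteq> []" by auto
      then show ?thesis unfolding x(1) cut_tens
        using True tens_T[OF set_take_G[OF hlist_G[OF x(2)]], of i] tens_T[OF set_drop_G[OF hlist_G[OF x(2)]], of i]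
        by (auto intro: T2_tens2)
    next
      case False
      then have "cut s V i x = 0" unfolding x(1) cut_tens by (rule if_not_P)
      then show ?thesis by (simp add: T2_closed)
    qed
  qed
qed

lemma slice_T:
  assumes \<theta>: "lin_on fscale (*) T.G \<theta>" and Z: "Z \<in> T2 (Tbar s V)"
  shows "slice \<theta> Z \<in> T.G"
  by (rule T2_in_map[OF flin_slice T.subspace_G Z[unfolded T2_eq]])
    (simp add: slice_tens2[OF \<theta>] gtot_closed)

lemma twist_slice_left:
  assumes \<theta>: "lin_on fscale (*) T.G \<theta>" and w: "w \<in> Tens s V" and j: "Suc j < i"
  shows "twist s V j (slice \<theta> (cut s V i w)) = slice \<theta> (cut s V i (twist s V j w))"
  using w
proof (induction rule: Tens_induct)
  case (tens xs ds)
  show ?case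
  proof (cases "i \<in> {1..<length xs}")
    case True
    then have short: "Suc j < length xs" using j by simp
    obtain ps as u a w b zs cs where *: "xs = ps @ u # w # zs" "ds = as @ a # b # cs" "hlist V ps as"
        "u \<in> V a" "w \<in> V b" "hlist V zs cs" "length ps = j" "length as = j"
      using hlist_split[OF tens short] by metis
    obtain k where k: "i = Suc (Suc (j + k))" using j by (auto dest: less_imp_Suc_add)
    have t: "take i xs = ps @ u # w # take k zs" "drop i xs = drop k zs"
      "take i (ps @ w # u # zs) = ps @ w # u # take k zs" "drop i (ps @ w # u # zs) = drop k zs"
      using * k by simp_all
    have len: "i \<in> {1..<length (ps @ w # u # zs)}" using True * by simp
    have "twist s V j (tens s V (take i xs)) = fscale (sg (a * b)) (tens s V (ps @ w # u # take k zs))"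
      unfolding t by (rule twist_hom[OF *(3-5) hlist_take[OF *(6)] *(7)])
    moreover have "twist s V j (tens s V xs) = fscale (sg (a * b)) (tens s V (ps @ w # u # zs))"
      unfolding *(1) by (rule twist_hom[OF *(3-7)])
    ultimately show ?thesis
      using True len
      by (simp add: cut_tens slice_tens2[OF \<theta>] flin_scale[OF flin_twist] flin_scale[OF flin_slice]
          flin_scale[OF flin_cut] t mult.commute del: length_append length_Cons take_append drop_append)
  next
    case False
    then have c: "cut s V i (tens s V ys) = 0" if "length ys = length xs" for ys
      using False by (simp only: cut_tens that if_False)
    show ?thesis
    proof (cases "Suc j < length xs")
      case True
      obtain ps as u a w b zs cs where *: "xs = ps @ u # w # zs" "ds = as @ a # b # cs" "hlist V ps as"
          "u \<in> V a" "w \<in> V b" "hlist V zs cs" "length ps = j" "length as = j"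
        using hlist_split[OF tens True] by metis
      have "twist s V j (tens s V xs) = fscale (sg (a * b)) (tens s V (ps @ w # u # zs))"
        unfolding *(1) by (rule twist_hom[OF *(3-7)])
      then show ?thesis
        using c[of xs] c[of "ps @ w # u # zs"] *(1)
        by (simp add: flin_scale[OF flin_cut] flin_zero[OF flin_slice] flin_zero[OF flin_twist])
    qed (use c[of xs] in \<open>simp add: twist_short flin_zero[OF flin_slice] flin_zero[OF flin_twist]\<close>)
  qed
next
  case lin
  show ?case by (rule flin_comp[OF flin_comp[OF flin_cut flin_slice] flin_twist])
next
  case lin'
  show ?case by (rule flin_comp[OF flin_comp[OF flin_twist flin_cut] flin_slice])
qed

text \<open>What remains after the contraction has at most \<open>i\<close> factors, so a twist
  reaching beyond them does nothing.\<close>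

lemma twist_slice_left_id:
  assumes \<theta>: "lin_on fscale (*) T.G \<theta>" and w: "w \<in> Tens s V" and j: "i \<le> Suc j"
  shows "twist s V j (slice \<theta> (cut s V i w)) = slice \<theta> (cut s V i w)"
  using w
proof (induction rule: Tens_induct)
  case (tens xs ds)
  show ?case
    using j twist_short[of "take i xs" j]
    by (simp add: cut_tens slice_tens2[OF \<theta>] flin_scale[OF flin_twist] flin_zero[OF flin_slice]
        flin_zero[OF flin_twist])
next
  case lin
  show ?case by (rule flin_comp[OF flin_comp[OF flin_cut flin_slice] flin_twist])
next
  case lin'
  show ?case by (rule flin_comp[OF flin_cut flin_slice])
qed

text \<open>The right block starts after \<open>i\<close> factors, which shifts the position of the
  twist by \<open>i\<close>.\<close>

lemma twist_slice_right:
  assumes \<theta>: "lin_on fscale (*) T.G \<theta>" and w: "w \<in> Tens s V"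
  shows "twist s V j (slice \<theta> (swap2 (cut s V i w))) = slice \<theta> (swap2 (cut s V i (twist s V (i + j) w)))"
  using w
proof (induction rule: Tens_induct)
  case (tens xs ds)
  show ?case
  proof (cases "Suc (i + j) < length xs")
    case True
    obtain ps as u a w b zs cs where *: "xs = ps @ u # w # zs" "ds = as @ a # b # cs" "hlist V ps as"
        "u \<in> V a" "w \<in> V b" "hlist V zs cs" "length ps = i + j" "length as = i + j"
      using hlist_split[OF tens True] by metis
    have t: "drop i xs = drop i ps @ u # w # zs" "take i xs = take i ps"
      "drop i (ps @ w # u # zs) = drop i ps @ w # u # zs" "take i (ps @ w # u # zs) = take i ps"
      "length (ps @ w # u # zs) = length xs"
      using * by simp_all
    have "twist s V j (tens s V (drop i xs)) = fscale (sg (a * b)) (tens s V (drop i ps @ w # u # zs))"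
      unfolding t by (rule twist_hom[OF hlist_drop[OF *(3)] *(4-6)]) (use *(7) in simp)
    moreover have "twist s V (i + j) (tens s V xs) = fscale (sg (a * b)) (tens s V (ps @ w # u # zs))"
      unfolding *(1) by (rule twist_hom[OF *(3-7)])
    ultimately show ?thesis
      by (simp add: cut_tens swap2_tens2 slice_tens2[OF \<theta>] flin_scale[OF flin_twist] flin_scale[OF flin_slice]
          flin_scale[OF flin_cut] flin_scale[OF flin_swap2] flin_zero[OF flin_swap2] flin_zero[OF flin_slice]
          flin_zero[OF flin_twist] t mult.commute del: length_append length_Cons take_append drop_append)
  next
    case False
    then show ?thesis
      using twist_short[of xs "i + j"] twist_short[of "drop i xs" j]
      by (simp add: cut_tens swap2_tens2 slice_tens2[OF \<theta>] flin_scale[OF flin_twist] flin_zero[OF flin_slice]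
          flin_zero[OF flin_twist] flin_zero[OF flin_swap2])
  qed
next
  case lin
  show ?case by (rule flin_comp[OF flin_comp[OF flin_comp[OF flin_cut flin_swap2] flin_slice] flin_twist])
next
  case lin'
  show ?case by (rule flin_comp[OF flin_comp[OF flin_comp[OF flin_twist flin_cut] flin_swap2] flin_slice])
qed

section \<open>Symmetric tensors under coalgebra morphisms and coderivations\<close>

abbreviation S :: "('k, 'v) tensor set" where "S \<equiv> gtot fscale (Sbar s V)"

lemma S_T: "z \<in> S \<Longrightarrow> z \<in> T.G"
  by (simp add: S_iff)

text \<open>By the basis expansion it suffices that all slices of the coproduct are symmetric, and
  for each single cut this follows from the behaviour of twists under slicing.\<close>

lemma deconcat_S_left: "z \<in> S \<Longrightarrow> deconcat s V z \<in> T2_in (Tbar s V) S T.G"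
proof (rule T2_slices)
  assume z: "z \<in> S"
  then have zT: "z \<in> T.G" and inv: "\<And>i. twist s V i z = z" by (auto simp: S_iff tinv_def)
  show "deconcat s V z \<in> T2 (Tbar s V)" by (rule deconcat_T2[OF zT])
  fix \<theta> assume \<theta>: "lin_on fscale (*) T.G \<theta>"
  obtain N where N: "z \<in> Tle s V N" using Tbar_Tle[OF zT] ..
  have "slice \<theta> (cut s V i z) \<in> S" for i
    unfolding S_iff tinv_def
  proof (intro conjI allI)
    show "slice \<theta> (cut s V i z) \<in> T.G" by (rule slice_T[OF \<theta> cut_T2[OF zT]])
    show "twist s V j (slice \<theta> (cut s V i z)) = slice \<theta> (cut s V i z)" for j
      using twist_slice_left[OF \<theta> T_Tens[OF zT], of j i] twist_slice_left_id[OF \<theta> T_Tens[OF zT], of i j]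
      by (cases "Suc j < i") (simp_all add: inv)
  qed
  then show "slice \<theta> (deconcat s V z) \<in> S"
    unfolding deconcat_cut[OF N] flin_sum[OF flin_slice] by (intro fs.subspace_sum[OF subspace_gtot])
qed

lemma deconcat_S_right: "z \<in> S \<Longrightarrow> deconcat s V z \<in> T2_in (Tbar s V) T.G S"
proof (rule T2_slices')
  assume z: "z \<in> S"
  then have zT: "z \<in> T.G" and inv: "\<And>i. twist s V i z = z" by (auto simp: S_iff tinv_def)
  show "deconcat s V z \<in> T2 (Tbar s V)" by (rule deconcat_T2[OF zT])
  fix \<theta> assume \<theta>: "lin_on fscale (*) T.G \<theta>"
  obtain N where N: "z \<in> Tle s V N" using Tbar_Tle[OF zT] ..
  have "slice \<theta> (swap2 (cut s V i z)) \<in> S" for i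
    unfolding S_iff tinv_def
  proof (intro conjI allI)
    have "swap2 (cut s V i z) \<in> T2 (Tbar s V)"
      by (rule T2_in_map[OF flin_swap2 subspace_T2 cut_T2[OF zT, unfolded T2_eq]])
        (simp add: swap2_tens2 T2_tens2)
    then show "slice \<theta> (swap2 (cut s V i z)) \<in> T.G" by (rule slice_T[OF \<theta>])
    show "twist s V j (slice \<theta> (swap2 (cut s V i z))) = slice \<theta> (swap2 (cut s V i z))" for j
      using twist_slice_right[OF \<theta> T_Tens[OF zT], of j i] by (simp add: inv)
  qed
  then show "slice \<theta> (swap2 (deconcat s V z)) \<in> S"
    unfolding deconcat_cut[OF N] flin_sum[OF flin_swap2] flin_sum[OF flin_slice]
    by (intro fs.subspace_sum[OF subspace_gtot])
qed

text \<open>A map of degree 0 keeps degrees, so it pulls a pair of forms related by the graded swap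
  back to such a pair.\<close>

lemma sym2_t2map:
  assumes F: "graded_map fscale 0 A (Tbar s V) F" and A: "graded_space fscale A" and Z: "sym2 A Z"
  shows "sym2 (Tbar s V) (t2map (Tbar s V) F F Z)"
  unfolding sym2_def
proof (intro allI impI)
  fix \<beta> \<beta>' assume b: "bilinear_form fscale (Tbar s V) \<beta>" "bilinear_form fscale (Tbar s V) \<beta>'"
    and s: "\<forall>a b. \<forall>x\<in>Tbar s V a. \<forall>y\<in>Tbar s V b. \<beta>' x y = sg (a * b) * \<beta> y x"
  have L: "lmap A (Tbar s V) F" by (rule graded_map_lmap[OF F A T.graded_space])
  have F0: "F ` A n \<subseteq> Tbar s V (n + 0)" for n using F unfolding graded_map_def by blast
  have bil: "bilinear_form fscale A (\<lambda>x y. \<gamma> (F x) (F y))" if "bilinear_form fscale (Tbar s V) \<gamma>" for \<gamma>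
    using that unfolding bilinear_form_def lin_on_def
    by (simp add: lmap_add[OF L] lmap_scale[OF L] lmap_in[OF L])
  have "\<forall>a b. \<forall>x\<in>A a. \<forall>y\<in>A b. \<beta>' (F x) (F y) = sg (a * b) * \<beta> (F y) (F x)"
    using s F0 by (metis add_0_right image_subset_iff)
  then have "Z (\<lambda>x y. \<beta> (F x) (F y)) = Z (\<lambda>x y. \<beta>' (F x) (F y))"
    using Z bil[OF b(1)] bil[OF b(2)] unfolding sym2_def by blast
  then show "t2map (Tbar s V) F F Z \<beta> = t2map (Tbar s V) F F Z \<beta>'"
    by (simp add: t2map_def tlift2_def tens2_eval[OF b(1)] tens2_eval[OF b(2)])
qed

text \<open>The image of the symmetric tensors inherits the conditions of
  \<open>tinv_subcoalgebra\<close>, so compatibility with the coproduct replaces any direct analysis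
  of how \<open>F\<close> meets the symmetric group. This is what makes the asymmetric formula for
  the homotopy harmless.\<close>

theorem morphism_symmetric:
  assumes M: "graded_space s M" and F: "graded_map fscale 0 (Tbar s M) (Tbar s V) F"
    and mor: "\<And>z. z \<in> gtot fscale (Tbar s M) \<Longrightarrow> deconcat s V (F z) = t2map (Tbar s V) F F (deconcat s M z)"
    and z: "z \<in> gtot fscale (Sbar s M)"
  shows "F z \<in> S"
proof -
  interpret M: tensor_powers s M using M by unfold_locales
  let ?C = "F ` M.S"
  have L: "lmap (Tbar s M) (Tbar s V) F" by (rule graded_map_lmap[OF F M.T.graded_space T.graded_space])
  have "tinv s V (F z)"
  proof (rule tinv_subcoalgebra[of ?C])
    show "?C \<subseteq> T.G" using lmap_in[OF L] M.S_T by blast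
    show "F z \<in> ?C" using z by blast
  next
    fix y assume "y \<in> ?C"
    then obtain x where x: "x \<in> M.S" and y: "y = F x" by blast
    have d: "deconcat s V y = t2map (Tbar s V) F F (deconcat s M x)" using mor M.S_T[OF x] y by simp
    show "deconcat s V y \<in> T2_in (Tbar s V) ?C T.G" unfolding d
      by (rule T2_in_map[OF flin_t2map subspace_T2_in M.deconcat_S_left[OF x]])
        (simp add: t2map_tens2[OF L L] T2_in_base lmap_in[OF L])
    show "deconcat s V y \<in> T2_in (Tbar s V) T.G ?C" unfolding d
      by (rule T2_in_map[OF flin_t2map subspace_T2_in M.deconcat_S_right[OF x]])
        (simp add: t2map_tens2[OF L L] T2_in_base lmap_in[OF L])
    show "sym2 (Tbar s V) (deconcat s V y)" unfolding d
      by (rule sym2_t2map[OF F M.T.graded_space M.sym2_S[OF x]])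
  qed
  then show ?thesis using lmap_in[OF L M.S_T[OF z]] by (simp add: S_iff)
qed

abbreviation "kT \<equiv> koszul fscale (Tbar s V) 1"

lemma lmap_kT: "lmap (Tbar s V) (Tbar s V) kT"
  by (rule lmapI[OF T.lin_koszul T.koszul_G])

lemma kT_S: "z \<in> S \<Longrightarrow> kT z \<in> S"
proof -
  assume z: "z \<in> S"
  have "twist s V i (kT z) = kT z" for i
    using T.graded_map_koszul[OF graded_map_twist T.graded_space S_T[OF z], of i 1] z
    by (simp add: S_iff tinv_def)
  then show ?thesis using z T.koszul_G by (simp add: S_iff tinv_def)
qed

text \<open>Under the graded swap the summands \<open>R \<otimes> id\<close> and
  \<open>id \<otimes> R\<close> change places. Since \<open>R\<close> has degree 1, exchanging
  \<open>R x\<close> with \<open>y\<close> costs an additional sign \<open>sg b\<close>, which is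
  what \<open>kT\<close> supplies.\<close>

lemma sym2_coderivation:
  assumes R: "graded_map fscale 1 (Tbar s V) (Tbar s V) R"
    and Z: "sym2 (Tbar s V) Z"
  shows "sym2 (Tbar s V) (t2map (Tbar s V) R (\<lambda>x. x) Z + t2map (Tbar s V) kT R Z)"
  unfolding sym2_def
proof (intro allI impI)
  let ?A = "Tbar s V"
  fix \<beta> \<beta>' assume b: "bilinear_form fscale ?A \<beta>" "bilinear_form fscale ?A \<beta>'"
    and s: "\<forall>a b. \<forall>x\<in>?A a. \<forall>y\<in>?A b. \<beta>' x y = sg (a * b) * \<beta> y x"
  have L: "lmap ?A ?A R" by (rule graded_map_lmap[OF R T.graded_space T.graded_space])
  have R1: "R x \<in> ?A (a + 1)" if "x \<in> ?A a" for x a using R that unfolding graded_map_def by blast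
  show "(t2map ?A R (\<lambda>x. x) Z + t2map ?A kT R Z) \<beta> = (t2map ?A R (\<lambda>x. x) Z + t2map ?A kT R Z) \<beta>'"
  proof -
    have bil: "bilinear_form fscale ?A (\<lambda>x y. \<gamma> (f x) (g y))"
      if "bilinear_form fscale ?A \<gamma>" and f: "lmap ?A ?A f" and g: "lmap ?A ?A g" for \<gamma> f g
      using that(1) unfolding bilinear_form_def lin_on_def
      by (simp add: lmap_add[OF f] lmap_scale[OF f] lmap_in[OF f] lmap_add[OF g] lmap_scale[OF g] lmap_in[OF g])
    have neg: "\<beta>'' (- x) y = - \<beta>'' x y"
      if \<beta>'': "bilinear_form fscale ?A \<beta>''" and "x \<in> T.G" "y \<in> T.G" for \<beta>'' x y
    proof -
      have "\<beta>'' (fscale (- 1) x) y = - 1 * \<beta>'' x y"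
        using that unfolding bilinear_form_def lin_on_def by blast
      then show ?thesis by simp
    qed
    have k: "\<beta>'' (kT x) y = sg a * \<beta>'' x y"
      if "bilinear_form fscale ?A \<beta>''" "x \<in> ?A a" "y \<in> T.G" for \<beta>'' x y a
      using neg[OF that(1) T.V_G[OF that(2)] that(3)] by (simp add: T.koszul_hom[OF that(2)] sg_def)
    note RG = lmap_in[OF L T.V_G]
    have "\<beta>' (R x) y = sg (a * b) * \<beta> (kT y) (R x)" if "x \<in> ?A a" "y \<in> ?A b" for x y a b
    proof -
      have "\<beta>' (R x) y = sg ((a + 1) * b) * \<beta> y (R x)" using s R1[OF that(1)] that(2) by blast
      also have "\<dots> = sg (a * b) * (sg b * \<beta> y (R x))"
        by (simp only: sg_mult mult.assoc[symmetric] distrib_right mult_1)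
      finally show ?thesis by (simp only: k[OF b(1) that(2) RG[OF that(1)]])
    qed
    then have 1: "Z (\<lambda>x y. \<beta> (kT x) (R y)) = Z (\<lambda>x y. \<beta>' (R x) y)"
      using Z bil[OF b(1) lmap_kT L] bil[OF b(2) L lmap_id(1)] unfolding sym2_def by blast
    have "\<beta>' (kT x) (R y) = sg (a * b) * \<beta> (R y) x" if "x \<in> ?A a" "y \<in> ?A b" for x y a b
    proof -
      have "\<beta>' (kT x) (R y) = sg a * (sg (a * (b + 1)) * \<beta> (R y) x)"
        using s R1[OF that(2)] that(1) by (simp add: k[OF b(2) that(1) RG[OF that(2)]])
      also have "\<dots> = sg (a + a * (b + 1)) * \<beta> (R y) x" by (simp only: sg_mult mult.assoc[symmetric])
      also have "sg (a + a * (b + 1)) = (sg (a * b) :: 'k)" by (simp add: sg_def algebra_simps)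
      finally show ?thesis .
    qed
    then have 2: "Z (\<lambda>x y. \<beta> (R x) y) = Z (\<lambda>x y. \<beta>' (kT x) (R y))"
      using Z bil[OF b(1) L lmap_id(1)] bil[OF b(2) lmap_kT L] unfolding sym2_def by blast
    show ?thesis
      using 1 2 by (simp add: apply_simps t2map_def tlift2_def tens2_eval[OF b(1)] tens2_eval[OF b(2)])
  qed
qed

text \<open>The image of \<open>S\<close> alone need not be a subcoalgebra: in each summand of the
  coproduct of \<open>R x\<close> only one factor carries \<open>R\<close>. Hence \<open>S\<close>
  is adjoined to it.\<close>

theorem coderivation_symmetric:
  assumes R: "graded_map fscale 1 (Tbar s V) (Tbar s V) R"
    and der: "\<And>z. z \<in> T.G \<Longrightarrow> deconcat s V (R z) =
      t2map (Tbar s V) R (\<lambda>x. x) (deconcat s V z) + t2map (Tbar s V) kT R (deconcat s V z)"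
    and z: "z \<in> S"
  shows "R z \<in> S"
proof -
  let ?A = "Tbar s V" and ?C = "S \<union> R ` S"
  have L: "lmap ?A ?A R" by (rule graded_map_lmap[OF R T.graded_space T.graded_space])
  have sub: "S \<subseteq> ?C" "S \<subseteq> T.G" "?C \<subseteq> T.G" using S_T lmap_in[OF L] by auto
  have "tinv s V (R z)"
  proof (rule tinv_subcoalgebra[of ?C])
    show "?C \<subseteq> T.G" by (rule sub)
    show "R z \<in> ?C" using z by blast
  next
    fix y assume "y \<in> ?C"
    then consider "y \<in> S" | x where "x \<in> S" "y = R x" by blast
    then have "deconcat s V y \<in> T2_in ?A ?C T.G \<and> deconcat s V y \<in> T2_in ?A T.G ?C \<and>
        sym2 ?A (deconcat s V y)"
    proof cases
      case 1
      then show ?thesis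
        using deconcat_S_left deconcat_S_right sym2_S T2_in_mono[OF sub(1) order_refl] T2_in_mono[OF order_refl sub(1)]
        by blast
    next
      case 2
      have d: "deconcat s V y = t2map ?A R (\<lambda>x. x) (deconcat s V x) + t2map ?A kT R (deconcat s V x)"
        using der S_T[OF 2(1)] 2(2) by simp
      have "t2map ?A R (\<lambda>x. x) (deconcat s V x) \<in> T2_in ?A ?C T.G"
        by (rule T2_in_map[OF flin_t2map subspace_T2_in deconcat_S_left[OF 2(1)]])
          (simp add: t2map_tens2[OF L lmap_id(1)] T2_in_base)
      moreover have "t2map ?A kT R (deconcat s V x) \<in> T2_in ?A ?C T.G"
        by (rule T2_in_map[OF flin_t2map subspace_T2_in deconcat_S_left[OF 2(1)]])
          (simp add: t2map_tens2[OF lmap_kT L] T2_in_base kT_S lmap_in[OF L])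
      moreover have "t2map ?A R (\<lambda>x. x) (deconcat s V x) \<in> T2_in ?A T.G ?C"
        by (rule T2_in_map[OF flin_t2map subspace_T2_in deconcat_S_right[OF 2(1)]])
          (simp add: t2map_tens2[OF L lmap_id(1)] T2_in_base lmap_in[OF L])
      moreover have "t2map ?A kT R (deconcat s V x) \<in> T2_in ?A T.G ?C"
        by (rule T2_in_map[OF flin_t2map subspace_T2_in deconcat_S_right[OF 2(1)]])
          (simp add: t2map_tens2[OF lmap_kT L] T2_in_base T.koszul_G)
      ultimately show ?thesis
        using sym2_coderivation[OF R sym2_S[OF 2(1)]] unfolding d
        by (simp add: fs.subspace_add[OF subspace_T2_in])
    qed
    then show "deconcat s V y \<in> T2_in ?A ?C T.G" "deconcat s V y \<in> T2_in ?A T.G ?C"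
        "sym2 ?A (deconcat s V y)" by auto
  qed
  then show ?thesis using lmap_in[OF L S_T[OF z]] by (simp add: S_iff)
qed

end

lemma t2map_koszul:
  assumes A: "graded_space fscale A" and R: "lmap A A R" and Z: "Z \<in> T2 A"
  shows "tmap2 fscale A A 0 R id Z + tmap2 fscale A A 1 id R Z =
    t2map A R (\<lambda>x. x) Z + t2map A (koszul fscale A 1) R Z"
proof -
  interpret A: graded fscale A using A by unfold_locales
  have "tmap2 fscale A A 0 R id Z = t2map A R (\<lambda>x. x) Z"
    unfolding tmap2_t2map by (rule t2map_cong[OF Z R lmap_id(1)]) (simp_all add: A.koszul_zero_degree)
  then show ?thesis by (simp add: tmap2_t2map)
qed

context tensor_powers
begin

text \<open>Starting from the unit tensor and adding a homogeneous head at a time reduces an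
  identity on tensor powers to one use of the recursions for \<open>tcons\<close>.\<close>

lemma Tens_cons_induct [consumes 1, case_names lin lin' Nil Cons]:
  assumes "z \<in> Tens s V" "flin f" "flin g" "f (tens s V []) = g (tens s V [])"
    and Cons: "\<And>v a z. v \<in> V a \<Longrightarrow> z \<in> Tens s V \<Longrightarrow> f z = g z \<Longrightarrow> f (tcons s V v z) = g (tcons s V v z)"
  shows "f z = g z"
proof (rule Tens_induct[OF assms(1-3)])
  fix xs ds assume "hlist V xs ds"
  then show "f (tens s V xs) = g (tens s V xs)"
  proof (induction xs arbitrary: ds)
    case (Cons x xs)
    then obtain a as where x: "x \<in> V a" and xs: "hlist V xs as" by auto
    from assms(5)[OF x tens_Tens[OF xs] Cons.IH[OF xs]] x show ?case by (simp add: tcons_tens V_G)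
  qed (rule assms(4))
qed

lemma tder_Tens:
  assumes g: "gmap s V V \<gamma>" and k: "gmap s V V k" and z: "z \<in> Tens s V"
  shows "tder s V \<gamma> k z \<in> Tens s V"
proof (rule lin_subset_span[OF flin_tder _ subspace_Tens z[unfolded Tens_def]])
  fix x assume "x \<in> {tens s V xs |xs ds. hlist V xs ds}"
  then obtain xs ds where x: "x = tens s V xs" "hlist V xs ds" by blast
  have "tder s V \<gamma> k (tens s V xs) \<in> Tens s V"
    using x(2)
  proof (induction xs arbitrary: ds)
    case Nil
    show ?case by (simp add: tder_Nil[OF g k] Tens_0)
  next
    case (Cons x xs)
    then obtain a as where x: "x \<in> V a" and xs: "hlist V xs as" by auto
    have "tder s V \<gamma> k (tcons s V x (tens s V xs)) \<in> Tens s V"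
      unfolding tder_tcons[OF g k V_G[OF x] tens_Tens[OF xs]]
      by (intro Tens_add tcons_Tens Cons.IH[OF xs] tens_Tens[OF xs] gmap_in[OF g V_G[OF x]] gmap_in[OF k V_G[OF x]])
    then show ?case by (simp add: tcons_tens V_G[OF x])
  qed
  then show "tder s V \<gamma> k x \<in> Tens s V" by (simp add: x)
qed

lemma tmap_Tens:
  assumes M: "graded_space s M" and f: "graded_map s 0 M V f" and z: "z \<in> Tens s M"
  shows "tmap s V f z \<in> Tens s V"
proof (rule lin_subset_span[OF flin_tmap _ subspace_Tens z[unfolded Tens_def]])
  fix x assume "x \<in> {tens s M xs |xs ds. hlist M xs ds}"
  then obtain xs ds where x: "x = tens s M xs" "hlist M xs ds" by blast
  then show "tmap s V f x \<in> Tens s V"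
    using tens_Tens[OF tmap_hlist[OF M f x(2)], of s] graded_map_gmap[OF f M graded_space]
    by (simp add: tmap_tens_gmap[OF M])
qed

lemma graded_map_koszul_self: "graded_map s 0 V V (koszul s V e)"
  unfolding graded_map_def using lin_koszul koszul_V by auto

lemma Tle_sub_T: "z \<in> Tle s V N \<Longrightarrow> z \<in> T.G"
  using Tle_Tbar by blast

lemma Tle_tpow_map:
  assumes L: "lin_on fscale fscale T.G L"
    and n: "\<And>n. L ` gtot fscale (tpow s V n) \<subseteq> gtot fscale (tpow s M n)" and z: "z \<in> Tle s V N"
  shows "L z \<in> Tle s M N"
proof (rule Tle_into[OF L subspace_Tle _ z])
  fix m assume "1 \<le> m" "m \<le> N"
  then show "L ` gtot fscale (tpow s V m) \<subseteq> Tle s M N"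
    using n[of m] tpow_Tle[of m N s M] by blast
qed

lemma lenp_tcons: "v \<in> G \<Longrightarrow> z \<in> Tens s V \<Longrightarrow> lenp s V (Suc n) (tcons s V v z) = tcons s V v (lenp s V n z)"
proof -
  assume v: "v \<in> G" and z: "z \<in> Tens s V"
  from z show ?thesis
  proof (induction rule: Tens_induct)
    case (tens xs ds)
    show ?case using v by (simp add: tcons_tens lenp_tens flin_zero[OF flin_tcons])
  next
    case lin show ?case by (rule flin_comp[OF flin_tcons flin_lenp])
  next
    case lin' show ?case by (rule flin_comp[OF flin_lenp flin_tcons])
  qed
qed

lemma tprod_single: "v \<in> G \<Longrightarrow> z \<in> Tens s V \<Longrightarrow> tprod s V (tens s V [v]) z = tcons s V v z"
  by (simp add: tprod_tens tcons_def)

text \<open>Serves to discard all cuts but the first when the top-length part of \<open>Q\<close> is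
  extracted.\<close>

lemma lenp_tprod_zero:
  assumes x: "x \<in> Tens s V" and ys: "hlist V ys ds" and n: "length ys \<noteq> n"
  shows "lenp s V (Suc n) (tprod s V (lenp s V 1 x) (tens s V ys)) = 0"
  using x
proof (induction rule: Tens_induct)
  case (tens xs as)
  show ?case
    using tprod_tens_tens[OF hlist_G[OF tens] ys] n
    by (simp add: lenp_tens flin_zero[OF flin_lenp] flin_zero[OF flin_tprod])
next
  case lin show ?case by (rule flin_comp[OF flin_comp[OF flin_lenp flin_tprod] flin_lenp])
next
  case lin' show ?case by (rule lin_on_const_zero[OF vector_space_fscale])
qed

lemma lenp_tpow_id: "z \<in> gtot fscale (tpow s V n) \<Longrightarrow> lenp s V m z = (if m = n then z else 0)"
proof -
  assume z: "z \<in> gtot fscale (tpow s V n)"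
  have "gtot fscale (tpow s V n) \<subseteq> {z. lenp s V m z = (if m = n then z else 0)}"
    unfolding gtot_tpow
  proof (rule fs.span_minimal)
    show "fs.subspace {z. lenp s V m z = (if m = n then z else 0)}"
      by (cases "m = n") (simp_all add: subspace_eqs flin_lenp flin_id lin_on_const_zero vector_space_fscale)
  qed (auto simp: lenp_tens)
  then show ?thesis using z by blast
qed

lemma lenp_Tle: "z \<in> Tle s V N \<Longrightarrow> N < n \<Longrightarrow> lenp s V n z = 0"
proof -
  assume z: "z \<in> Tle s V N" and n: "N < n"
  have "Tle s V N \<subseteq> {z. lenp s V n z = 0}"
    unfolding Tle_def
    by (intro fs.span_minimal subspace_eqs[OF flin_lenp lin_on_const_zero[OF vector_space_fscale]])
      (use n lenp_tpow_id in fastforce)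
  then show ?thesis using z by blast
qed

end

subsection \<open>The transferred structure\<close>

text \<open>The inclusion of \<open>W\<close> is the identity function, because \<open>W\<close> and
  \<open>V\<close> live in the same ambient space.\<close>

locale transfer = V: tensor_powers s V
  for s :: "'k::field_char_0 \<Rightarrow> 'v::ab_group_add \<Rightarrow> 'v" and V +
  fixes W :: "int \<Rightarrow> 'v set"
    and Q d \<delta> :: "('k, 'v) tensor \<Rightarrow> ('k, 'v) tensor"
    and d1 p k :: "'v \<Rightarrow> 'v"
  assumes Q: "coderivation fscale (Tbar s V) (deconcat s V) (Tbar s V) Q"
    and d_lin: "lin_on fscale fscale (gtot fscale (Tbar s V)) d"
    and \<delta>_lin: "lin_on fscale fscale (gtot fscale (Tbar s V)) \<delta>"
    and Q_decomp: "\<And>z. z \<in> gtot fscale (Tbar s V) \<Longrightarrow> Q z = d z + \<delta> z"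
    and d_length: "\<And>n. n \<ge> 1 \<Longrightarrow> d ` gtot fscale (tpow s V n) \<subseteq> gtot fscale (tpow s V n)"
    and \<delta>_length: "\<And>n. n \<ge> 1 \<Longrightarrow> \<delta> ` gtot fscale (tpow s V n)
           \<subseteq> fs.span (\<Union>m\<in>{1..<n}. gtot fscale (tpow s V m))"
    and Q_square: "\<And>z. z \<in> gtot fscale (Sbar s V) \<Longrightarrow> Q (Q z) = 0"
    and d1: "\<And>v. v \<in> gtot s V \<Longrightarrow> Q (tens s V [v]) = tens s V [d1 v]"
    and contr: "contraction s W d1 V d1 (\<lambda>w. w) p k"
begin

lemma W_graded: "graded_space s W"
  using contr by (simp add: contraction_def dg_space_def)

sublocale W: tensor_powers s W
  using W_graded by unfold_locales

abbreviation "\<iota> \<equiv> tmap s V (\<lambda>w. w)"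
abbreviation "\<pi> \<equiv> tmap s W p"
text \<open>The map \<open>i p\<close> together with the sign that \<open>k\<close> picks up in
  passing a factor; \<open>i\<close> is invisible, and degree -1 has the same parity as degree
  1.\<close>

abbreviation "\<gamma> \<equiv> \<lambda>x. p (koszul s V 1 x)"
abbreviation "h \<equiv> tder s V \<gamma> k"
abbreviation "dV \<equiv> tder s V (koszul s V 1) d1"
abbreviation "dW \<equiv> tder s W (koszul s W 1) d1"

section \<open>The given contraction and the identities it induces on tensor powers\<close>

lemma g_i: "graded_map s 0 W V (\<lambda>w. w)" and g_p: "graded_map s 0 V W p"
  and g_k: "graded_map s (- 1) V V k" and g_dV: "graded_map s 1 V V d1" and g_dW: "graded_map s 1 W W d1"
  using contr unfolding contraction_def cochain_map_def dg_space_def by blast+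

lemma p_id: "x \<in> W.G \<Longrightarrow> p x = x" and hom: "x \<in> V.G \<Longrightarrow> p x - x = d1 (k x) + k (d1 x)"
  and pk: "x \<in> V.G \<Longrightarrow> p (k x) = 0" and ki: "x \<in> W.G \<Longrightarrow> k x = 0" and kk: "x \<in> V.G \<Longrightarrow> k (k x) = 0"
  and dd: "x \<in> V.G \<Longrightarrow> d1 (d1 x) = 0" and pd: "x \<in> V.G \<Longrightarrow> p (d1 x) = d1 (p x)"
  using contr unfolding contraction_def cochain_map_def dg_space_def by blast+

lemma W_V: "x \<in> W n \<Longrightarrow> x \<in> V n"
  using g_i unfolding graded_map_def by force

lemma WG: "x \<in> W.G \<Longrightarrow> x \<in> V.G"
  by (rule W.graded_map_G[OF g_i V.graded_space])

lemmas i_G = graded_map_gmap[OF g_i W_graded V.graded_space]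
lemmas p_G = graded_map_gmap[OF g_p V.graded_space W_graded]
lemmas k_G = graded_map_gmap[OF g_k V.graded_space V.graded_space]
lemmas d_G = graded_map_gmap[OF g_dV V.graded_space V.graded_space]
lemmas dW_G = graded_map_gmap[OF g_dW W_graded W_graded]

lemma g_\<gamma>: "graded_map s 0 V V \<gamma>"
proof -
  have p: "p ` V n \<subseteq> W (n + 0)" for n using g_p unfolding graded_map_def by blast
  have "\<gamma> ` V n \<subseteq> V (n + 0)" for n using p[of n] V.koszul_V W_V by fastforce
  moreover have "lin_on s s V.G \<gamma>"
    by (rule lin_on_comp[OF V.lin_koszul gmap_lin[OF p_G] V.koszul_G])
  ultimately show ?thesis unfolding graded_map_def by blast
qed

lemmas \<gamma>_G = graded_map_gmap[OF g_\<gamma> V.graded_space V.graded_space]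
lemmas \<kappa>_G = graded_map_gmap[OF V.graded_map_koszul_self V.graded_space V.graded_space]
lemmas \<kappa>W_G = graded_map_gmap[OF W.graded_map_koszul_self W_graded W_graded]

lemma p_koszul: "x \<in> V.G \<Longrightarrow> p (koszul s V 1 x) = koszul s W 1 (p x)"
  using V.graded_map_koszul[OF g_p W_graded, of x 1] by simp

lemma koszul_W: "x \<in> W.G \<Longrightarrow> koszul s V 1 x = koszul s W 1 x"
  using W.graded_map_koszul[OF g_i V.graded_space, of x 1] by simp

lemma k_koszul: "x \<in> V.G \<Longrightarrow> k (koszul s V 1 x) = - koszul s V 1 (k x)"
  using V.graded_map_koszul[OF g_k V.graded_space, of x 1] by simp

lemma d_koszul: "x \<in> V.G \<Longrightarrow> d1 (koszul s V 1 x) = - koszul s V 1 (d1 x)"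
  using V.graded_map_koszul[OF g_dV V.graded_space, of x 1] by simp

lemmas inG = gmap_in[OF p_G] gmap_in[OF k_G] gmap_in[OF d_G] gmap_in[OF dW_G] gmap_in[OF \<kappa>_G] gmap_in[OF \<kappa>W_G]
  WG V.V_G W.V_G
lemmas conses = V.tder_tcons[OF \<gamma>_G k_G] V.tder_tcons[OF \<kappa>_G d_G] W.tder_tcons[OF \<kappa>W_G dW_G]
  V.tmap_tcons[OF W_graded i_G] W.tmap_tcons[OF V.graded_space p_G]
lemmas nils = V.tder_Nil[OF \<gamma>_G k_G] V.tder_Nil[OF \<kappa>_G d_G] W.tder_Nil[OF \<kappa>W_G dW_G]
  V.tmap_Nil[OF W_graded i_G] W.tmap_Nil[OF V.graded_space p_G]
lemmas inTens = V.tder_Tens[OF \<gamma>_G k_G] V.tder_Tens[OF \<kappa>_G d_G] W.tder_Tens[OF \<kappa>W_G dW_G]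
  V.tmap_Tens[OF W_graded g_i] W.tmap_Tens[OF V.graded_space g_p]
lemmas zeros = flin_zero[OF flin_tder] flin_zero[OF V.flin_tmap] flin_zero[OF flin_tcons]
lemmas adds = flin_add[OF flin_tder] flin_add[OF V.flin_tmap] flin_add[OF flin_tcons]

lemma \<pi>_\<iota>: "z \<in> Tens s W \<Longrightarrow> \<pi> (\<iota> z) = z"
proof (induction rule: W.Tens_cons_induct)
  case (Cons v a z)
  then show ?case by (simp add: conses inG inTens p_id)
next
  case lin show ?case by (rule flin_comp[OF V.flin_tmap V.flin_tmap])
qed (simp_all add: nils flin_id)

lemma h_\<iota>: "z \<in> Tens s W \<Longrightarrow> h (\<iota> z) = 0"
proof (induction rule: W.Tens_cons_induct)
  case (Cons v a z)
  then show ?case by (simp add: conses inG inTens ki zeros V.tcons_zero)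
next
  case lin show ?case by (rule flin_comp[OF V.flin_tmap flin_tder])
next
  case lin' show ?case by (rule lin_on_const_zero[OF vector_space_fscale])
qed (simp add: nils)

lemma \<pi>_h: "z \<in> Tens s V \<Longrightarrow> \<pi> (h z) = 0"
proof (induction rule: V.Tens_cons_induct)
  case (Cons v a z)
  then show ?case by (simp add: conses inG inTens adds pk zeros W.tcons_zero)
next
  case lin show ?case by (rule flin_comp[OF flin_tder V.flin_tmap])
next
  case lin' show ?case by (rule lin_on_const_zero[OF vector_space_fscale])
qed (simp add: nils zeros)

text \<open>Expanding on \<open>v \<otimes> z\<close> gives four terms. They vanish by
  \<open>k k = 0\<close>, by \<open>p k = 0\<close> up to a sign, by \<open>k i = 0\<close>, and by
  the induction hypothesis; all three side conditions of the contraction enter.\<close>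

lemma h_h: "z \<in> Tens s V \<Longrightarrow> h (h z) = 0"
proof (induction rule: V.Tens_cons_induct)
  case (Cons v a z)
  have "p (koszul s V 1 (k v)) = 0" using Cons by (simp add: p_koszul inG pk)
  moreover have "k (p (koszul s V 1 v)) = 0" using Cons by (simp add: ki inG)
  ultimately show ?case using Cons
    by (simp add: conses inG inTens adds kk zeros V.tcons_zero)
next
  case lin show ?case by (rule flin_comp[OF flin_tder flin_tder])
next
  case lin' show ?case by (rule lin_on_const_zero[OF vector_space_fscale])
qed (simp add: nils zeros)

text \<open>The mixed terms cancel because \<open>d1\<close> has odd degree and anticommutes with
  the sign operator.\<close>

lemma dV_dV: "z \<in> Tens s V \<Longrightarrow> dV (dV z) = 0"
proof (induction rule: V.Tens_cons_induct)
  case (Cons v a z)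
  have "tcons s V (d1 (koszul s V 1 v)) (dV z) = - tcons s V (koszul s V 1 (d1 v)) (dV z)"
    using Cons by (simp add: d_koszul V.tcons_minus inG inTens)
  then show ?case using Cons
    by (simp add: conses inG inTens adds dd zeros V.tcons_zero)
next
  case lin show ?case by (rule flin_comp[OF flin_tder flin_tder])
next
  case lin' show ?case by (rule lin_on_const_zero[OF vector_space_fscale])
qed (simp add: nils zeros)

lemma dV_\<iota>: "z \<in> Tens s W \<Longrightarrow> dV (\<iota> z) = \<iota> (dW z)"
proof (induction rule: W.Tens_cons_induct)
  case (Cons v a z)
  then show ?case by (simp add: conses inG inTens adds koszul_W)
next
  case lin show ?case by (rule flin_comp[OF V.flin_tmap flin_tder])
next
  case lin' show ?case by (rule flin_comp[OF flin_tder V.flin_tmap])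
qed (simp add: nils zeros)

text \<open>On \<open>v \<otimes> z\<close> the mixed terms cancel because \<open>k\<close> and
  \<open>d1\<close> are odd, and the rest telescopes: \<open>(p v - v) \<otimes> z + p v \<otimes>
  (\<iota> (\<pi> z) - z)\<close>. On the empty tensor both sides are zero.\<close>

lemma homotopy: "z \<in> Tens s V \<Longrightarrow> dV (h z) + h (dV z) = \<iota> (\<pi> z) - z"
proof (induction rule: V.Tens_cons_induct)
  case (Cons v a z)
  note v = V.V_G[OF Cons(1)] and z = Cons(2)
  let ?c = "tcons s V"
  have kv: "koszul s V 1 v \<in> V.G" using v inG by simp
  have 1: "?c (k (koszul s V 1 v)) (dV z) = - ?c (koszul s V 1 (k v)) (dV z)"
    using v z by (simp add: k_koszul V.tcons_minus inG inTens)
  have pv: "koszul s V 1 (p (koszul s V 1 v)) = p v"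
    using v kv by (simp add: koszul_W inG p_koszul W.koszul_koszul)
  have pv2: "p (koszul s V 1 (koszul s V 1 v)) = p v" using v by (simp add: V.koszul_koszul)
  have 2: "?c (d1 (p (koszul s V 1 v))) (h z) = - ?c (p (koszul s V 1 (d1 v))) (h z)"
  proof -
    have "d1 (p (koszul s V 1 v)) = p (- koszul s V 1 (d1 v))"
      using v kv by (simp add: pd[symmetric] d_koszul)
    also have "\<dots> = - p (koszul s V 1 (d1 v))"
      by (rule lin_on_uminus[OF gmap_lin[OF p_G] _ V.vs.vector_space_axioms V.vs.vector_space_axioms])
        (simp add: inG v)
    finally show ?thesis using v z by (simp add: V.tcons_minus inG inTens)
  qed
  have 3: "?c (d1 (k v)) z + ?c (k (d1 v)) z = ?c (p v) z - ?c v z"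
  proof -
    have "?c (p v) z = ?c (d1 (k v) + k (d1 v) + v) z" using hom[OF v] by (simp add: algebra_simps)
    also have "\<dots> = ?c (d1 (k v)) z + ?c (k (d1 v)) z + ?c v z"
      using v z by (simp add: V.tcons_add inG V.G_add)
    finally show ?thesis by simp
  qed
  have l: "dV (h (?c v z)) = ?c (d1 (k v)) z + ?c (koszul s V 1 (k v)) (dV z) +
      (?c (d1 (p (koszul s V 1 v))) (h z) + ?c (p v) (dV (h z)))"
    using v z by (simp add: conses inG inTens adds pv)
  have r: "h (dV (?c v z)) = ?c (k (d1 v)) z + ?c (p (koszul s V 1 (d1 v))) (h z) +
      (?c (k (koszul s V 1 v)) (dV z) + ?c (p v) (h (dV z)))"
    using v z by (simp add: conses inG inTens adds pv2)
  have "dV (h (?c v z)) + h (dV (?c v z)) =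
      (?c (d1 (k v)) z + ?c (k (d1 v)) z) + ?c (p v) (dV (h z) + h (dV z))"
    unfolding l r 1 2 flin_add[OF flin_tcons] by (simp add: algebra_simps)
  also have "\<dots> = ?c (p v) (\<iota> (\<pi> z)) - ?c v z"
    unfolding 3 Cons(3) flin_diff[OF flin_tcons] by (simp add: algebra_simps)
  also have "?c (p v) (\<iota> (\<pi> z)) = \<iota> (\<pi> (?c v z))"
    using v z by (simp add: conses inG inTens)
  finally show ?case .
next
  case lin show ?case by (rule flin_plus[OF flin_comp[OF flin_tder flin_tder] flin_comp[OF flin_tder flin_tder]])
next
  case lin' show ?case by (rule flin_sub[OF flin_comp[OF V.flin_tmap V.flin_tmap] flin_id])
qed (simp add: nils zeros)

section \<open>Splitting \<open>Q\<close> into the natural differential and a length-lowering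
  coderivation\<close>

abbreviation "A \<equiv> Tbar s V"
abbreviation "B \<equiv> Tbar s W"
abbreviation "\<Delta> \<equiv> deconcat s V"

lemma graded_Q: "graded_map fscale 1 A A Q"
  using Q unfolding coderivation_def by blast

lemma L_Q: "lmap A A Q"
  by (rule V.graded_map_lmap[OF graded_Q V.T.graded_space V.T.graded_space])

lemma Q_coder: "z \<in> V.T.G \<Longrightarrow> \<Delta> (Q z) = t2map A Q (\<lambda>x. x) (\<Delta> z) + t2map A V.kT Q (\<Delta> z)"
  using Q t2map_koszul[OF V.T.graded_space L_Q V.deconcat_T2] unfolding coderivation_def by simp

lemma \<delta>_tpow: "n \<ge> 1 \<Longrightarrow> z \<in> gtot fscale (tpow s V n) \<Longrightarrow> \<delta> z \<in> Tle s V (n - 1)"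
proof -
  assume n: "n \<ge> 1" and z: "z \<in> gtot fscale (tpow s V n)"
  have "{1..<n} = {1..n - 1}" using n by auto
  then show ?thesis using \<delta>_length[OF n] z unfolding Tle_def by auto
qed

text \<open>The truncated subtraction is harmless: for \<open>N = 0\<close> the filtration step is
  the zero space.\<close>

lemma \<delta>_Tle: "z \<in> Tle s V N \<Longrightarrow> \<delta> z \<in> Tle s V (N - 1)"
proof (rule Tle_into[OF \<delta>_lin subspace_Tle], rule image_subsetI)
  fix n z assume "1 \<le> n" "n \<le> N" "z \<in> gtot fscale (tpow s V n)"
  then show "\<delta> z \<in> Tle s V (N - 1)"
    using \<delta>_tpow[of n z] Tle_mono[of "n - 1" "N - 1" s V] diff_le_mono[of n N 1] by blast
qed

text \<open>The part of highest length of \<open>Q (v \<otimes> z)\<close> is read off its coproduct, by extracting the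
  first tensor factor.\<close>

lemma d_eq: "z \<in> V.T.G \<Longrightarrow> d z = dV z"
proof (induction rule: Tbar_induct)
  case (tens xs ds)
  show ?case using tens(2,1)
  proof (induction xs arbitrary: ds rule: list_nonempty_induct)
    case (single x)
    then have x: "x \<in> V.G" using V.hlist_G by fastforce
    have t: "tens s V [x] \<in> gtot fscale (tpow s V 1)" using tens_tpow[OF single, of s] by simp
    then have "\<delta> (tens s V [x]) = 0" using \<delta>_tpow[of 1] by simp
    moreover have "tens s V [x] \<in> V.T.G" using x by (intro V.tens_T) auto
    ultimately show ?case
      using Q_decomp[of "tens s V [x]"] d1[OF x] by (simp add: V.tder_tens[OF \<kappa>_G d_G])
  next
    case (cons x ys)
    obtain a bs where x: "x \<in> V a" and ys: "hlist V ys bs" using cons.prems by auto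
    let ?n = "length ys" and ?t = "tens s V (x # ys)" and ?L = "lenp s V (Suc (length ys))" and ?z = "tens s V ys"
    have n: "?n \<ge> 1" using cons.hyps by (simp add: Suc_le_eq)
    have xG: "x \<in> V.G" and ysG: "set ys \<subseteq> V.G" using x ys V.V_G V.hlist_G by auto
    have tT: "?t \<in> V.T.G" and zT: "?z \<in> V.T.G"
      using xG ysG cons.hyps by (auto intro!: V.tens_T)
    have tn: "?t \<in> gtot fscale (tpow s V (Suc ?n))" using tens_tpow[OF cons.prems, of s] by simp
    have zn: "?z \<in> gtot fscale (tpow s V ?n)" using tens_tpow[OF ys, of s] by simp
    \<comment> \<open>Since \<open>\<delta>\<close> strictly lowers length, the part of
      \<open>Q w\<close> that has the length of \<open>w\<close> is \<open>d w\<close>.\<close>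
    have top: "lenp s V m (Q w) = d w" if "w \<in> gtot fscale (tpow s V m)" "m \<ge> 1" for w m
    proof -
      have "w \<in> V.T.G" using tpow_Tbar[OF that(2)] that(1) by blast
      moreover have "lenp s V m (\<delta> w) = 0" using V.lenp_Tle[OF \<delta>_tpow[OF that(2,1)]] that(2) by simp
      moreover have "lenp s V m (d w) = d w"
        using V.lenp_tpow_id[of "d w" m m] d_length[OF that(2)] that(1) by auto
      ultimately show ?thesis by (simp add: Q_decomp flin_add[OF flin_lenp])
    qed
    have QT: "w \<in> V.T.G \<Longrightarrow> Q w \<in> V.T.G" for w by (rule lmap_in[OF L_Q])
    \<comment> \<open>\<open>glue 1\<close> recovers everything except the part of length 1, and the
      projection to length \<open>Suc ?n\<close>, which is at least 2, discards that part.\<close>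
    have dt: "d ?t = ?L (V.glue 1 (\<Delta> (Q ?t)))"
    proof -
      have "Q ?t = lenp s V 1 (Q ?t) + V.glue 1 (\<Delta> (Q ?t))"
        using V.glue_deconcat[OF _ QT[OF tT], of 1] by simp
      then have "?L (Q ?t) = ?L (lenp s V 1 (Q ?t) + V.glue 1 (\<Delta> (Q ?t)))" by (rule arg_cong)
      then have e: "?L (Q ?t) = ?L (lenp s V 1 (Q ?t)) + ?L (V.glue 1 (\<Delta> (Q ?t)))"
        by (simp only: flin_add[OF flin_lenp])
      have z: "?L (lenp s V 1 w) = 0" if "w \<in> Tens s V" for w
        using that
      proof (induction rule: Tens_induct)
        case lin show ?case by (rule flin_comp[OF flin_lenp flin_lenp])
      next
        case lin' show ?case by (rule lin_on_const_zero[OF vector_space_fscale])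
      qed (use cons.hyps in \<open>simp add: V.lenp_tens flin_zero[OF flin_lenp]\<close>)
      have "1 \<le> Suc ?n" by simp
      from e show ?thesis
        unfolding z[OF V.T_Tens[OF QT[OF tT]]] top[OF tn \<open>1 \<le> Suc ?n\<close>] add_0_left .
    qed
    define u where "u i = tens s V (take i (x # ys))" for i
    define w where "w i = tens s V (drop i (x # ys))" for i
    have \<Delta>t: "\<Delta> ?t = (\<Sum>i\<in>{1..<Suc ?n}. V.tens2V (u i) (w i))" by (simp add: V.deconcat_tens u_def w_def)
    have hw: "hlist V (drop i (x # ys)) (drop i (a # bs))" for i
      by (rule hlist_drop) (use x ys in simp)
    have hu: "hlist V (take i (x # ys)) (take i (a # bs))" for i
      by (rule hlist_take) (use x ys in simp)
    have uT: "u i \<in> V.T.G" if "i \<in> {1..<Suc ?n}" for i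
      unfolding u_def using that by (intro tens_gtot[OF hu]) auto
    have wT: "w i \<in> V.T.G" if "i \<in> {1..<Suc ?n}" for i
      unfolding w_def using that by (intro tens_gtot[OF hw]) auto
    have i1: "1 \<in> {1..<Suc ?n}" using cons.hyps by (cases ys) auto
    have u1: "u 1 = tens s V [x]" and w1: "w 1 = ?z" by (simp_all add: u_def w_def)
    have kx: "koszul s V 1 x \<in> V.G" using xG by (rule V.koszul_G)
    have k1: "V.kT (tens s V [x]) = tens s V [koszul s V 1 x]"
      using V.koszul_T[OF uT[OF i1], of 1] unfolding u1
      by (simp add: V.tmap_tens_gmap[OF V.graded_space \<kappa>_G])
    have single: "lenp s V 1 (tens s V [v]) = tens s V [v]" for v by (simp add: V.lenp_tens)
    \<comment> \<open>Only the part of \<open>Q (u i)\<close> of length 1 is glued to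
      \<open>w i\<close>. The result has the top length \<open>Suc ?n\<close> only for the cut
      directly after the first factor.\<close>
    have first: "?L (V.glue 1 (V.tens2V (Q (u i)) (w i))) = (if i = 1 then tcons s V (d1 x) ?z else 0)"
      if i: "i \<in> {1..<Suc ?n}" for i
    proof (cases "i = 1")
      case True
      have dx: "d1 x \<in> V.G" using xG by (rule gmap_in[OF d_G])
      have "V.glue 1 (V.tens2V (Q (u 1)) (w 1)) = tens s V (d1 x # ys)"
        unfolding V.glue_tens2 u1 w1 d1[OF xG] single V.tprod_single[OF dx tens_Tens[OF ys]]
        by (rule V.tcons_tens[OF dx])
      then show ?thesis using True V.tcons_tens[OF dx, of ys] by (simp add: V.lenp_tens)
    next
      case False
      then have "length (drop i (x # ys)) \<noteq> ?n" using i by (simp, linarith)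
      from V.lenp_tprod_zero[OF V.T_Tens[OF QT[OF uT[OF i]]] hw[of i] this] False show ?thesis
        by (simp add: V.glue_tens2 w_def)
    qed
    \<comment> \<open>The sign operator keeps the length \<open>i\<close> of \<open>u i\<close>, so
      the projection to length 1 inside \<open>glue 1\<close> again leaves only the first
      cut.\<close>
    have second: "?L (V.glue 1 (V.tens2V (V.kT (u i)) (Q (w i)))) =
        (if i = 1 then tcons s V (koszul s V 1 x) (d ?z) else 0)"
      if i: "i \<in> {1..<Suc ?n}" for i
    proof (cases "i = 1")
      case True
      have "V.glue 1 (V.tens2V (V.kT (u 1)) (Q (w 1))) = tcons s V (koszul s V 1 x) (Q ?z)"
        unfolding V.glue_tens2 u1 w1 k1 single by (rule V.tprod_single[OF kx V.T_Tens[OF QT[OF zT]]])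
      then show ?thesis
        using True V.lenp_tcons[OF kx V.T_Tens[OF QT[OF zT]]] top[OF zn n] by simp
    next
      case False
      have "V.kT (u i) = (if even (sum_list (take i (a # bs))) then u i else - u i)"
        using V.T.koszul_hom[of "u i" "sum_list (take i (a # bs))" 1] Tbar_tens[OF hu[of i], of s] i
        by (simp add: u_def)
      moreover have "lenp s V 1 (u i) = 0" using i False by (auto simp: u_def V.lenp_tens)
      ultimately have "lenp s V 1 (V.kT (u i)) = 0" by (simp add: flin_minus[OF flin_lenp])
      then show ?thesis using False
        by (simp add: V.glue_tens2 flin_zero[OF flin_tprod] flin_zero[OF flin_lenp])
    qed
    have "\<Delta> (Q ?t) = (\<Sum>i\<in>{1..<Suc ?n}. V.tens2V (Q (u i)) (w i)) +
        (\<Sum>i\<in>{1..<Suc ?n}. V.tens2V (V.kT (u i)) (Q (w i)))"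
      unfolding Q_coder[OF tT] \<Delta>t flin_sum[OF flin_t2map] t2map_tens2[OF L_Q lmap_id(1)]
        t2map_tens2[OF V.lmap_kT L_Q] ..
    then have "d ?t = (\<Sum>i\<in>{1..<Suc ?n}. if i = 1 then tcons s V (d1 x) ?z else 0) +
        (\<Sum>i\<in>{1..<Suc ?n}. if i = 1 then tcons s V (koszul s V 1 x) (d ?z) else 0)"
      by (simp only: dt flin_add[OF V.flin_glue] flin_add[OF flin_lenp] flin_sum[OF V.flin_glue]
          flin_sum[OF flin_lenp] first second cong: sum.cong)
    also have "\<dots> = tcons s V (d1 x) ?z + tcons s V (koszul s V 1 x) (d ?z)"
      using i1 by (simp only: sum.delta finite_atLeastLessThan if_True)
    also have "\<dots> = dV (tcons s V x ?z)"
      unfolding cons.IH[OF ys] by (rule V.tder_tcons[OF \<kappa>_G d_G xG V.T_Tens[OF zT], symmetric])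
    finally show ?case using xG by (simp add: V.tcons_tens)
  qed
next
  case lin show ?case by (rule d_lin)
next
  case lin' show ?case by (rule flin_on[OF flin_tder])
qed

lemma \<delta>_eq: "z \<in> V.T.G \<Longrightarrow> \<delta> z = Q z - dV z"
  using Q_decomp d_eq by simp

lemmas L_\<iota> = V.lmap_tmap[OF W_graded g_i]
lemmas L_\<pi> = W.lmap_tmap[OF V.graded_space g_p]
lemmas L_h = V.lmap_tder[OF g_\<gamma> g_k]
lemmas L_dV = V.lmap_tder[OF V.graded_map_koszul_self g_dV]
lemmas L_dW = W.lmap_tder[OF W.graded_map_koszul_self g_dW]
lemmas L_kT = V.lmap_kT
lemmas L_kW = W.lmap_kT
lemmas graded_\<iota> = V.graded_map_tmap(1)[OF W_graded g_i]
lemmas graded_\<pi> = W.graded_map_tmap(1)[OF V.graded_space g_p]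
lemmas graded_h = V.graded_map_tder(1)[OF g_\<gamma> g_k]
lemmas graded_dV = V.graded_map_tder(1)[OF V.graded_map_koszul_self g_dV]
lemmas graded_dW = W.graded_map_tder(1)[OF W.graded_map_koszul_self g_dW]

lemma graded_\<delta>: "graded_map fscale 1 A A \<delta>"
  unfolding graded_map_def
proof (intro conjI allI image_subsetI)
  fix n z assume z: "z \<in> A n"
  have "Q ` A n \<subseteq> A (n + 1)" "dV ` A n \<subseteq> A (n + 1)"
    using graded_Q graded_dV unfolding graded_map_def by blast+
  then show "\<delta> z \<in> A (n + 1)"
    using z V.T.V_G[OF z] by (auto simp: \<delta>_eq intro!: V.T.vs.subspace_diff[OF V.T.subspace_V])
qed (rule \<delta>_lin)

lemma L_\<delta>: "lmap A A \<delta>"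
  by (rule V.graded_map_lmap[OF graded_\<delta> V.T.graded_space V.T.graded_space])

lemma kT_tmap: "z \<in> V.T.G \<Longrightarrow> tmap s V (koszul s V 1) z = V.kT z"
  by (simp add: V.koszul_T)

lemma dV_coder: "z \<in> V.T.G \<Longrightarrow> \<Delta> (dV z) = t2map A dV (\<lambda>x. x) (\<Delta> z) + t2map A V.kT dV (\<Delta> z)"
  using V.deconcat_tder[OF V.graded_map_koszul_self g_dV]
    t2map_cong[OF V.deconcat_T2 L_kT L_dV kT_tmap] by simp

text \<open>\<open>\<delta>\<close> is the difference of the coderivations \<open>Q\<close> and
  \<open>dV\<close>; this rests on the identification of \<open>d\<close> with the natural
  differential.\<close>

lemma \<delta>_coder:
  assumes z: "z \<in> V.T.G"
  shows "\<Delta> (\<delta> z) = t2map A \<delta> (\<lambda>x. x) (\<Delta> z) + t2map A V.kT \<delta> (\<Delta> z)"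
proof -
  note Z = V.deconcat_T2[OF z]
  have 1: "t2map A \<delta> (\<lambda>x. x) (\<Delta> z) = t2map A (\<lambda>x. Q x - dV x) (\<lambda>x. x) (\<Delta> z)"
    by (rule t2map_cong[OF Z lmap_sub[OF L_Q L_dV] lmap_id(1)]) (simp_all add: \<delta>_eq)
  have 2: "t2map A V.kT \<delta> (\<Delta> z) = t2map A V.kT (\<lambda>x. Q x - dV x) (\<Delta> z)"
    by (rule t2map_cong[OF Z L_kT lmap_sub[OF L_Q L_dV]]) (simp_all add: \<delta>_eq)
  show ?thesis
    unfolding 1 2 t2map_minus_left[OF Z L_Q L_dV lmap_id(1)] t2map_minus_right[OF Z L_kT L_Q L_dV]
    by (simp add: \<delta>_eq[OF z] flin_diff[OF flin_deconcat] Q_coder[OF z] dV_coder[OF z])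
qed

text \<open>Functoriality of tensor powers, with the factorwise signs collected into the sign of the
  total degree.\<close>

lemma tmap_\<gamma>: "z \<in> V.T.G \<Longrightarrow> tmap s V \<gamma> z = \<iota> (\<pi> (V.kT z))"
proof -
  assume z: "z \<in> V.T.G"
  note zT = V.T_Tens[OF z]
  have kz: "tmap s V (koszul s V 1) z \<in> Tens s V" by (rule V.tmap_Tens[OF V.graded_space V.graded_map_koszul_self zT])
  have gm: "gmap s V W \<gamma>" using p_G V.koszul_G lin_on_comp[OF V.lin_koszul gmap_lin[OF p_G] V.koszul_G]
    by (auto simp: gmap_def)
  have "\<iota> (\<pi> (V.kT z)) = \<iota> (tmap s W \<gamma> z)"
    unfolding kT_tmap[OF z, symmetric] using W.tmap_comp[OF V.graded_space V.graded_space \<kappa>_G p_G zT] by simp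
  also have "\<dots> = tmap s V \<gamma> z" using V.tmap_comp[OF V.graded_space W_graded gm i_G zT] by simp
  finally show ?thesis ..
qed

text \<open>The coalgebra contraction identity: a left block passed by \<open>h\<close> undergoes
  \<open>\<iota> \<pi>\<close>, preceded by the sign operator because \<open>h\<close> has odd
  degree.\<close>

lemma h_coder:
  assumes z: "z \<in> V.T.G"
  shows "\<Delta> (h z) = t2map A h (\<lambda>x. x) (\<Delta> z) + t2map A (\<lambda>x. \<iota> (\<pi> (V.kT x))) h (\<Delta> z)"
  using V.deconcat_tder[OF g_\<gamma> g_k z]
    t2map_cong[OF V.deconcat_T2[OF z] lmap_comp[OF lmap_comp[OF L_kT L_\<pi>] L_\<iota>] L_h tmap_\<gamma>] by simp

lemma Tle_\<iota>: "z \<in> Tle s W N \<Longrightarrow> \<iota> z \<in> Tle s V N"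
  by (rule W.Tle_tpow_map[OF flin_on[OF V.flin_tmap] V.graded_map_tmap(2)[OF W_graded g_i]])

lemma Tle_\<pi>: "z \<in> Tle s V N \<Longrightarrow> \<pi> z \<in> Tle s W N"
  by (rule V.Tle_tpow_map[OF flin_on[OF V.flin_tmap] W.graded_map_tmap(2)[OF V.graded_space g_p]])

lemma Tle_h: "z \<in> Tle s V N \<Longrightarrow> h z \<in> Tle s V N"
  by (rule V.Tle_tpow_map[OF flin_on[OF flin_tder] V.graded_map_tder(2)[OF g_\<gamma> g_k]])

end

lemma Sum_any_lessThan:
  fixes f :: "nat \<Rightarrow> 'a::comm_monoid_add"
  assumes "\<And>n. N \<le> n \<Longrightarrow> f n = 0"
  shows "Sum_any f = (\<Sum>n<N. f n)"
proof (rule Sum_any.expand_superset)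
  have "n < N" if "f n \<noteq> 0" for n using assms[of n] that by (cases "N \<le> n") auto
  then show "{n. f n \<noteq> 0} \<subseteq> {..<N}" by blast
qed simp

section \<open>The perturbation series\<close>

context transfer
begin

definition step :: "nat \<Rightarrow> ('k, 'v) tensor \<Rightarrow> ('k, 'v) tensor" where
  "step n z = ((h \<circ> \<delta>) ^^ n) (\<iota> z)"

definition F :: "('k, 'v) tensor \<Rightarrow> ('k, 'v) tensor" where
  "F z = Sum_any (\<lambda>n. step n z)"

definition D :: "('k, 'v) tensor \<Rightarrow> ('k, 'v) tensor" where
  "D z = Sum_any (\<lambda>n. \<pi> (\<delta> (step n z)))"

abbreviation "R \<equiv> \<lambda>z. dW z + D z"

lemma step_0: "step 0 z = \<iota> z" and step_Suc: "step (Suc n) z = h (\<delta> (step n z))"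
  by (simp_all add: step_def)

lemma h\<delta>_Tle: "z \<in> Tle s V N \<Longrightarrow> h (\<delta> z) \<in> Tle s V (N - 1)"
  by (rule Tle_h[OF \<delta>_Tle])

text \<open>Each \<open>h \<delta>\<close> lowers the length bound by one, so this operator is
  locally nilpotent. The finiteness of the series and the uniqueness of solutions of
  \<open>x = h (\<delta> x)\<close> both rest on this.\<close>

lemma funpow_Tle: "z \<in> Tle s V N \<Longrightarrow> ((h \<circ> \<delta>) ^^ n) z \<in> Tle s V (N - n)"
proof (induction n)
  case (Suc n)
  have "((h \<circ> \<delta>) ^^ Suc n) z = h (\<delta> (((h \<circ> \<delta>) ^^ n) z))" by (simp only: funpow.simps comp_apply)
  moreover have "N - n - 1 = N - Suc n" by simp
  ultimately show ?case using h\<delta>_Tle[OF Suc.IH[OF Suc.prems]] by (simp only:)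
qed simp

lemma step_zero: "z \<in> Tle s W N \<Longrightarrow> N \<le> n \<Longrightarrow> step n z = 0"
  using funpow_Tle[OF Tle_\<iota>, of z N n] unfolding step_def by simp

lemma L_h\<delta>: "lmap A A (\<lambda>z. h (\<delta> z))"
  by (rule lmap_comp[OF L_\<delta> L_h])

lemma L_step: "lmap B A (step n)"
proof (induction n)
  case 0
  show ?case using L_\<iota> unfolding step_0 .
next
  case (Suc n)
  from lmap_comp[OF Suc L_h\<delta>] show ?case unfolding step_Suc .
qed

lemma F_eq: "z \<in> Tle s W N \<Longrightarrow> F z = (\<Sum>n<N. step n z)"
  unfolding F_def by (rule Sum_any_lessThan) (rule step_zero)

lemma L_F: "lmap B A F"
proof (rule lmapI)
  fix z assume "z \<in> W.T.G"
  then obtain N where N: "z \<in> Tle s W N" using Tbar_Tle by blast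
  show "F z \<in> V.T.G" unfolding F_eq[OF N] by (intro V.T.G_sum lmap_in[OF L_step] \<open>z \<in> W.T.G\<close>)
next
  show "lin_on fscale fscale W.T.G F"
  proof (rule lin_onI)
    fix x y assume xy: "x \<in> W.T.G" "y \<in> W.T.G"
    then obtain M N where "x \<in> Tle s W M" "y \<in> Tle s W N" using Tbar_Tle by blast
    \<comment> \<open>A common length bound makes the three truncated sums comparable.\<close>
    then have N: "x \<in> Tle s W (max M N)" "y \<in> Tle s W (max M N)"
      using Tle_mono[of M "max M N" s W] Tle_mono[of N "max M N" s W] by auto
    show "F (x + y) = F x + F y"
      unfolding F_eq[OF N(1)] F_eq[OF N(2)] F_eq[OF fs.subspace_add[OF subspace_Tle N]]
      by (simp add: lmap_add[OF L_step] xy sum.distrib)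
  next
    fix c x assume x: "x \<in> W.T.G"
    then obtain N where N: "x \<in> Tle s W N" using Tbar_Tle by blast
    show "F (fscale c x) = fscale c (F x)"
      unfolding F_eq[OF N] F_eq[OF fs.subspace_scale[OF subspace_Tle N]]
      by (simp add: lmap_scale[OF L_step] x fs.scale_sum_right)
  qed
qed

lemma F_fix: "z \<in> W.T.G \<Longrightarrow> F z = \<iota> z + h (\<delta> (F z))"
proof -
  assume z: "z \<in> W.T.G"
  then obtain N where N: "z \<in> Tle s W N" using Tbar_Tle by blast
  \<comment> \<open>One term more than necessary, so that splitting off \<open>n = 0\<close> leaves
    a sum over the full range \<open>n < N\<close>.\<close>
  have "F z = (\<Sum>n<Suc N. step n z)" by (rule F_eq) (use N Tle_mono[of N "Suc N" s W] in auto)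
  also have "\<dots> = step 0 z + (\<Sum>n<N. step (Suc n) z)" by (rule sum.lessThan_Suc_shift)
  also have "\<dots> = \<iota> z + (\<Sum>n<N. h (\<delta> (step n z)))" unfolding step_0 step_Suc ..
  also have "\<dots> = \<iota> z + h (\<delta> (\<Sum>n<N. step n z))"
    using lin_on_sum[OF lmap_lin[OF L_h\<delta>] vector_space_fscale vector_space_fscale subspace_gtot,
        of "{..<N}" "\<lambda>n. step n z"] lmap_in[OF L_step z] by simp
  finally show ?thesis unfolding F_eq[OF N] .
qed

lemma D_eq: "z \<in> W.T.G \<Longrightarrow> D z = \<pi> (\<delta> (F z))"
proof -
  assume z: "z \<in> W.T.G"
  then obtain N where N: "z \<in> Tle s W N" using Tbar_Tle by blast
  note L = lmap_comp[OF L_\<delta> L_\<pi>]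
  have "D z = (\<Sum>n<N. \<pi> (\<delta> (step n z)))"
    unfolding D_def by (rule Sum_any_lessThan) (simp add: step_zero[OF N] lmap_zero[OF L])
  also have "\<dots> = \<pi> (\<delta> (\<Sum>n<N. step n z))"
    by (rule lin_on_sum[OF lmap_lin[OF L] vector_space_fscale vector_space_fscale subspace_gtot, symmetric])
      (rule lmap_in[OF L_step z])
  finally show ?thesis unfolding F_eq[OF N] .
qed

lemma L_D: "lmap B B D"
  using lmap_comp[OF L_F lmap_comp[OF L_\<delta> L_\<pi>]] unfolding lmap_def lin_on_def
  by (simp add: D_eq gtot_closed)

lemma graded_F: "graded_map fscale 0 B A F"
  unfolding graded_map_def
proof (intro conjI allI image_subsetI)
  fix n z assume z: "z \<in> B n"
  have h\<delta>: "h (\<delta> y) \<in> A n" if "y \<in> A n" for y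
  proof -
    have "\<delta> ` A n \<subseteq> A (n + 1)" "h ` A (n + 1) \<subseteq> A (n + 1 + - 1)"
      using graded_\<delta> graded_h unfolding graded_map_def by blast+
    then show ?thesis using that by auto
  qed
  have "\<iota> ` B n \<subseteq> A (n + 0)" using graded_\<iota> unfolding graded_map_def by blast
  then have "\<iota> z \<in> A n" using z by auto
  then have "step m z \<in> A n" for m by (induction m) (simp_all add: step_0 step_Suc h\<delta>)
  then show "F z \<in> A (n + 0)"
    unfolding F_def Sum_any.expand_set by (simp add: fs.subspace_sum[OF V.T.subspace_V])
qed (rule lmap_lin[OF L_F])

lemma graded_D: "graded_map fscale 1 B B D"
  unfolding graded_map_def
proof (intro conjI allI image_subsetI)
  fix n z assume z: "z \<in> B n"
  have "F ` B n \<subseteq> A (n + 0)" "\<delta> ` A n \<subseteq> A (n + 1)" "\<pi> ` A (n + 1) \<subseteq> B (n + 1 + 0)"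
    using graded_\<delta> graded_\<pi> graded_F unfolding graded_map_def by blast+
  then have "\<pi> (\<delta> (F z)) \<in> B (n + 1)" using z by auto
  then show "D z \<in> B (n + 1)" using D_eq[OF W.T.V_G[OF z]] by simp
qed (rule lmap_lin[OF L_D])

text \<open>In the fixed point equation \<open>\<pi>\<close> sends \<open>\<iota> z\<close> to
  \<open>z\<close> and kills the image of \<open>h\<close>. In particular \<open>F\<close> is
  injective on tensors, which allows equations to be pulled back along it.\<close>

lemma \<pi>_F: "z \<in> W.T.G \<Longrightarrow> \<pi> (F z) = z"
proof -
  assume z: "z \<in> W.T.G"
  have "h (\<delta> (F z)) \<in> V.T.G" "\<delta> (F z) \<in> V.T.G"
    using z lmap_in[OF L_F] lmap_in[OF L_\<delta>] lmap_in[OF L_h] by blast+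
  note T = V.T_Tens[OF this(2)]
  have "\<pi> (F z) = \<pi> (\<iota> z + h (\<delta> (F z)))" using F_fix[OF z] by (rule arg_cong)
  also have "\<dots> = z" by (simp only: flin_add[OF V.flin_tmap] \<pi>_\<iota>[OF W.T_Tens[OF z]] \<pi>_h[OF T] add_0_right)
  finally show ?thesis .
qed

text \<open>In the fixed point equation \<open>h\<close> kills both \<open>\<iota> z\<close> and the
  image of \<open>h\<close>. This is what removes the mixed terms when \<open>\<Phi>\<close> is
  applied to \<open>F \<otimes> F\<close>.\<close>

lemma h_F: "z \<in> W.T.G \<Longrightarrow> h (F z) = 0"
proof -
  assume z: "z \<in> W.T.G"
  have "\<delta> (F z) \<in> V.T.G" using z lmap_in[OF L_F] lmap_in[OF L_\<delta>] by blast
  note T = V.T_Tens[OF this]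
  have "h (F z) = h (\<iota> z + h (\<delta> (F z)))" using F_fix[OF z] by (rule arg_cong)
  also have "\<dots> = 0" by (simp only: flin_add[OF flin_tder] h_\<iota>[OF W.T_Tens[OF z]] h_h[OF T] add_0_right)
  finally show ?thesis .
qed

section \<open>\<open>F\<close> as a coalgebra morphism and \<open>D\<close> as a
  coderivation\<close>

lemma h_kT: "x \<in> V.T.G \<Longrightarrow> h (V.kT x) = - V.kT (h x)"
  using V.T.graded_map_koszul[OF graded_h V.T.graded_space, of x 1] by simp

lemma \<pi>_kT: "x \<in> V.T.G \<Longrightarrow> \<pi> (V.kT x) = W.kT (\<pi> x)"
  using V.T.graded_map_koszul[OF graded_\<pi> W.T.graded_space, of x 1] by simp

text \<open>Up to Koszul signs, \<open>\<Theta>\<close> is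
  \<open>\<delta> \<otimes> id + id \<otimes> \<delta>\<close>, and \<open>\<Phi>\<close> is
  \<open>\<Theta>\<close> followed by \<open>h \<otimes> id + \<iota> \<pi> \<otimes> h\<close>. By
  \<open>h_coder\<close> and \<open>\<delta>_coder\<close>, \<open>\<Phi>\<close> lifts
  \<open>h \<delta>\<close> along the coproduct:
  \<open>\<Delta> (h (\<delta> y)) = \<Phi> (\<Delta> y)\<close> for every tensor
  \<open>y\<close>.\<close>

abbreviation "\<rho> \<equiv> \<lambda>x. \<iota> (\<pi> (V.kT x))"
abbreviation "\<Theta> Z \<equiv> t2map A \<delta> (\<lambda>x. x) Z + t2map A V.kT \<delta> Z"
abbreviation "\<Phi> Z \<equiv> t2map A h (\<lambda>x. x) (\<Theta> Z) + t2map A \<rho> h (\<Theta> Z)"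

lemma L_\<rho>: "lmap A A \<rho>"
  by (rule lmap_comp[OF lmap_comp[OF L_kT L_\<pi>] L_\<iota>])

text \<open>\<open>\<Phi>\<close> lowers the total length, so that the equation \<open>Z = \<Delta>(\<iota> z) + \<Phi> Z\<close> has at most one
  solution; both \<open>\<Delta> (F z)\<close> and \<open>(F \<otimes> F) (\<Delta> z)\<close> solve it.\<close>

definition total_le :: "nat \<Rightarrow> ('k, ('k, 'v) tensor) tensor2 set" where
  "total_le N = fs.span {V.tens2V x y |x y a b. x \<in> Tle s V a \<and> y \<in> Tle s V b \<and> a + b \<le> N}"

lemma total_le_base: "x \<in> Tle s V a \<Longrightarrow> y \<in> Tle s V b \<Longrightarrow> a + b \<le> N \<Longrightarrow> V.tens2V x y \<in> total_le N"
  unfolding total_le_def by (rule fs.span_base) blast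

lemma flin_\<Phi>: "flin \<Phi>"
  by (rule flin_plus[OF flin_comp[OF flin_plus[OF flin_t2map flin_t2map] flin_t2map]
      flin_comp[OF flin_plus[OF flin_t2map flin_t2map] flin_t2map]])

lemma Tle_kT: "x \<in> Tle s V a \<Longrightarrow> V.kT x \<in> Tle s V a"
  unfolding kT_tmap[OF V.Tle_sub_T, symmetric]
  by (rule V.Tle_tpow_map[OF flin_on[OF V.flin_tmap]
      V.graded_map_tmap(2)[OF V.graded_space V.graded_map_koszul_self]])

lemma total_le_0: "total_le 0 = {0}"
proof -
  have "{V.tens2V x y |x y a b. x \<in> Tle s V a \<and> y \<in> Tle s V b \<and> a + b \<le> 0} \<subseteq> {0}"
    by (auto simp: tens2_zero_left[OF V.T.G_0])
  then have "total_le 0 \<subseteq> {0}"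
    unfolding total_le_def by (rule fs.span_minimal) (rule fs.subspace_single_0)
  then show ?thesis using fs.span_zero unfolding total_le_def by auto
qed

text \<open>Each of the four terms contains exactly one \<open>\<delta>\<close>, which shortens one
  of the factors, while \<open>h\<close>, \<open>\<rho>\<close> and the sign operator respect length
  bounds.\<close>

lemma \<Phi>_total_le: "Z \<in> total_le (Suc N) \<Longrightarrow> \<Phi> Z \<in> total_le N"
proof -
  assume Z: "Z \<in> total_le (Suc N)"
  have K: "fs.subspace (total_le N)" for N by (simp add: total_le_def)
  show ?thesis
  proof (rule lin_subset_span[OF flin_\<Phi> _ K Z[unfolded total_le_def]])
    fix X assume "X \<in> {V.tens2V x y |x y a b. x \<in> Tle s V a \<and> y \<in> Tle s V b \<and> a + b \<le> Suc N}"
    then obtain x y a b where X: "X = V.tens2V x y" and x: "x \<in> Tle s V a" and y: "y \<in> Tle s V b"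
      and ab: "a + b \<le> Suc N" by blast
    have \<Theta>: "\<Theta> X = V.tens2V (\<delta> x) y + V.tens2V (V.kT x) (\<delta> y)"
      by (simp add: X t2map_tens2[OF L_\<delta> lmap_id(1)] t2map_tens2[OF L_kT L_\<delta>])
    have \<Phi>: "\<Phi> X = V.tens2V (h (\<delta> x)) y + V.tens2V (h (V.kT x)) (\<delta> y) +
        (V.tens2V (\<rho> (\<delta> x)) (h y) + V.tens2V (\<rho> (V.kT x)) (h (\<delta> y)))"
      by (simp only: \<Theta> flin_add[OF flin_t2map] t2map_tens2[OF L_h lmap_id(1)] t2map_tens2[OF L_\<rho> L_h])
    have \<rho>: "\<rho> x \<in> Tle s V a" if "x \<in> Tle s V a" for x a
      by (rule Tle_\<iota>[OF Tle_\<pi>[OF Tle_kT[OF that]]])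
    have z: "V.tens2V x' y' \<in> total_le N"
      if "x' \<in> Tle s V (a - 1) \<and> y' \<in> Tle s V b \<or> x' \<in> Tle s V a \<and> y' \<in> Tle s V (b - 1)" for x' y'
    proof -
      \<comment> \<open>The bounds \<open>a - 1\<close> and \<open>b - 1\<close> are truncated.
        Where the bound that should drop is already 0, the factor is zero and so is the
        tensor.\<close>
      consider "x' \<in> Tle s V (a - 1)" "y' \<in> Tle s V b" "a = 0" | "x' \<in> Tle s V (a - 1)" "y' \<in> Tle s V b" "a > 0"
        | "x' \<in> Tle s V a" "y' \<in> Tle s V (b - 1)" "b = 0" | "x' \<in> Tle s V a" "y' \<in> Tle s V (b - 1)" "b > 0"
        using \<open>_ \<or> _\<close> by fastforce
      then show ?thesis
      proof cases
        case 1
        then show ?thesis using tens2_zero_left[OF V.Tle_sub_T[OF 1(2)]] fs.subspace_0[OF K] by simp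
      next
        case 2 then show ?thesis using ab by (intro total_le_base[OF 2(1,2)]) simp
      next
        case 3
        then show ?thesis using tens2_zero_right[OF V.Tle_sub_T[OF 3(1)]] fs.subspace_0[OF K] by simp
      next
        case 4 then show ?thesis using ab by (intro total_le_base[OF 4(1,2)]) simp
      qed
    qed
    have x': "h (\<delta> x) \<in> Tle s V (a - 1)" "h (V.kT x) \<in> Tle s V a" "\<rho> (\<delta> x) \<in> Tle s V (a - 1)"
        "\<rho> (V.kT x) \<in> Tle s V a"
      by (rule h\<delta>_Tle[OF x], rule Tle_h[OF Tle_kT[OF x]], rule \<rho>[OF \<delta>_Tle[OF x]], rule \<rho>[OF Tle_kT[OF x]])
    have y': "\<delta> y \<in> Tle s V (b - 1)" "h y \<in> Tle s V b" "h (\<delta> y) \<in> Tle s V (b - 1)"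
      by (rule \<delta>_Tle[OF y], rule Tle_h[OF y], rule h\<delta>_Tle[OF y])
    show "\<Phi> X \<in> total_le N" unfolding \<Phi>
      by (intro fs.subspace_add[OF K] z) (use x' y y' in blast)+
  qed
qed

lemma \<Phi>_unique:
  assumes "Z \<in> T2 A" "Z = \<Phi> Z" shows "Z = 0"
proof -
  have "\<exists>N. Z \<in> total_le N"
    using assms(1)[unfolded T2_def]
  proof (induction rule: fs.span_induct_alt)
    case base show ?case using fs.span_zero unfolding total_le_def by blast
  next
    case (step c X Y)
    then obtain x y N where X: "X = V.tens2V x y" "x \<in> V.T.G" "y \<in> V.T.G" and N: "Y \<in> total_le N" by blast
    then obtain a b where ab: "x \<in> Tle s V a" "y \<in> Tle s V b" using Tbar_Tle by metis
    have "Y \<in> total_le (N + (a + b))"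
      using N unfolding total_le_def by (rule subsetD[OF fs.span_mono, rotated]) fastforce
    moreover have "X \<in> total_le (N + (a + b))" unfolding X by (rule total_le_base[OF ab]) simp
    ultimately show ?case unfolding total_le_def by (blast intro: fs.span_add fs.span_scale)
  qed
  then obtain N where "Z \<in> total_le N" ..
  then show ?thesis
  proof (induction N)
    case 0 then show ?case by (simp add: total_le_0)
  next
    case (Suc N)
    from \<Phi>_total_le[OF Suc.prems] have "Z \<in> total_le N" unfolding assms(2)[symmetric] .
    then show ?case by (rule Suc.IH)
  qed
qed

text \<open>For \<open>F \<otimes> F\<close> applied to the coproduct of \<open>z\<close>, the mixed
  terms of \<open>\<Phi>\<close> contain \<open>h F\<close> and vanish. With
  \<open>h \<delta> F = F - \<iota>\<close> and \<open>\<iota> \<pi> F = \<iota>\<close>, the other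
  two are \<open>(F - \<iota>) \<otimes> F + \<iota> \<otimes> (F - \<iota>)\<close>, which
  telescopes to \<open>F \<otimes> F - \<iota> \<otimes> \<iota>\<close>. This is the equation that
  \<open>\<Delta> (F z)\<close> satisfies, and the difference of the two solutions is a fixed point
  of \<open>\<Phi>\<close>.\<close>

lemma F_morphism:
  assumes z: "z \<in> W.T.G"
  shows "\<Delta> (F z) = t2map A F F (deconcat s W z)"
proof -
  let ?U = "deconcat s W z"
  have U: "?U \<in> T2 B" by (rule W.deconcat_T2[OF z])
  have Fz: "F z \<in> V.T.G" by (rule lmap_in[OF L_F z])
  have \<delta>Fz: "\<delta> (F z) \<in> V.T.G" by (rule lmap_in[OF L_\<delta> Fz])
  have X: "\<Delta> (F z) = t2map A \<iota> \<iota> ?U + \<Phi> (\<Delta> (F z))"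
  proof -
    have "\<Delta> (F z) = \<Delta> (\<iota> z + h (\<delta> (F z)))" using F_fix[OF z] by (rule arg_cong)
    also have "\<dots> = t2map A \<iota> \<iota> ?U + \<Phi> (\<Delta> (F z))"
      unfolding flin_add[OF flin_deconcat] V.deconcat_tmap[OF W_graded g_i z] h_coder[OF \<delta>Fz] \<delta>_coder[OF Fz] ..
    finally show ?thesis .
  qed
  let ?Y = "t2map A F F ?U"
  note L_\<delta>F = lmap_comp[OF L_F L_\<delta>] and L_h\<delta>F = lmap_comp[OF lmap_comp[OF L_F L_\<delta>] L_h]
    and L_kF = lmap_comp[OF L_F L_kT]
  have FG: "y \<in> W.T.G \<Longrightarrow> F y \<in> V.T.G" for y by (rule lmap_in[OF L_F])
  have \<Theta>Y: "\<Theta> ?Y = t2map A (\<lambda>y. \<delta> (F y)) F ?U + t2map A (\<lambda>y. V.kT (F y)) (\<lambda>y. \<delta> (F y)) ?U"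
    by (simp only: t2map_comp[OF U L_F L_F L_\<delta> lmap_id(1)] t2map_comp[OF U L_F L_F L_kT L_\<delta>])
  have "\<Phi> ?Y = t2map A (\<lambda>y. h (\<delta> (F y))) F ?U + t2map A (\<lambda>y. h (V.kT (F y))) (\<lambda>y. \<delta> (F y)) ?U +
      (t2map A (\<lambda>y. \<rho> (\<delta> (F y))) (\<lambda>y. h (F y)) ?U + t2map A (\<lambda>y. \<rho> (V.kT (F y))) (\<lambda>y. h (\<delta> (F y))) ?U)"
    by (simp only: \<Theta>Y flin_add[OF flin_t2map] t2map_comp[OF U L_\<delta>F L_F L_h lmap_id(1)]
        t2map_comp[OF U L_kF L_\<delta>F L_h lmap_id(1)] t2map_comp[OF U L_\<delta>F L_F L_\<rho> L_h]
        t2map_comp[OF U L_kF L_\<delta>F L_\<rho> L_h])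
  moreover have "t2map A (\<lambda>y. h (V.kT (F y))) (\<lambda>y. \<delta> (F y)) ?U = 0"
    by (rule t2map_zero_left[OF U L_\<delta>F]) (simp add: h_kT FG h_F)
  moreover have "t2map A (\<lambda>y. \<rho> (\<delta> (F y))) (\<lambda>y. h (F y)) ?U = 0"
    by (rule t2map_zero_right[OF U lmap_comp[OF L_\<delta>F L_\<rho>]]) (rule h_F)
  moreover have hdF: "h (\<delta> (F y)) = F y - \<iota> y" if "y \<in> W.T.G" for y
    by (rule eq_diff_eq[THEN iffD2], subst add.commute, rule F_fix[OF that, symmetric])
  have "t2map A (\<lambda>y. h (\<delta> (F y))) F ?U = t2map A F F ?U - t2map A \<iota> F ?U"
    unfolding t2map_minus_left[OF U L_F L_\<iota> L_F, symmetric]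
    by (rule t2map_cong[OF U lmap_sub[OF L_F L_\<iota>] L_F]) (simp_all add: hdF)
  moreover have "t2map A (\<lambda>y. \<rho> (V.kT (F y))) (\<lambda>y. h (\<delta> (F y))) ?U = t2map A \<iota> F ?U - t2map A \<iota> \<iota> ?U"
    unfolding t2map_minus_right[OF U L_\<iota> L_F L_\<iota>, symmetric]
    by (rule t2map_cong[OF U L_\<iota> lmap_sub[OF L_F L_\<iota>]])
      (simp_all add: hdF V.T.koszul_koszul FG \<pi>_F)
  ultimately have Y: "?Y = t2map A \<iota> \<iota> ?U + \<Phi> ?Y" by simp
  have "\<Delta> (F z) - ?Y = \<Phi> (\<Delta> (F z)) - \<Phi> ?Y"
    by (subst X, subst (1) Y) (simp only: add_diff_cancel_left)
  then have "\<Delta> (F z) - ?Y = \<Phi> (\<Delta> (F z) - ?Y)"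
    unfolding flin_diff[OF flin_\<Phi>] .
  moreover have "\<Delta> (F z) - ?Y \<in> T2 A"
    by (intro T2_closed V.deconcat_T2[OF Fz] t2map_T2[OF U L_F L_F])
  ultimately have "\<Delta> (F z) - ?Y = 0" using \<Phi>_unique by blast
  then show ?thesis by simp
qed

text \<open>\<open>\<pi>\<close> is a coalgebra morphism. In the coproduct of
  \<open>\<delta> (F z)\<close> it turns a factor \<open>\<delta> F\<close> into \<open>D\<close>,
  and the factor without \<open>\<delta>\<close> into the identity or the sign operator because
  \<open>\<pi> F\<close> is the identity.\<close>

lemma D_coder:
  assumes z: "z \<in> W.T.G"
  shows "deconcat s W (D z) = t2map B D (\<lambda>x. x) (deconcat s W z) + t2map B W.kT D (deconcat s W z)"
proof -
  let ?U = "deconcat s W z"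
  have U: "?U \<in> T2 B" by (rule W.deconcat_T2[OF z])
  have Fz: "F z \<in> V.T.G" by (rule lmap_in[OF L_F z])
  have FG: "y \<in> W.T.G \<Longrightarrow> F y \<in> V.T.G" for y by (rule lmap_in[OF L_F])
  note L_\<delta>F = lmap_comp[OF L_F L_\<delta>] and L_kF = lmap_comp[OF L_F L_kT]
  have \<Theta>Y: "\<Theta> (t2map A F F ?U) = t2map A (\<lambda>y. \<delta> (F y)) F ?U + t2map A (\<lambda>y. V.kT (F y)) (\<lambda>y. \<delta> (F y)) ?U"
    by (simp only: t2map_comp[OF U L_F L_F L_\<delta> lmap_id(1)] t2map_comp[OF U L_F L_F L_kT L_\<delta>])
  have "deconcat s W (D z) = t2map B \<pi> \<pi> (\<Theta> (t2map A F F ?U))"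
    unfolding D_eq[OF z] W.deconcat_tmap[OF V.graded_space g_p lmap_in[OF L_\<delta> Fz]] \<delta>_coder[OF Fz]
      F_morphism[OF z] ..
  also have "\<dots> = t2map B (\<lambda>y. \<pi> (\<delta> (F y))) (\<lambda>y. \<pi> (F y)) ?U +
      t2map B (\<lambda>y. \<pi> (V.kT (F y))) (\<lambda>y. \<pi> (\<delta> (F y))) ?U"
    by (simp only: \<Theta>Y flin_add[OF flin_t2map] t2map_comp[OF U L_\<delta>F L_F L_\<pi> L_\<pi>]
        t2map_comp[OF U L_kF L_\<delta>F L_\<pi> L_\<pi>])
  moreover have "t2map B (\<lambda>y. \<pi> (\<delta> (F y))) (\<lambda>y. \<pi> (F y)) ?U = t2map B D (\<lambda>x. x) ?U"
    by (rule t2map_cong[OF U L_D lmap_id(1)]) (simp_all add: D_eq \<pi>_F)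
  moreover have "t2map B (\<lambda>y. \<pi> (V.kT (F y))) (\<lambda>y. \<pi> (\<delta> (F y))) ?U = t2map B W.kT D ?U"
    by (rule t2map_cong[OF U L_kW L_D]) (simp_all add: D_eq \<pi>_F \<pi>_kT FG)
  ultimately show ?thesis by simp
qed

lemma L_R: "lmap B B R"
  by (rule lmap_plus[OF L_dW L_D])

lemma graded_R: "graded_map fscale 1 B B R"
  unfolding graded_map_def
proof (intro conjI allI image_subsetI)
  fix n z assume z: "z \<in> B n"
  have "dW ` B n \<subseteq> B (n + 1)" "D ` B n \<subseteq> B (n + 1)"
    using graded_dW graded_D unfolding graded_map_def by blast+
  then show "R z \<in> B (n + 1)" using z by (auto intro!: fs.subspace_add[OF W.T.subspace_V])
qed (rule lmap_lin[OF L_R])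

lemma R_coder:
  assumes z: "z \<in> W.T.G"
  shows "deconcat s W (R z) = t2map B R (\<lambda>x. x) (deconcat s W z) + t2map B W.kT R (deconcat s W z)"
proof -
  let ?U = "deconcat s W z"
  have U: "?U \<in> T2 B" by (rule W.deconcat_T2[OF z])
  have k: "t2map B (tmap s W (koszul s W 1)) dW ?U = t2map B W.kT dW ?U"
    by (rule t2map_cong[OF U L_kW L_dW]) (simp_all add: W.koszul_T)
  show ?thesis
    unfolding flin_add[OF flin_deconcat] D_coder[OF z] W.deconcat_tder[OF W.graded_map_koszul_self g_dW z] k
      t2map_plus_left[OF U L_dW L_D lmap_id(1)] t2map_plus_right[OF U L_kW L_dW L_D]
    by (simp add: algebra_simps)
qed

section \<open>Restriction to symmetric tensors, and the equations for the differentials\<close>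

lemma F_S: "z \<in> W.S \<Longrightarrow> F z \<in> V.S"
  by (rule V.morphism_symmetric[OF W_graded graded_F F_morphism])

lemma D_S: "z \<in> W.S \<Longrightarrow> D z \<in> W.S"
  by (rule W.coderivation_symmetric[OF graded_D D_coder])

lemma R_S: "z \<in> W.S \<Longrightarrow> R z \<in> W.S"
  by (rule W.coderivation_symmetric[OF graded_R R_coder])

lemma Q_S: "z \<in> V.S \<Longrightarrow> Q z \<in> V.S"
  by (rule V.coderivation_symmetric[OF graded_Q Q_coder])

lemma Q_F:
  assumes z: "z \<in> W.S"
  shows "Q (F z) = F (R z)"
proof -
  have zT: "z \<in> W.T.G" by (rule W.S_T[OF z])
  have RzT: "R z \<in> W.T.G" by (rule lmap_in[OF L_R zT])
  have Fz: "F z \<in> V.T.G" by (rule lmap_in[OF L_F zT])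
  have \<delta>Fz: "\<delta> (F z) \<in> V.T.G" by (rule lmap_in[OF L_\<delta> Fz])
  have dFz: "dV (F z) \<in> V.T.G" by (rule lmap_in[OF L_dV Fz])
  have QFz: "Q (F z) \<in> V.T.G" by (rule lmap_in[OF L_Q Fz])
  have Qe: "Q y = dV y + \<delta> y" if "y \<in> V.T.G" for y using \<delta>_eq[OF that] by simp
  \<comment> \<open>\<open>F z\<close> is symmetric, so the square of \<open>Q\<close> vanishes on
    it. Expanding the outer \<open>Q\<close>, and then \<open>dV\<close> of the inner one, yields a
    formula for \<open>dV (\<delta> (F z))\<close>.\<close>
  have "0 = Q (Q (F z))" using Q_square[OF F_S[OF z]] by simp
  also have "\<dots> = dV (dV (F z) + \<delta> (F z)) + \<delta> (Q (F z))" using Qe[OF QFz] Qe[OF Fz] by simp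
  also have "\<dots> = dV (\<delta> (F z)) + \<delta> (Q (F z))"
    by (simp add: flin_add[OF flin_tder] dV_dV[OF V.T_Tens[OF Fz]])
  finally have d\<delta>: "dV (\<delta> (F z)) = - \<delta> (Q (F z))" by (simp add: eq_neg_iff_add_eq_0)
  have "dV (F z) = dV (\<iota> z + h (\<delta> (F z)))" using F_fix[OF zT] by (rule arg_cong)
  also have "\<dots> = \<iota> (dW z) + dV (h (\<delta> (F z)))"
    by (simp only: flin_add[OF flin_tder] dV_\<iota>[OF W.T_Tens[OF zT]])
  finally have 1: "dV (F z) = \<iota> (dW z) + dV (h (\<delta> (F z)))" .
  \<comment> \<open>The homotopy identity at \<open>\<delta> (F z)\<close>; its term
    \<open>\<iota> \<pi> \<delta> F\<close> is where \<open>D z\<close> appears.\<close>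
  have 2: "dV (h (\<delta> (F z))) = \<iota> (D z) - \<delta> (F z) - h (dV (\<delta> (F z)))"
    using homotopy[OF V.T_Tens[OF \<delta>Fz]] unfolding D_eq[OF zT] by (simp add: eq_diff_eq diff_eq_eq add.commute)
  have 3: "h (dV (\<delta> (F z))) = - h (\<delta> (Q (F z)))" unfolding d\<delta> flin_minus[OF flin_tder] ..
  have 4: "dV (F z) = \<iota> (dW z) + (\<iota> (D z) - \<delta> (F z) - - h (\<delta> (Q (F z))))"
    by (rule trans[OF 1]) (unfold 2 3, rule refl)
  \<comment> \<open>\<open>F (R z)\<close> satisfies the same equation
    \<open>x = \<iota> (R z) + h (\<delta> x)\<close>, by \<open>F_fix\<close>. Thus the difference
    \<open>?E\<close> below is fixed by \<open>h \<delta>\<close>.\<close>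
  have QF: "Q (F z) = \<iota> (R z) + h (\<delta> (Q (F z)))"
  proof (rule trans[OF Qe[OF Fz]], rule trans[OF arg_cong[where f = "\<lambda>x. x + \<delta> (F z)", OF 4]])
    have *: "a + (b - c - - e) + c = (a + b) + e" for a b c e :: "('k, 'v) tensor"
      by (simp add: algebra_simps)
    show "\<iota> (dW z) + (\<iota> (D z) - \<delta> (F z) - - h (\<delta> (Q (F z)))) + \<delta> (F z) = \<iota> (R z) + h (\<delta> (Q (F z)))"
      unfolding flin_add[OF V.flin_tmap] by (rule *)
  qed
  let ?E = "Q (F z) - F (R z)"
  have FR: "F (R z) \<in> V.T.G" by (rule lmap_in[OF L_F RzT])
  have ET: "?E \<in> V.T.G" by (rule gtot_closed(3)[OF QFz FR])
  have E: "?E = h (\<delta> ?E)"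
  proof -
    have "?E = h (\<delta> (Q (F z))) - h (\<delta> (F (R z)))"
      by (subst QF, subst F_fix[OF RzT]) (simp only: add_diff_cancel_left)
    then show ?thesis using lmap_diff[OF L_h\<delta> QFz FR] by simp
  qed
  have fixp: "((h \<circ> \<delta>) ^^ n) x = x" if "h (\<delta> x) = x" for x n
    by (induction n) (simp_all add: that)
  obtain N where N: "?E \<in> Tle s V N" using Tbar_Tle[OF ET] by blast
  \<comment> \<open>\<open>?E\<close> equals its own \<open>N\<close>-fold image, and
    \<open>N\<close> applications exhaust its length bound.\<close>
  have "((h \<circ> \<delta>) ^^ N) ?E \<in> {0}" using funpow_Tle[OF N, of N] by (simp only: diff_self_eq_0 Tle_0)
  then have "?E = 0" unfolding fixp[OF E[symmetric]] by (rule singletonD)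
  then show ?thesis by simp
qed

lemma R_R:
  assumes z: "z \<in> W.S"
  shows "R (R z) = 0"
proof -
  have Rz: "R z \<in> W.S" by (rule R_S[OF z])
  have "F (R (R z)) = Q (Q (F z))" by (simp only: Q_F[OF z] Q_F[OF Rz])
  also have "\<dots> = 0" by (rule Q_square[OF F_S[OF z]])
  finally have "\<pi> (F (R (R z))) = 0" by (simp add: flin_zero[OF V.flin_tmap])
  then show ?thesis using \<pi>_F[OF W.S_T[OF R_S[OF Rz]]] by simp
qed

text \<open>The homogeneous parts of \<open>Sbar\<close> are the invariant elements of those of
  \<open>Tbar\<close>, so degree and symmetry can be checked separately.\<close>

lemma graded_map_S:
  assumes M: "graded_space s M" and N: "graded_space s N"
    and f: "graded_map fscale e (Tbar s M) (Tbar s N) f"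
    and S: "\<And>z. z \<in> gtot fscale (Sbar s M) \<Longrightarrow> f z \<in> gtot fscale (Sbar s N)"
  shows "graded_map fscale e (Sbar s M) (Sbar s N) f"
proof -
  interpret M: tensor_powers s M using M by unfold_locales
  interpret N: tensor_powers s N using N by unfold_locales
  have lin: "lin_on fscale fscale M.T.G f" and deg: "f ` Tbar s M n \<subseteq> Tbar s N (n + e)" for n
    using f unfolding graded_map_def by blast+
  have "z \<in> Sbar s M n \<Longrightarrow> f z \<in> Sbar s N (n + e)" for z n
  proof -
    assume z: "z \<in> Sbar s M n"
    then have "z \<in> M.S" unfolding gtot_def by (blast intro: fs.span_base)
    from S[OF this] have "tinv s N (f z)" by (simp add: N.S_iff)
    moreover have "f z \<in> Tbar s N (n + e)" using deg z by (auto simp: M.Sbar_iff)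
    ultimately show ?thesis by (simp add: N.Sbar_iff)
  qed
  moreover have "lin_on fscale fscale M.S f" by (rule lin_on_subset[OF lin]) (use M.S_T in blast)
  ultimately show ?thesis unfolding graded_map_def by blast
qed

lemma codifferential_R: "codifferential fscale B (deconcat s W) (Sbar s W) R"
  unfolding codifferential_def coderivation_def
proof (intro conjI ballI)
  show "graded_map fscale 1 (Sbar s W) (Sbar s W) R"
    by (rule graded_map_S[OF W_graded W_graded graded_R R_S])
  fix z assume z: "z \<in> W.S"
  show "R (R z) = 0" by (rule R_R[OF z])
  show "deconcat s W (R z) = tmap2 fscale B B 0 R id (deconcat s W z) + tmap2 fscale B B 1 id R (deconcat s W z)"
    unfolding t2map_koszul[OF W.T.graded_space L_R W.deconcat_T2[OF W.S_T[OF z]]]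
    by (rule R_coder[OF W.S_T[OF z]])
qed

text \<open>The target differential is the function \<open>d + \<delta>\<close>, which agrees with
  \<open>Q\<close> on tensors but possibly not elsewhere in the function space; each condition is
  therefore transported along that restricted equality.\<close>

lemma codifferential_V: "codifferential fscale A \<Delta> (Sbar s V) (\<lambda>z. d z + \<delta> z)"
proof -
  let ?Q = "\<lambda>z. d z + \<delta> z"
  have eq: "?Q z = Q z" if "z \<in> V.T.G" for z using Q_decomp[OF that] by simp
  have L: "lmap A A ?Q"
    using L_Q unfolding lmap_def lin_on_def by (simp add: eq gtot_closed)
  have gQ: "graded_map fscale 1 (Sbar s V) (Sbar s V) Q"
    by (rule graded_map_S[OF V.graded_space V.graded_space graded_Q Q_S])
  have SV: "z \<in> Sbar s V n \<Longrightarrow> z \<in> V.T.G" for z n using V.Sbar_iff V.T.V_G by blast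
  show ?thesis
    unfolding codifferential_def coderivation_def
  proof (intro conjI ballI)
    show "graded_map fscale 1 (Sbar s V) (Sbar s V) ?Q"
      unfolding graded_map_def
    proof (intro conjI allI image_subsetI)
      show "lin_on fscale fscale V.S ?Q"
        by (rule lin_on_subset[OF lmap_lin[OF L]]) (use V.S_T in blast)
      show "z \<in> Sbar s V n \<Longrightarrow> ?Q z \<in> Sbar s V (n + 1)" for z n
        using gQ eq[OF SV] unfolding graded_map_def by (metis image_subset_iff)
    qed
    fix z assume z: "z \<in> V.S"
    note zT = V.S_T[OF z] and Z = V.deconcat_T2[OF V.S_T[OF z]]
    show "?Q (?Q z) = 0"
      using Q_square[OF z] eq[OF zT] eq[OF lmap_in[OF L_Q zT]] by metis
    have "t2map A ?Q (\<lambda>x. x) (\<Delta> z) = t2map A Q (\<lambda>x. x) (\<Delta> z)"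
      by (rule t2map_cong[OF Z L_Q lmap_id(1) eq refl])
    moreover have "t2map A V.kT ?Q (\<Delta> z) = t2map A V.kT Q (\<Delta> z)"
      by (rule t2map_cong[OF Z L_kT L_Q refl eq])
    ultimately show "\<Delta> (?Q z) = tmap2 fscale A A 0 ?Q id (\<Delta> z) + tmap2 fscale A A 1 id ?Q (\<Delta> z)"
      unfolding t2map_koszul[OF V.T.graded_space L Z] eq[OF zT] using Q_coder[OF zT] by metis
  qed
qed

lemma F_dg_morphism:
  "dg_coalgebra_morphism fscale B (deconcat s W) (Sbar s W) R A \<Delta> (Sbar s V) (\<lambda>z. d z + \<delta> z) F"
  unfolding dg_coalgebra_morphism_def coalgebra_morphism_def
proof (intro conjI ballI codifferential_R codifferential_V)
  show "graded_map fscale 0 (Sbar s W) (Sbar s V) F"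
    by (rule graded_map_S[OF W_graded V.graded_space graded_F F_S])
  fix z assume z: "z \<in> W.S"
  note zT = W.S_T[OF z]
  show "F (R z) = d (F z) + \<delta> (F z)"
    using Q_F[OF z] Q_decomp[OF lmap_in[OF L_F zT]] by simp
  show "\<Delta> (F z) = tmap2 fscale B A 0 F F (deconcat s W z)"
    unfolding tmap2_t2map F_morphism[OF zT]
    by (rule t2map_cong[OF W.deconcat_T2[OF zT] L_F L_F, symmetric]) (simp_all add: W.T.koszul_zero_degree)
qed

text \<open>Term by term, \<open>\<delta>\<close> after \<open>n\<close> copies of
  \<open>h \<delta>\<close> is \<open>n\<close> copies of \<open>\<delta> h\<close> after
  \<open>\<delta>\<close>.\<close>

lemma D_alt: "D z = Sum_any (\<lambda>n. \<pi> (((\<delta> \<circ> h) ^^ n) (\<delta> (\<iota> z))))"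
proof -
  have "\<delta> (step n z) = ((\<delta> \<circ> h) ^^ n) (\<delta> (\<iota> z))" for n
    by (induction n) (simp_all add: step_0 step_Suc)
  then show ?thesis unfolding D_def by simp
qed

lemma finite_steps: "z \<in> W.T.G \<Longrightarrow> finite {n. step n z \<noteq> 0}"
proof -
  assume "z \<in> W.T.G"
  then obtain N where "z \<in> Tle s W N" using Tbar_Tle by blast
  then have "n < N" if "step n z \<noteq> 0" for n using that step_zero[of z N n] by (cases "N \<le> n") auto
  then have "{n. step n z \<noteq> 0} \<subseteq> {..<N}" by blast
  then show ?thesis by (rule finite_subset) simp
qed

end

theorem theorem6p1:
  fixes s :: "'k::field_char_0 \<Rightarrow> 'v::ab_group_add \<Rightarrow> 'v"
    and V W :: "int \<Rightarrow> 'v set"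
    and Q d \<delta> \<iota> \<pi> h D \<iota>\<delta> dW :: "('k, 'v) tensor \<Rightarrow> ('k, 'v) tensor"
    and d1 i p k :: "'v \<Rightarrow> 'v"
  assumes V: "graded_space s V"
    and Q: "coderivation fscale (Tbar s V) (deconcat s V) (Tbar s V) Q"
    and d_lin: "lin_on fscale fscale (gtot fscale (Tbar s V)) d"
    and \<delta>_lin: "lin_on fscale fscale (gtot fscale (Tbar s V)) \<delta>"
    and Q_decomp: "\<And>z. z \<in> gtot fscale (Tbar s V) \<Longrightarrow> Q z = d z + \<delta> z"
    and d_length: "\<And>n. n \<ge> 1 \<Longrightarrow> d ` gtot fscale (tpow s V n) \<subseteq> gtot fscale (tpow s V n)"
    and \<delta>_length: "\<And>n. n \<ge> 1 \<Longrightarrow> \<delta> ` gtot fscale (tpow s V n)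
           \<subseteq> module.span fscale (\<Union>m\<in>{1..<n}. gtot fscale (tpow s V m))"
    and Q_square: "\<And>z. z \<in> gtot fscale (Sbar s V) \<Longrightarrow> Q (Q z) = 0"
    and d1: "\<And>v. v \<in> gtot s V \<Longrightarrow> d1 v \<in> gtot s V \<and> Q (tens s V [v]) = tens s V [d1 v]"
    and W_sub: "graded_subspace s W V"
    and W_dg: "\<And>n. d1 ` W n \<subseteq> W (n + 1)"
    and i: "i = (\<lambda>w. w)"
    and contr: "contraction s W d1 V d1 i p k"
    and \<iota>: "\<iota> = tmap s V i"
    and \<pi>: "\<pi> = tmap s W p"
    and h: "h = thomotopy s V i p k"
    and dW: "dW = tdiff s W d1"
    and D: "D = (\<lambda>z. Sum_any (\<lambda>n. \<pi> (\<delta> (((h \<circ> \<delta>) ^^ n) (\<iota> z)))))"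
    and \<iota>\<delta>: "\<iota>\<delta> = (\<lambda>z. Sum_any (\<lambda>n. ((h \<circ> \<delta>) ^^ n) (\<iota> z)))"
  shows "(\<forall>z\<in>gtot fscale (Tbar s W). finite {n. ((h \<circ> \<delta>) ^^ n) (\<iota> z) \<noteq> 0})
    \<and> (\<forall>z\<in>gtot fscale (Tbar s W). D z = Sum_any (\<lambda>n. \<pi> (((\<delta> \<circ> h) ^^ n) (\<delta> (\<iota> z)))))
    \<and> graded_map fscale 1 (Tbar s W) (Tbar s W) D
    \<and> graded_map fscale 0 (Tbar s W) (Tbar s V) \<iota>\<delta>
    \<and> D ` gtot fscale (Sbar s W) \<subseteq> gtot fscale (Sbar s W)
    \<and> \<iota>\<delta> ` gtot fscale (Sbar s W) \<subseteq> gtot fscale (Sbar s V)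
    \<and> codifferential fscale (Tbar s W) (deconcat s W) (Sbar s W) (\<lambda>z. dW z + D z)
    \<and> dg_coalgebra_morphism fscale
        (Tbar s W) (deconcat s W) (Sbar s W) (\<lambda>z. dW z + D z)
        (Tbar s V) (deconcat s V) (Sbar s V) (\<lambda>z. d z + \<delta> z) \<iota>\<delta>"
proof -
  interpret X: transfer s V W Q d \<delta> d1 p k
    by (unfold_locales; (rule V)?) (use Q d_lin \<delta>_lin Q_decomp d_length \<delta>_length Q_square d1 contr in \<open>auto simp: i\<close>)
  \<comment> \<open>\<open>thomotopy\<close> uses the sign of degree -1, which coincides with that
    of degree 1, and \<open>i\<close> is the identity function.\<close>
  have h': "h = tder s V (\<lambda>x. p (koszul s V 1 x)) k"
    by (simp add: h i thomotopy_tder X.V.koszul_neg_one)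
  have dW': "dW = tder s W (koszul s W 1) d1" by (simp add: dW tdiff_tder)
  have step: "((h \<circ> \<delta>) ^^ n) (\<iota> z) = X.step n z" for n z
    by (simp only: X.step_def h' \<iota> i)
  have \<iota>\<delta>': "\<iota>\<delta> = X.F" unfolding \<iota>\<delta> step X.F_def by (rule refl)
  have D': "D = X.D" unfolding D step X.D_def \<pi> by (rule refl)
  have alt: "X.D z = Sum_any (\<lambda>n. \<pi> (((\<delta> \<circ> h) ^^ n) (\<delta> (\<iota> z))))" for z
    unfolding X.D_alt by (simp only: h' \<pi> \<iota> i)
  show ?thesis
    unfolding \<iota>\<delta>' D' dW' step
    using X.finite_steps alt X.graded_D X.graded_F X.D_S X.F_S X.codifferential_R X.F_dg_morphism
    by (intro conjI ballI image_subsetI) auto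
qed

end
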